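(* Let $\Sigma=\{1,\dots,\mathfrak r\}$ be a finite set, let $(P_n)_{n\ge1}$ be stochastic matrices on $\Sigma$ converging entrywise to a stochastic matrix $P$, let $\pi$ be a probability distribution on $\Sigma$, let $\mathbb P_\pi$ be the law of the nonhomogeneous Markov chain with initial distribution $\pi$ and transition matrices $(P_n)$, let $f:\Sigma\to\mathbb R^d$ ($d\ge1$) and $Z_n=\frac1n\sum_{i=1}^nf(X_i)$. Then the function $\mathbb J_{\mathcal U_0}$ (defined in the context) is a good rate function, and for every Borel set $\Gamma\subset\mathbb R^d$, with closure $\overline\Gamma$, $$\limsup_{n\to\infty}\frac1n\log\mathbb P_\pi(Z_n\in\overline\Gamma)\le-\inf_{z\in\overline\Gamma}\mathbb J_{\mathcal U_0}(z).$$
   Context: Conventions: $\pm\infty\cdot0=0$, $\log0=-\infty$, $\inf\varnothing=+\infty$. A good rate function on $\mathbb R^d$ is a lower semicontinuous function $\mathbb R^d\to[0,\infty]$ with compact level sets $\{x:\cdot\le a\}$, $a\in\mathbb R$. Chain: $P=(p(i,j))$, $P_n=(p_n(i,j))$. Under $\mathbb P_\pi$, $X_0\sim\pi$ and $\mathbb P_\pi(X_{n+1}=j\mid X_0,\dots,X_{n-1},X_n=i)=p_{n+1}(i,j)$, $n\ge0$. Decomposition of $P$: let $C_1,\dots,C_{N+M}$ be the communicating classes of $P$ (states $x,y$ are in the same class iff $x=y$ or each is reachable from the other with positive $P$-probability), numbered so that $p(x,y)=0$ for $x\in C_i,y\in C_j,i>j$. Put $P(i)=(p(x,y))_{x,y\in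 C_i}$. Each $P(i)$ is either the $1\times1$ zero matrix (degenerate transient; the set of such $i$ is $\mathcal D$, $|\mathcal D|=N$) or irreducible; $\mathcal G$ is the set of $i$ with $P(i)$ irreducible (either a nondegenerate transient class or a closed, i.e. stochastic, class), $|\mathcal G|=M\ge1$, enumerated as $\mathcal G=\{\zeta_1,\dots,\zeta_M\}$. Rate functions: for $i\in\mathcal G$ and $\lambda\in\mathbb R^d$ let $\rho(C_i,\lambda)$ be the Perron–Frobenius eigenvalue of the matrix $(p(x,y)e^{\langle\lambda,f(y)\rangle})_{x,y\in C_i}$ and $\mathbb I_i(x)=\sup_{\lambda\in\mathbb R^d}\{\langle\lambda,x\rangle-\log\rho(C_i,\lambda)\}$. Function $\mathbb J_U$: $\mathbb S_M$ is the set of permutations of $\{1,\dots,M\}$, $\Omega_M$ the set of probability vectors in $\mathbb R^M$, and $D(M,\mathbf v,z)=\{\mathbf x=\langle x_1,\dots,x_M\rangle\in(\mathbb R^d)^M:\sum_{i=1}^Mv_ix_i=z\}$. For a cost $U=\{u(i,j)\}$ with entries in $[-\infty,0]$ defined for distinct $i,j\in\mathcal G$, put $$C_{\mathbf v,U}(\sigma,\mathbf x)=-\sum_{i=1}^{M-1}\Big(\sum_{j=1}^iv_j\Big)u(\zeta_{\sigma(i)},\zeta_{\sigma(i+1)})+\sum_{i=1}^Mv_i\mathbb I_{\zeta_{\sigma(i)}}(x_i)$$ if $M\ge2$, and $C_{\mathbf v,U}(\sigma,\mathbf x)=\mathbb I_{\zeta_1}(x_1)$ if $M=1$; then $$\mathbb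 J_U(z)=\inf_{\mathbf v\in\Omega_M}\ \inf_{\mathbf x\in D(M,\mathbf v,z)}\ \min_{\sigma\in\mathbb S_M}C_{\mathbf v,U}(\sigma,\mathbf x).$$ Upper cost: for distinct $1\le i,j\le N+M$ let $t(n,(i,j))=\max_{x\in C_i,y\in C_j}p_n(x,y)$, $\upsilon(i,j)=\limsup_n\frac1n\log t(n,(i,j))$, and $$\mathcal U_0(i,j)=\max_{0\le k\le N+M-2}\ \max_{L_k}\ \sum_{s=0}^k\upsilon(l_s,l_{s+1}),$$ where $L_k=\langle l_0,l_1,\dots,l_{k+1}\rangle$ ranges over $(k+2)$-tuples of distinct indices in $\{1,\dots,N+M\}$ with $l_0=i$, $l_{k+1}=j$. *)

theory Defs
  imports "HOL-Analysis.Analysis" "HOL-Combinatorics.Permutations" "HOL-Probability.Probability"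
begin

text \<open>
  Logarithm on the nonnegative reals with the convention \<open>log 0 = -\<infinity>\<close>
  (the library has \<open>ln 0 = 0\<close>). The other conventions, \<open>\<plusminus>\<infinity> * 0 = 0\<close> and \<open>Inf {} = \<infinity>\<close>, are
  those of the type \<open>ereal\<close>.
\<close>

definition elog :: "real \<Rightarrow> ereal" where
  "elog x = (if x = 0 then - \<infinity> else ereal (ln x))"

definition lower_semicontinuous :: "('a::topological_space \<Rightarrow> ereal) \<Rightarrow> bool" where
  "lower_semicontinuous I \<longleftrightarrow> (\<forall>x. I x \<le> Liminf (at x) I)"

definition good_rate_function :: "('a::topological_space \<Rightarrow> ereal) \<Rightarrow> bool" where
  "good_rate_function I \<longleftrightarrow>
     (\<forall>x. 0 \<le> I x) \<and> lower_semicontinuous I \<and> (\<forall>a::real. compact {x. I x \<le> ereal a})"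

definition prob_vector :: "('s::finite \<Rightarrow> real) \<Rightarrow> bool" where
  "prob_vector p \<longleftrightarrow> (\<forall>x. 0 \<le> p x) \<and> (\<Sum>x\<in>UNIV. p x) = 1"

definition stochastic :: "('s::finite \<Rightarrow> 's \<Rightarrow> real) \<Rightarrow> bool" where
  "stochastic P \<longleftrightarrow> (\<forall>x. prob_vector (P x))"

text \<open>
  The step from time \<open>n\<close> to time \<open>n + 1\<close> uses \<open>Pn (n + 1)\<close>, so \<open>Pn 0\<close> plays no role.
  The transition law is prescribed only after histories of positive probability.
\<close>

definition nonhomogeneous_markov_chain ::
  "'w measure \<Rightarrow> (nat \<Rightarrow> 'w \<Rightarrow> 's) \<Rightarrow> ('s::finite \<Rightarrow> real) \<Rightarrow> (nat \<Rightarrow> 's \<Rightarrow> 's \<Rightarrow> real) \<Rightarrow> bool" where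
  "nonhomogeneous_markov_chain Pr X \<pi> Pn \<longleftrightarrow>
     prob_space Pr \<and>
     (\<forall>n. X n \<in> measurable Pr (count_space UNIV)) \<and>
     (\<forall>x. \<P>(\<omega> in Pr. X 0 \<omega> = x) = \<pi> x) \<and>
     (\<forall>n x j. \<P>(\<omega> in Pr. \<forall>k\<le>n. X k \<omega> = x k) > 0 \<longrightarrow>
        \<P>(\<omega> in Pr. X (Suc n) \<omega> = j \<bar> \<forall>k\<le>n. X k \<omega> = x k) = Pn (Suc n) (x n) j)"

definition sample_mean :: "('s \<Rightarrow> real ^ 'd) \<Rightarrow> (nat \<Rightarrow> 'w \<Rightarrow> 's) \<Rightarrow> nat \<Rightarrow> 'w \<Rightarrow> real ^ 'd" where
  "sample_mean f X n \<omega> = (1 / real n) *\<^sub>R (\<Sum>i=1..n. f (X i \<omega>))"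

definition transitions :: "('s \<Rightarrow> 's \<Rightarrow> real) \<Rightarrow> ('s \<times> 's) set" where
  "transitions P = {(x, y). P x y > 0}"

definition communicating :: "('s \<Rightarrow> 's \<Rightarrow> real) \<Rightarrow> ('s \<times> 's) set" where
  "communicating P =
     {(x, y). x = y \<or> (x, y) \<in> (transitions P)\<^sup>+ \<and> (y, x) \<in> (transitions P)\<^sup>+}"

definition communicating_classes :: "('s \<Rightarrow> 's \<Rightarrow> real) \<Rightarrow> 's set set" where
  "communicating_classes P = UNIV // communicating P"

text \<open>
  Irreducibility of the block of \<open>P\<close> with rows and columns in \<open>C\<close>. Paths have at least one step,
  so the \<open>1 \<times> 1\<close> zero matrix is not irreducible.
\<close>

definition irreducible_block :: "('s \<Rightarrow> 's \<Rightarrow> real) \<Rightarrow> 's set \<Rightarrow> bool" where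
  "irreducible_block P C \<longleftrightarrow> (\<forall>x\<in>C. \<forall>y\<in>C. (x, y) \<in> (transitions P \<inter> C \<times> C)\<^sup>+)"

text \<open>
  \<open>C\<close> numbers the communicating classes by \<open>1, \<dots>, N + M\<close> and \<open>\<zeta>\<close> enumerates the set
  \<open>\<G>\<close> of indices with irreducible block, so that \<open>M = |\<G>|\<close>; the remaining
  \<open>N\<close> indices are those of the degenerate transient classes. For stochastic \<open>P\<close> there is a
  closed class, hence \<open>M \<ge> 1\<close>.
\<close>

definition class_decomposition ::
  "('s \<Rightarrow> 's \<Rightarrow> real) \<Rightarrow> nat \<Rightarrow> nat \<Rightarrow> (nat \<Rightarrow> 's set) \<Rightarrow> (nat \<Rightarrow> nat) \<Rightarrow> bool" where
  "class_decomposition P N M C \<zeta> \<longleftrightarrow>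
     bij_betw C {1..N + M} (communicating_classes P) \<and>
     (\<forall>i\<in>{1..N + M}. \<forall>j\<in>{1..N + M}. i > j \<longrightarrow> (\<forall>x\<in>C i. \<forall>y\<in>C j. P x y = 0)) \<and>
     bij_betw \<zeta> {1..M} {i \<in> {1..N + M}. irreducible_block P (C i)}"

text \<open>
  Eigenvalues of the block of \<open>A\<close> with rows and columns in \<open>C\<close>. The Perron-Frobenius eigenvalue
  is the real eigenvalue that dominates the modulus of every complex eigenvalue; it is
  automatically nonnegative and unique.
\<close>

definition block_eigenvalue :: "'s set \<Rightarrow> ('s \<Rightarrow> 's \<Rightarrow> real) \<Rightarrow> complex \<Rightarrow> bool" where
  "block_eigenvalue C A \<mu> \<longleftrightarrow>
     (\<exists>v :: 's \<Rightarrow> complex. (\<exists>x\<in>C. v x \<noteq> 0) \<and>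
        (\<forall>x\<in>C. (\<Sum>y\<in>C. complex_of_real (A x y) * v y) = \<mu> * v x))"

definition perron_frobenius_eigenvalue :: "'s set \<Rightarrow> ('s \<Rightarrow> 's \<Rightarrow> real) \<Rightarrow> real" where
  "perron_frobenius_eigenvalue C A =
     (THE r. block_eigenvalue C A (complex_of_real r) \<and>
             (\<forall>\<mu>. block_eigenvalue C A \<mu> \<longrightarrow> cmod \<mu> \<le> r))"

definition tilted_eigenvalue ::
  "('s \<Rightarrow> 's \<Rightarrow> real) \<Rightarrow> ('s \<Rightarrow> real ^ 'd) \<Rightarrow> 's set \<Rightarrow> real ^ 'd \<Rightarrow> real" where
  "tilted_eigenvalue P f C \<theta> =
     perron_frobenius_eigenvalue C (\<lambda>x y. P x y * exp (\<theta> \<bullet> f y))"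

definition class_rate ::
  "('s \<Rightarrow> 's \<Rightarrow> real) \<Rightarrow> ('s \<Rightarrow> real ^ 'd) \<Rightarrow> 's set \<Rightarrow> real ^ 'd \<Rightarrow> ereal" where
  "class_rate P f C x = (SUP \<theta>. ereal (\<theta> \<bullet> x) - elog (tilted_eigenvalue P f C \<theta>))"

text \<open>Elements of \<open>\<real>\<^sup>M\<close> and \<open>(\<real>\<^sup>d)\<^sup>M\<close> are functions on \<open>nat\<close>
  of which only the values on \<open>{1..M}\<close> matter.\<close>

definition prob_weights :: "nat \<Rightarrow> (nat \<Rightarrow> real) set" where
  "prob_weights M = {v. (\<forall>i\<in>{1..M}. 0 \<le> v i) \<and> (\<Sum>i=1..M. v i) = 1}"

definition averaging_to :: "nat \<Rightarrow> (nat \<Rightarrow> real) \<Rightarrow> real ^ 'd \<Rightarrow> (nat \<Rightarrow> real ^ 'd) set" where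
  "averaging_to M v z = {x. (\<Sum>i=1..M. v i *\<^sub>R x i) = z}"

text \<open>In the next two definitions \<open>I i\<close> is the rate function of the \<open>i\<close>-th class.\<close>

definition path_cost ::
  "nat \<Rightarrow> (nat \<Rightarrow> nat) \<Rightarrow> (nat \<Rightarrow> real ^ 'd \<Rightarrow> ereal) \<Rightarrow> (nat \<Rightarrow> nat \<Rightarrow> ereal) \<Rightarrow>
   (nat \<Rightarrow> real) \<Rightarrow> (nat \<Rightarrow> nat) \<Rightarrow> (nat \<Rightarrow> real ^ 'd) \<Rightarrow> ereal" where
  "path_cost M \<zeta> I U v \<sigma> x =
     (if M = 1 then I (\<zeta> 1) (x 1)
      else - (\<Sum>i=1..M - 1. ereal (\<Sum>j=1..i. v j) * U (\<zeta> (\<sigma> i)) (\<zeta> (\<sigma> (i + 1))))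
           + (\<Sum>i=1..M. ereal (v i) * I (\<zeta> (\<sigma> i)) (x i)))"

definition rate_J ::
  "nat \<Rightarrow> (nat \<Rightarrow> nat) \<Rightarrow> (nat \<Rightarrow> real ^ 'd \<Rightarrow> ereal) \<Rightarrow> (nat \<Rightarrow> nat \<Rightarrow> ereal) \<Rightarrow>
   real ^ 'd \<Rightarrow> ereal" where
  "rate_J M \<zeta> I U z =
     (INF v\<in>prob_weights M. INF x\<in>averaging_to M v z.
        MIN \<sigma>\<in>{\<sigma>. \<sigma> permutes {1..M}}. path_cost M \<zeta> I U v \<sigma> x)"

definition max_transition ::
  "(nat \<Rightarrow> 's \<Rightarrow> 's \<Rightarrow> real) \<Rightarrow> (nat \<Rightarrow> 's set) \<Rightarrow> nat \<Rightarrow> nat \<Rightarrow> nat \<Rightarrow> real" where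
  "max_transition Pn C n i j = (MAX x\<in>C i. MAX y\<in>C j. Pn n x y)"

definition upper_exponent ::
  "(nat \<Rightarrow> 's \<Rightarrow> 's \<Rightarrow> real) \<Rightarrow> (nat \<Rightarrow> 's set) \<Rightarrow> nat \<Rightarrow> nat \<Rightarrow> ereal" where
  "upper_exponent Pn C i j =
     limsup (\<lambda>n. ereal (1 / real n) * elog (max_transition Pn C n i j))"

text \<open>The tuples \<open>\<langle>l\<^sub>0, \<dots>, l\<^sub>k\<^sub>+\<^sub>1\<rangle>\<close> of distinct indices in \<open>{1..K}\<close> from \<open>i\<close> to \<open>j\<close>,
  as lists indexed from \<open>0\<close>.\<close>

definition index_tuples :: "nat \<Rightarrow> nat \<Rightarrow> nat \<Rightarrow> nat \<Rightarrow> nat list set" where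
  "index_tuples K k i j =
     {l. length l = k + 2 \<and> distinct l \<and> set l \<subseteq> {1..K} \<and> l ! 0 = i \<and> l ! (k + 1) = j}"

text \<open>Meaningful for distinct \<open>i, j\<close> in \<open>{1..K}\<close> only, \<open>K = N + M\<close> being the number of classes;
  then \<open>K \<ge> 2\<close> and both maxima are over finite nonempty sets.\<close>

definition upper_cost ::
  "(nat \<Rightarrow> 's \<Rightarrow> 's \<Rightarrow> real) \<Rightarrow> nat \<Rightarrow> (nat \<Rightarrow> 's set) \<Rightarrow> nat \<Rightarrow> nat \<Rightarrow> ereal" where
  "upper_cost Pn K C i j =
     (MAX k\<in>{0..K - 2}. MAX l\<in>index_tuples K k i j.
        \<Sum>s=0..k. upper_exponent Pn C (l ! s) (l ! (s + 1)))"

end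

theory Submission
  imports Defs
begin

text \<open>
  Fix a tilt \<open>\<theta>\<^sub>i\<close> for each irreducible class. A path is weighted by the exponential of
  \<open>\<langle>\<theta>\<^sub>i, f(y)\<rangle> - log \<rho>(C\<^sub>i, \<theta>\<^sub>i)\<close> for each visit to \<open>y \<in> C\<^sub>i\<close>, by a large
  constant for each visit to a degenerate class, and by almost the inverse \<open>e\<^sup>k\<^sup>w\<close> of the largest
  transition probability for each switch between classes at time \<open>k\<close>. The expected weight grows
  subexponentially: the right Perron--Frobenius eigenvectors of the classes, multiplied by \<open>\<kappa>\<^sup>i\<close>
  with small \<open>\<kappa>\<close>, are almost superharmonic for the weighted kernel at large times. This gives a Chernoff
  bound with no enumeration of the switching times.

  The total switching cost of a path dominates the cost of visiting every class only once, in
  the order of the last visits, with the upper cost between consecutive classes. Hence the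
  exponent is a function of the empirical measure of the path, and
  for a measure with mean \<open>z\<close> the tilts can be chosen such that it exceeds any \<open>a < J(z)\<close>. A finite
  cover of the compact set of empirical measures with mean in the closed set proves the bound.
  Goodness holds because the cost is a supremum of continuous functions and the
  class rates are infinite outside a ball, so that the infimum is over a compact set.
\<close>

section \<open>Perron--Frobenius eigenvalues and class rate functions\<close>

text \<open>Being a maximum over walks, the upper cost makes \<open>- upper_cost\<close> satisfy the
  triangle inequality and lie below the one-step costs \<open>- upper_exponent\<close>. So deleting
  a visit from an order never raises its cost, and a path weighted by one-step exponents can be
  bounded in terms of upper costs.

  Exponents may be \<open>-\<infinity>\<close>, while weights must be finite. Costs are therefore
  cut off at some \<open>A\<close>, which keeps the triangle inequality, and multiplied by some
  \<open>c < 1\<close>. The factor leaves an exponential margin: weighted switch probabilities with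
  positive rate decay exponentially although the exponent is only a limsup. Where the rate is zero,
  the convergence to \<open>P\<close> has to suffice.

  The empirical measure does not reveal the order of the last visits, so one choice of tilts,
  \<open>A\<close> and \<open>c\<close> must serve all orders. This is possible because the order
  enters only the switching part of the cost: the tilts are fitted to the class rates, then
  \<open>A\<close> and \<open>c\<close> to the finitely many orders.\<close>

lemma positive_eigenvector_exists:
  fixes A :: "'s::finite \<Rightarrow> 's \<Rightarrow> real"
  assumes nonneg: "\<And>x y. 0 \<le> A x y" and ne: "C \<noteq> {}"
    and irr: "irreducible_block A C"
  obtains r h where "r > 0" "\<And>x. x \<in> C \<Longrightarrow> h x > 0"
    "\<And>x. x \<in> C \<Longrightarrow> (\<Sum>y\<in>C. A x y * h y) = r * h x"
proof -
  define S where "S = {m :: real^'s. (\<forall>x. 0 \<le> m $ x) \<and> (\<forall>x\<in>-C. m $ x = 0) \<and> (\<Sum>x\<in>UNIV. m $ x) = 1}"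
  define t where "t m = (\<Sum>x\<in>C. \<Sum>y\<in>C. A x y * m $ y)" for m :: "real^'s"
  \<comment> \<open>The normalized action of the block on the simplex of probability vectors
    supported on \<open>C\<close>; a Brouwer fixed point is an eigenvector with eigenvalue
    \<open>t m\<close>.\<close>
  define g :: "real^'s \<Rightarrow> real^'s" where
    "g m = (\<chi> x. if x \<in> C then (\<Sum>y\<in>C. A x y * m $ y) / t m else 0)" for m
  have sum_C: "(\<Sum>x\<in>C. m $ x) = 1" if "m \<in> S" for m
  proof -
    have "(\<Sum>x\<in>C. m $ x) = (\<Sum>x\<in>UNIV. m $ x)"
      using that by (intro sum.mono_neutral_left) (auto simp: S_def)
    then show ?thesis using that by (simp add: S_def)
  qed
  have t_pos: "t m > 0" if m: "m \<in> S" for m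
  proof -
    have m0: "0 \<le> m $ x" for x using m by (simp add: S_def)
    have "\<exists>y\<in>C. m $ y \<noteq> 0"
      using sum_C[OF m] by (metis sum.neutral zero_neq_one)
    then obtain y where y: "y \<in> C" "m $ y > 0" using m0 by (metis order_less_le)
    \<comment> \<open>A cycle through \<open>y\<close> supplies a predecessor \<open>x\<close> of
      \<open>y\<close> in \<open>C\<close>, whose row picks up the mass at \<open>y\<close>. Here it
      matters that paths have at least one step.\<close>
    have "(y, y) \<in> (transitions A \<inter> C \<times> C)\<^sup>+" using irr y by (auto simp: irreducible_block_def)
    then obtain x where x: "(x, y) \<in> transitions A \<inter> C \<times> C" by (meson tranclE)
    then have "0 < A x y * m $ y" using y by (auto simp: transitions_def)
    also have "\<dots> \<le> (\<Sum>y\<in>C. A x y * m $ y)"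
      by (rule member_le_sum) (auto simp: y nonneg m0)
    also have "\<dots> \<le> t m" unfolding t_def using x
      by (intro member_le_sum[of x C "\<lambda>x. \<Sum>y\<in>C. A x y * m $ y"]) (auto intro!: sum_nonneg mult_nonneg_nonneg nonneg m0)
    finally show ?thesis .
  qed
  have "closed S"
    unfolding S_def Ball_def
    by (intro closed_Collect_conj closed_Collect_all closed_Collect_imp open_Collect_const
        closed_Collect_le closed_Collect_eq continuous_intros)
  moreover have "bounded S"
  proof (rule boundedI[of _ 1])
    fix m assume m: "m \<in> S"
    have "norm m \<le> (\<Sum>i\<in>UNIV. \<bar>m $ i\<bar>)" by (rule norm_le_l1_cart)
    also have "\<dots> = (\<Sum>i\<in>UNIV. m $ i)" using m by (intro sum.cong) (auto simp: S_def)
    finally show "norm m \<le> 1" using m by (simp add: S_def)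
  qed
  ultimately have compact: "compact S" by (simp add: compact_eq_bounded_closed)
  have convex: "convex S"
    unfolding convex_def S_def
    by (auto simp: sum.distrib sum_distrib_left[symmetric])
  obtain x0 where "x0 \<in> C" using ne by auto
  then have "axis x0 1 \<in> S" by (auto simp: S_def axis_def)
  then have "S \<noteq> {}" by auto
  have cont: "continuous_on S g"
    unfolding g_def
  proof (intro continuous_on_vec_lambda)
    fix x
    show "continuous_on S (\<lambda>m. if x \<in> C then (\<Sum>y\<in>C. A x y * m $ y) / t m else 0)"
      using t_pos[THEN less_imp_neq] by (cases "x \<in> C") (force simp: t_def intro!: continuous_intros)+
  qed
  have "g \<in> S \<rightarrow> S"
  proof
    fix m assume m: "m \<in> S"
    have m0: "0 \<le> m $ x" for x using m by (simp add: S_def)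
    have "(\<Sum>x\<in>UNIV. g m $ x) = (\<Sum>x\<in>C. g m $ x)"
      by (intro sum.mono_neutral_right) (auto simp: g_def)
    also have "\<dots> = t m / t m" by (simp add: g_def sum_divide_distrib[symmetric]) (simp add: t_def)
    finally have "(\<Sum>x\<in>UNIV. g m $ x) = 1" using t_pos[OF m] by simp
    moreover have "0 \<le> g m $ x" for x
      using t_pos[OF m] by (auto simp: g_def intro!: divide_nonneg_pos sum_nonneg mult_nonneg_nonneg nonneg m0)
    ultimately show "g m \<in> S" by (auto simp: S_def) (auto simp: g_def)
  qed
  then obtain m where m: "m \<in> S" "g m = m"
    using brouwer[OF compact convex \<open>S \<noteq> {}\<close> cont] by auto
  have m0: "0 \<le> m $ x" for x using m by (simp add: S_def)
  have eig: "(\<Sum>y\<in>C. A x y * m $ y) = t m * m $ x" if "x \<in> C" for x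
  proof -
    have "g m $ x = (\<Sum>y\<in>C. A x y * m $ y) / t m" using that by (simp add: g_def)
    then show ?thesis using m t_pos[OF m(1)] by (simp add: field_simps)
  qed
  have "\<exists>y\<in>C. m $ y \<noteq> 0"
    using sum_C[OF m(1)] by (metis sum.neutral zero_neq_one)
  then obtain y where y: "y \<in> C" "m $ y > 0" using m0 by (metis order_less_le)
  \<comment> \<open>The eigenvector equation carries positivity backwards along a transition;
    irreducibility then reaches every state of \<open>C\<close>.\<close>
  have pred_pos: "m $ x > 0" if "(x, y) \<in> transitions A \<inter> C \<times> C" "m $ y > 0" for x y
  proof -
    have "0 < A x y * m $ y" using that by (auto simp: transitions_def)
    also have "\<dots> \<le> (\<Sum>y\<in>C. A x y * m $ y)"
      using that by (intro member_le_sum) (auto simp: nonneg m0)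
    also have "\<dots> = t m * m $ x" using that by (intro eig) auto
    finally show ?thesis using t_pos[OF m(1)] by (simp add: zero_less_mult_iff)
  qed
  have "m $ x > 0" if "x \<in> C" for x
  proof -
    have "(x, y) \<in> (transitions A \<inter> C \<times> C)\<^sup>+" using irr y that by (auto simp: irreducible_block_def)
    then show ?thesis using y(2) by (induct rule: converse_trancl_induct) (auto intro: pred_pos)
  qed
  then show thesis using that[of "t m" "\<lambda>x. m $ x"] t_pos[OF m(1)] eig by auto
qed

text \<open>A positive eigenvector controls all others: with \<open>c\<close> the largest ratio of
  \<open>cmod (v x)\<close> to \<open>h x\<close>, the equation for \<open>v\<close> at a state
  attaining \<open>c\<close> bounds \<open>cmod \<mu>\<close> by \<open>r\<close>. Two dominating
  eigenvalues bound each other, so the description by \<open>THE\<close> is unique.\<close>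

lemma perron_frobenius_eigenvalue_eqI:
  fixes A :: "'s::finite \<Rightarrow> 's \<Rightarrow> real"
  assumes nonneg: "\<And>x y. 0 \<le> A x y" and ne: "C \<noteq> {}" and r: "r > 0"
    and h: "\<And>x. x \<in> C \<Longrightarrow> h x > 0"
    and eig: "\<And>x. x \<in> C \<Longrightarrow> (\<Sum>y\<in>C. A x y * h y) = r * h x"
  shows "perron_frobenius_eigenvalue C A = r"
proof -
  have 1: "block_eigenvalue C A (complex_of_real r)"
    unfolding block_eigenvalue_def
  proof (intro exI[of _ "\<lambda>x. complex_of_real (h x)"] conjI ballI)
    show "\<exists>x\<in>C. complex_of_real (h x) \<noteq> 0" using ne h by force
    show "(\<Sum>y\<in>C. complex_of_real (A x y) * complex_of_real (h y)) = complex_of_real r * complex_of_real (h x)"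
      if "x \<in> C" for x
      using arg_cong[OF eig[OF that], of complex_of_real] by simp
  qed
  have 2: "cmod \<mu> \<le> r" if "block_eigenvalue C A \<mu>" for \<mu>
  proof -
    obtain v where v: "\<exists>x\<in>C. v x \<noteq> 0"
      "\<And>x. x \<in> C \<Longrightarrow> (\<Sum>y\<in>C. complex_of_real (A x y) * v y) = \<mu> * v x"
      using \<open>block_eigenvalue C A \<mu>\<close> by (auto simp: block_eigenvalue_def)
    define c where "c = Max ((\<lambda>x. cmod (v x) / h x) ` C)"
    have le: "cmod (v y) \<le> c * h y" if "y \<in> C" for y
      using Max_ge[of "(\<lambda>x. cmod (v x) / h x) ` C" "cmod (v y) / h y"] that h[OF that]
      by (simp add: c_def divide_le_eq)
    have "c \<in> (\<lambda>x. cmod (v x) / h x) ` C" unfolding c_def using ne by (intro Max_in) auto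
    then obtain x where x: "x \<in> C" "cmod (v x) = c * h x" using h by (auto simp: field_simps less_imp_neq[symmetric])
    have c: "c > 0"
    proof -
      obtain y where y: "y \<in> C" "v y \<noteq> 0" using v by auto
      then have "0 < c * h y" using le[OF y(1)] by (meson less_le_trans zero_less_norm_iff)
      then show ?thesis using h[OF y(1)] by (simp add: zero_less_mult_iff)
    qed
    have "cmod \<mu> * (c * h x) = cmod (\<mu> * v x)" by (simp add: norm_mult x)
    also have "\<dots> = cmod (\<Sum>y\<in>C. complex_of_real (A x y) * v y)" using v(2)[OF x(1)] by simp
    also have "\<dots> \<le> (\<Sum>y\<in>C. cmod (complex_of_real (A x y) * v y))" by (rule norm_sum)
    also have "\<dots> \<le> (\<Sum>y\<in>C. A x y * (c * h y))"
      by (intro sum_mono) (auto simp: norm_mult nonneg intro!: mult_left_mono le)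
    also have "\<dots> = c * (\<Sum>y\<in>C. A x y * h y)" by (simp add: sum_distrib_left algebra_simps)
    also have "\<dots> = r * (c * h x)" using eig[OF x(1)] by simp
    finally show ?thesis using c h[OF x(1)] by simp
  qed
  show ?thesis
    unfolding perron_frobenius_eigenvalue_def
  proof (rule the_equality)
    fix r' assume "block_eigenvalue C A (complex_of_real r') \<and> (\<forall>\<mu>. block_eigenvalue C A \<mu> \<longrightarrow> cmod \<mu> \<le> r')"
    then have "cmod (complex_of_real r) \<le> r'" "cmod (complex_of_real r') \<le> r" using 1 2 by blast+
    then show "r' = r" by auto
  qed (use 1 2 in auto)
qed

text \<open>The exponential factors are positive, so tilting changes neither the transitions nor
  irreducibility.\<close>

lemma tilted_eigenvector:
  fixes P :: "'s::finite \<Rightarrow> 's \<Rightarrow> real"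
  assumes nonneg: "\<And>x y. 0 \<le> P x y" and ne: "C \<noteq> {}" and irr: "irreducible_block P C"
  obtains h where "tilted_eigenvalue P f C \<theta> > 0" "\<And>x. x \<in> C \<Longrightarrow> h x > 0"
    "\<And>x. x \<in> C \<Longrightarrow> (\<Sum>y\<in>C. P x y * exp (\<theta> \<bullet> f y) * h y) = tilted_eigenvalue P f C \<theta> * h x"
proof -
  let ?A = "\<lambda>x y. P x y * exp (\<theta> \<bullet> f y)"
  have "transitions ?A = transitions P" by (auto simp: transitions_def zero_less_mult_iff)
  then have "irreducible_block ?A C" using irr by (simp add: irreducible_block_def)
  then obtain r h where rh: "r > 0" "\<And>x. x \<in> C \<Longrightarrow> h x > 0"
    "\<And>x. x \<in> C \<Longrightarrow> (\<Sum>y\<in>C. ?A x y * h y) = r * h x"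
    using positive_eigenvector_exists[of ?A C] nonneg ne by auto
  moreover have "tilted_eigenvalue P f C \<theta> = r"
    unfolding tilted_eigenvalue_def
    using nonneg ne rh by (intro perron_frobenius_eigenvalue_eqI[where h = h]) auto
  ultimately show thesis using that by blast
qed

text \<open>Read the eigenvector equation at a state where \<open>h\<close> is maximal and use that
  block rows sum to at most 1. At \<open>\<theta> = 0\<close> the bound makes the class rate
  nonnegative; its linear growth in \<open>\<theta>\<close> makes the rate infinite outside the ball
  of radius \<open>R\<close>.\<close>

lemma ln_tilted_eigenvalue_le:
  fixes P :: "'s::finite \<Rightarrow> 's \<Rightarrow> real"
  assumes st: "stochastic P" and ne: "C \<noteq> {}" and irr: "irreducible_block P C"
    and R: "\<And>y. norm (f y) \<le> R"
  shows "ln (tilted_eigenvalue P f C \<theta>) \<le> norm \<theta> * R"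
proof -
  have nonneg: "0 \<le> P x y" for x y using st by (simp add: stochastic_def prob_vector_def)
  obtain h where h: "tilted_eigenvalue P f C \<theta> > 0" "\<And>x. x \<in> C \<Longrightarrow> h x > 0"
    "\<And>x. x \<in> C \<Longrightarrow> (\<Sum>y\<in>C. P x y * exp (\<theta> \<bullet> f y) * h y) = tilted_eigenvalue P f C \<theta> * h x"
    using tilted_eigenvector[OF nonneg ne irr] by blast
  have "Max (h ` C) \<in> h ` C" using ne by (intro Max_in) auto
  then obtain x where x: "x \<in> C" "h x = Max (h ` C)" by auto
  have hx: "h y \<le> h x" if "y \<in> C" for y using that x by auto
  have "tilted_eigenvalue P f C \<theta> * h x = (\<Sum>y\<in>C. P x y * exp (\<theta> \<bullet> f y) * h y)" using h(3) x by simp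
  also have "\<dots> \<le> (\<Sum>y\<in>C. P x y * exp (norm \<theta> * R) * h x)"
  proof (intro sum_mono mult_mono)
    fix y
    have "\<theta> \<bullet> f y \<le> norm \<theta> * norm (f y)" by (rule norm_cauchy_schwarz)
    also have "\<dots> \<le> norm \<theta> * R" by (intro mult_left_mono R) auto
    finally show "exp (\<theta> \<bullet> f y) \<le> exp (norm \<theta> * R)" by simp
  qed (auto simp: nonneg hx less_imp_le[OF h(2)])
  also have "\<dots> = (\<Sum>y\<in>C. P x y) * (exp (norm \<theta> * R) * h x)" by (simp add: sum_distrib_right mult.assoc)
  also have "\<dots> \<le> 1 * (exp (norm \<theta> * R) * h x)"
  proof (intro mult_right_mono)
    have "(\<Sum>y\<in>C. P x y) \<le> (\<Sum>y\<in>UNIV. P x y)" by (intro sum_mono2) (auto simp: nonneg)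
    then show "(\<Sum>y\<in>C. P x y) \<le> 1" using st by (simp add: stochastic_def prob_vector_def)
  qed (use h(2)[OF x(1)] in auto)
  finally have "tilted_eigenvalue P f C \<theta> \<le> exp (norm \<theta> * R)" using h(2)[OF x(1)] by simp
  then show ?thesis using h(1) by (metis ln_exp ln_le_cancel_iff exp_gt_zero)
qed

lemma class_rate_alt:
  fixes P :: "'s::finite \<Rightarrow> 's \<Rightarrow> real"
  assumes st: "stochastic P" and ne: "C \<noteq> {}" and irr: "irreducible_block P C"
  shows "class_rate P f C x = (SUP \<theta>. ereal (\<theta> \<bullet> x - ln (tilted_eigenvalue P f C \<theta>)))"
proof -
  have nonneg: "0 \<le> P x y" for x y using st by (simp add: stochastic_def prob_vector_def)
  have "tilted_eigenvalue P f C \<theta> > 0" for \<theta>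
    using tilted_eigenvector[OF nonneg ne irr] by metis
  then show ?thesis by (auto simp: class_rate_def elog_def less_imp_neq[symmetric] intro!: SUP_cong)
qed

lemma class_rate_nonneg:
  fixes P :: "'s::finite \<Rightarrow> 's \<Rightarrow> real"
  assumes st: "stochastic P" and ne: "C \<noteq> {}" and irr: "irreducible_block P C"
  shows "0 \<le> class_rate P f C x"
proof -
  obtain R where R: "\<And>y. norm (f y) \<le> R" using finite_imp_bounded[of "range f"] by (auto simp: bounded_iff)
  have "ln (tilted_eigenvalue P f C 0) \<le> 0" using ln_tilted_eigenvalue_le[OF st ne irr R, where \<theta> = 0] by simp
  then show ?thesis
    unfolding class_rate_alt[OF st ne irr] by (intro SUP_upper2[of 0]) auto
qed

lemma class_rate_eq_infinity:
  fixes P :: "'s::finite \<Rightarrow> 's \<Rightarrow> real"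
  assumes st: "stochastic P" and ne: "C \<noteq> {}" and irr: "irreducible_block P C"
    and R: "\<And>y. norm (f y) \<le> R" and x: "norm x > R"
  shows "class_rate P f C x = \<infinity>"
proof -
  have "ereal a \<le> class_rate P f C x" for a :: real
  proof -
    \<comment> \<open>With \<open>\<theta>\<close> of length \<open>t\<close> in the direction of
      \<open>x\<close>, the supremum is at least \<open>t * (norm x - R)\<close>, which this choice
      makes equal to \<open>\<bar>a\<bar>\<close>.\<close>
    define t where "t = \<bar>a\<bar> / (norm x - R)"
    have x0: "norm x > 0" using x R[of undefined] norm_ge_zero[of "f undefined"] by linarith
    define \<theta> where "\<theta> = (t / norm x) *\<^sub>R x"
    have t: "t \<ge> 0" using x by (simp add: t_def)
    have n: "norm \<theta> = t" using x0 t by (simp add: \<theta>_def)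
    have "\<theta> \<bullet> x = t * norm x" using x0 by (simp add: \<theta>_def dot_square_norm power2_eq_square)
    then have "\<theta> \<bullet> x - ln (tilted_eigenvalue P f C \<theta>) \<ge> t * norm x - t * R"
      using ln_tilted_eigenvalue_le[OF st ne irr R, where \<theta> = \<theta>] n by simp
    also have "t * norm x - t * R = t * (norm x - R)" by (simp add: algebra_simps)
    also have "\<dots> = \<bar>a\<bar>" using x by (simp add: t_def)
    finally show ?thesis
      unfolding class_rate_alt[OF st ne irr] by (intro SUP_upper2[of \<theta>]) auto
  qed
  then show ?thesis by (metis ereal_top)
qed

section \<open>The cost of an order of visits\<close>

text \<open>The parameter \<open>s\<close> is the time spent before the list starts. The time of the
  last entry never enters, just as the last weight is absent from the switching part of
  \<open>path_cost\<close>.\<close>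

fun order_cost :: "('i \<Rightarrow> real) \<Rightarrow> ('i \<Rightarrow> 'i \<Rightarrow> real) \<Rightarrow> real \<Rightarrow> 'i list \<Rightarrow> real" where
  "order_cost T W s (a # b # l) = (s + T a) * W a b + order_cost T W (s + T a) (b # l)"
| "order_cost T W s l = 0"

lemma order_cost_mono_start:
  assumes "\<And>a b. a \<in> S \<Longrightarrow> b \<in> S \<Longrightarrow> a \<noteq> b \<Longrightarrow> 0 \<le> W a b"
    and "s \<le> s'" "distinct (a # l)" "set (a # l) \<subseteq> S"
  shows "order_cost T W s (a # l) \<le> order_cost T W s' (a # l)"
  using assms(2-4)
proof (induct l arbitrary: a s s')
  case (Cons b l)
  then have "order_cost T W (s + T a) (b # l) \<le> order_cost T W (s' + T a) (b # l)" by auto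
  moreover have "(s + T a) * W a b \<le> (s' + T a) * W a b"
    using Cons.prems assms(1)[of a b] by (intro mult_right_mono) auto
  ultimately show ?case by simp
qed auto

locale subadditive_weight =
  fixes S :: "'i set" and W :: "'i \<Rightarrow> 'i \<Rightarrow> real" and T :: "'i \<Rightarrow> real"
  assumes W_nonneg: "\<And>a b. a \<in> S \<Longrightarrow> b \<in> S \<Longrightarrow> a \<noteq> b \<Longrightarrow> 0 \<le> W a b"
    and W_triangle: "\<And>a b c. a \<in> S \<Longrightarrow> b \<in> S \<Longrightarrow> c \<in> S \<Longrightarrow> a \<noteq> b \<Longrightarrow> b \<noteq> c \<Longrightarrow> a \<noteq> c \<Longrightarrow>
      W a c \<le> W a b + W b c"
    and T_nonneg: "\<And>a. 0 \<le> T a"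
begin

lemma order_cost_delete_first:
  assumes "0 \<le> s" "distinct (a # l)" "set (a # l) \<subseteq> S"
  shows "order_cost T W s l \<le> order_cost T W s (a # l)"
proof (cases l)
  case (Cons b l')
  have "order_cost T W s l \<le> order_cost T W (s + T a) l"
    unfolding Cons using assms Cons T_nonneg by (intro order_cost_mono_start[where S = S] W_nonneg) auto
  moreover have "0 \<le> (s + T a) * W a b"
    using assms Cons T_nonneg W_nonneg[of a b] by (intro mult_nonneg_nonneg add_nonneg_nonneg) auto
  ultimately show ?thesis using Cons by simp
qed auto

text \<open>If \<open>b\<close> is followed by \<open>d\<close>, two switches are replaced by one at
  the earlier time; the triangle inequality pays for it, and the time of \<open>b\<close> drops out
  of all later partial sums. If \<open>b\<close> is last, a nonnegative term disappears.\<close>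

lemma order_cost_delete_second:
  assumes "0 \<le> s" "distinct (a # b # l)" "set (a # b # l) \<subseteq> S"
  shows "order_cost T W s (a # l) \<le> order_cost T W s (a # b # l)"
proof (cases l)
  case Nil
  then show ?thesis using assms T_nonneg W_nonneg[of a b] by auto
next
  case (Cons d l')
  have "order_cost T W (s + T a) l \<le> order_cost T W (s + T a + T b) l"
    unfolding Cons using assms Cons T_nonneg by (intro order_cost_mono_start[where S = S] W_nonneg) auto
  moreover have "(s + T a) * W a d \<le> (s + T a) * (W a b + W b d)"
    using assms Cons T_nonneg by (intro mult_left_mono W_triangle add_nonneg_nonneg) auto
  moreover have "0 \<le> T b * W b d"
    using assms Cons T_nonneg W_nonneg[of b d] by auto
  ultimately show ?thesis using Cons by (simp add: algebra_simps)
qed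

text \<open>The head is kept so that each removed entry has a predecessor and
  \<open>order_cost_delete_second\<close> applies.\<close>

lemma order_cost_filter_tail:
  assumes "0 \<le> s" "distinct (a # l)" "set (a # l) \<subseteq> S"
  shows "order_cost T W s (a # filter Q l) \<le> order_cost T W s (a # l)"
  using assms
proof (induct l arbitrary: a s)
  case (Cons b l)
  show ?case
  proof (cases "Q b")
    case True
    then show ?thesis using Cons.prems T_nonneg Cons.hyps[of "s + T a" b] by simp
  next
    case False
    then have "order_cost T W s (a # filter Q (b # l)) \<le> order_cost T W s (a # l)"
      using Cons.prems Cons.hyps[of s a] by simp
    also have "\<dots> \<le> order_cost T W s (a # b # l)"
      using Cons.prems by (intro order_cost_delete_second)
    finally show ?thesis .
  qed
qed auto

lemma order_cost_filter:
  assumes "0 \<le> s" "distinct l" "set l \<subseteq> S"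
  shows "order_cost T W s (filter Q l) \<le> order_cost T W s l"
  using assms
proof (induct l)
  case (Cons a l)
  show ?case
  proof (cases "Q a")
    case True
    then show ?thesis using Cons.prems order_cost_filter_tail by simp
  next
    case False
    then have "order_cost T W s (filter Q (a # l)) \<le> order_cost T W s l"
      using Cons by simp
    also have "\<dots> \<le> order_cost T W s (a # l)"
      using Cons.prems by (intro order_cost_delete_first)
    finally show ?thesis .
  qed
qed auto

end

lemma order_cost_append:
  "order_cost T W s (l @ [a, b]) = order_cost T W s (l @ [a]) + (s + sum_list (map T l) + T a) * W a b"
  by (induct l arbitrary: s rule: induct_list012) (auto simp: algebra_simps)

lemma order_cost_cong:
  assumes "\<And>x. x \<in> set (butlast l) \<Longrightarrow> T x = T' x"
  shows "order_cost T W s l = order_cost T' W s l"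
  using assms by (induct l arbitrary: s rule: induct_list012) auto

lemma order_cost_scale_weight: "order_cost T (\<lambda>i j. c * W i j) s l = c * order_cost T W s l"
  by (induct l arbitrary: s rule: induct_list012) (auto simp: algebra_simps)

lemma order_cost_scale_time: "order_cost (\<lambda>i. c * T i) W (c * s) l = c * order_cost T W s l"
proof (induct l arbitrary: s rule: induct_list012)
  case (3 a b l)
  show ?case using 3(2)[of "s + T a"] by (simp add: algebra_simps)
qed auto

lemma order_cost_eq_sum:
  "order_cost T W s l = (\<Sum>i<length l - 1. (s + (\<Sum>j\<le>i. T (l ! j))) * W (l ! i) (l ! Suc i))"
proof (induct l arbitrary: s rule: induct_list012)
  case (3 a b l)
  show ?case using 3(2)[of "s + T a"]
    by (simp add: sum.lessThan_Suc_shift sum.atMost_Suc_shift add.assoc del: sum.lessThan_Suc sum.atMost_Suc)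
qed auto

lemma continuous_on_order_cost:
  assumes "\<And>i. continuous_on U (\<lambda>m. T m i)" "continuous_on U s"
  shows "continuous_on U (\<lambda>m. order_cost (T m) W (s m) l)"
  using assms(2)
proof (induct l arbitrary: s rule: induct_list012)
  case (3 a b l)
  have "continuous_on U (\<lambda>m. s m + T m a)" by (intro continuous_intros 3(3) assms(1))
  then have "continuous_on U (\<lambda>m. order_cost (T m) W (s m + T m a) (b # l))" by (rule 3(2))
  then show ?case unfolding order_cost.simps by (intro continuous_intros 3(3) assms(1))
qed auto

fun switch_cost :: "('i \<Rightarrow> 'i \<Rightarrow> real) \<Rightarrow> 'i list \<Rightarrow> real" where
  "switch_cost w (b # a # l) = (if a = b then 0 else real (Suc (length l)) * w a b) + switch_cost w (a # l)"
| "switch_cost w l = 0"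

text \<open>
  Histories are listed with the most recent entry first. The order produced here is that of the last
  visits: when a class is entered it moves to the end of the order, and closing the gap it leaves
  does not increase the cost, by the triangle inequality.
\<close>

lemma order_cost_le_switch_cost:
  assumes fin: "finite S" and nonneg: "\<And>a b. a \<in> S \<Longrightarrow> b \<in> S \<Longrightarrow> a \<noteq> b \<Longrightarrow> 0 \<le> W a b"
    and tri: "\<And>a b c. a \<in> S \<Longrightarrow> b \<in> S \<Longrightarrow> c \<in> S \<Longrightarrow> a \<noteq> b \<Longrightarrow> b \<noteq> c \<Longrightarrow> a \<noteq> c \<Longrightarrow>
      W a c \<le> W a b + W b c"
    and le: "\<And>a b. a \<in> S \<Longrightarrow> b \<in> S \<Longrightarrow> a \<noteq> b \<Longrightarrow> W a b \<le> w a b"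
    and c: "c \<noteq> []" "set c \<subseteq> S"
  shows "\<exists>\<sigma>. distinct \<sigma> \<and> set \<sigma> = S \<and> last \<sigma> = hd c \<and>
    order_cost (\<lambda>i. real (count_list (butlast c) i)) W 0 \<sigma> \<le> switch_cost w c"
  using c
proof (induct c rule: induct_list012)
  case (2 x)
  obtain l where l: "set l = S - {x}" "distinct l" using fin finite_distinct_list[of "S - {x}"] by auto
  \<comment> \<open>No time is counted yet, since \<open>butlast\<close> removes the initial class;
    so any order ending in \<open>x\<close> is free.\<close>
  have "order_cost (\<lambda>i. 0) W 0 (l @ [x]) = 0" by (simp add: order_cost_eq_sum)
  then show ?case using l 2 by (intro exI[of _ "l @ [x]"]) auto
next
  case (3 b a l)
  let ?T = "\<lambda>i. real (count_list (butlast (a # l)) i)"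
    and ?T' = "\<lambda>i. real (count_list (butlast (b # a # l)) i)"
  have "\<exists>\<sigma>. distinct \<sigma> \<and> set \<sigma> = S \<and> last \<sigma> = a \<and> order_cost ?T W 0 \<sigma> \<le> switch_cost w (a # l)"
    using 3 by auto
  then obtain \<sigma> where \<sigma>: "distinct \<sigma>" "set \<sigma> = S" "last \<sigma> = a"
    "order_cost ?T W 0 \<sigma> \<le> switch_cost w (a # l)" by blast
  have ab: "a \<in> S" "b \<in> S" using 3 by auto
  have "\<sigma> \<noteq> []" using \<sigma> ab by auto
  then obtain \<sigma>0 where \<sigma>0: "\<sigma> = \<sigma>0 @ [a]" using \<sigma>(3) by (metis append_butlast_last_id)
  show ?case
  proof (cases "a = b")
    case True
    \<comment> \<open>Staying in \<open>b\<close> adds time only to the last entry of the order,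
      where it does not count.\<close>
    have "order_cost ?T' W 0 \<sigma> = order_cost ?T W 0 \<sigma>"
      using \<sigma>(1) \<sigma>0 True by (intro order_cost_cong) auto
    then show ?thesis using True \<sigma> by (intro exI[of _ \<sigma>]) auto
  next
    case False
    interpret subadditive_weight S W ?T
      using nonneg tri by unfold_locales auto
    \<comment> \<open>\<open>b\<close> is deleted from the old order and appended after
      \<open>a\<close>, which is not affected by the deletion as \<open>a \<noteq> b\<close>. The
      new visit is counted only for \<open>b\<close>, now last, so \<open>?T'\<close> may be
      replaced by \<open>?T\<close>.\<close>
    let ?f = "filter (\<lambda>i. i \<noteq> b)"
    have f: "?f \<sigma> = ?f \<sigma>0 @ [a]" using False \<sigma>0 by auto
    have "order_cost ?T' W 0 (?f \<sigma> @ [b]) = order_cost ?T W 0 (?f \<sigma> @ [b])"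
      by (intro order_cost_cong) auto
    also have "\<dots> = order_cost ?T W 0 (?f \<sigma>) + sum_list (map ?T (?f \<sigma>)) * W a b"
      using order_cost_append[of ?T W 0 "?f \<sigma>0" a b] by (simp add: f)
    also have "sum_list (map ?T (?f \<sigma>)) = (\<Sum>i\<in>S - {b}. ?T i)"
      using \<sigma> by (subst sum_list_distinct_conv_sum_set) (auto simp: set_diff_eq)
    also have "order_cost ?T W 0 (?f \<sigma>) + (\<Sum>i\<in>S - {b}. ?T i) * W a b
        \<le> switch_cost w (a # l) + real (Suc (length l)) * w a b"
    proof (intro add_mono mult_mono)
      show "order_cost ?T W 0 (?f \<sigma>) \<le> switch_cost w (a # l)"
        using order_cost_filter[of 0 \<sigma> "\<lambda>i. i \<noteq> b"] \<sigma> by auto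
      \<comment> \<open>The visits counted so far number \<open>length l\<close>, so the time
        accumulated outside \<open>b\<close> is at most the time index \<open>Suc (length l)\<close>
        at which the switch is charged.\<close>
      have "set (butlast (a # l)) \<subseteq> S" using 3(4) by (auto dest!: in_set_butlastD split: if_splits)
      then have "sum (count_list (butlast (a # l))) S = length (butlast (a # l))"
        using fin by (rule sum_count_set)
      then have "(\<Sum>i\<in>S. ?T i) = real (length l)"
        unfolding of_nat_sum[symmetric] by simp
      moreover have "(\<Sum>i\<in>S - {b}. ?T i) \<le> (\<Sum>i\<in>S. ?T i)" using fin by (intro sum_mono2) auto
      ultimately show "(\<Sum>i\<in>S - {b}. ?T i) \<le> real (Suc (length l))" by simp
    qed (use ab False nonneg le in auto)
    finally have "order_cost ?T' W 0 (?f \<sigma> @ [b]) \<le> switch_cost w (b # a # l)" using False by simp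
    then show ?thesis using \<sigma> ab by (intro exI[of _ "?f \<sigma> @ [b]"]) auto
  qed
qed simp

section \<open>The upper cost as an optimal walk\<close>

fun walk_sum :: "('i \<Rightarrow> 'i \<Rightarrow> ereal) \<Rightarrow> 'i list \<Rightarrow> ereal" where
  "walk_sum u (a # b # l) = u a b + walk_sum u (b # l)"
| "walk_sum u l = 0"

lemma walk_sum_eq_sum:
  "length l = k + 2 \<Longrightarrow> (\<Sum>s=0..k. u (l ! s) (l ! (s + 1))) = walk_sum u l"
proof (induct l arbitrary: k rule: induct_list012)
  case (3 a b l)
  show ?case
  proof (cases k)
    case 0
    then show ?thesis using 3 by simp
  next
    case (Suc k')
    have "(\<Sum>s=0..k. u ((a # b # l) ! s) ((a # b # l) ! (s + 1))) =
        u a b + (\<Sum>s=0..k'. u ((b # l) ! s) ((b # l) ! (s + 1)))"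
      unfolding Suc sum.atLeast0_atMost_Suc_shift by simp
    also have "\<dots> = walk_sum u (a # b # l)" using 3(2)[of k'] 3(3) Suc by simp
    finally show ?thesis .
  qed
qed auto

lemma walk_sum_append: "walk_sum u (xs @ y # ys) = walk_sum u (xs @ [y]) + walk_sum u (y # ys)"
  by (induct xs rule: induct_list012) (auto simp: add.assoc)

lemma walk_sum_nonpos:
  assumes "\<And>a b. a \<in> S \<Longrightarrow> b \<in> S \<Longrightarrow> u a b \<le> 0" "set l \<subseteq> S"
  shows "walk_sum u l \<le> 0"
  using assms(2)
proof (induct l rule: induct_list012)
  case (3 a b l)
  then show ?case using assms(1)[of a b] by (auto intro: add_nonpos_nonpos)
qed auto

text \<open>Cutting out the loop between two occurrences of \<open>y\<close> removes a nonpositive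
  summand, so the sum can only grow; the list gets shorter until it is distinct.\<close>

lemma loop_erasure:
  assumes nonpos: "\<And>a b. a \<in> S \<Longrightarrow> b \<in> S \<Longrightarrow> u a b \<le> 0" and "set l \<subseteq> S" "l \<noteq> []"
  shows "\<exists>l'. distinct l' \<and> l' \<noteq> [] \<and> set l' \<subseteq> set l \<and> hd l' = hd l \<and> last l' = last l \<and> walk_sum u l \<le> walk_sum u l'"
  using assms(2,3)
proof (induct l rule: length_induct)
  case (1 l)
  show ?case
  proof (cases "distinct l")
    case False
    then obtain xs y ys zs where l: "l = xs @ [y] @ ys @ [y] @ zs" using not_distinct_decomp by blast
    define k where "k = xs @ y # zs"
    have "walk_sum u l = walk_sum u (xs @ [y]) + walk_sum u ((y # ys) @ y # zs)"
      unfolding l using walk_sum_append[of u xs y "ys @ [y] @ zs"] by simp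
    also have "\<dots> = walk_sum u (xs @ [y]) + (walk_sum u ((y # ys) @ [y]) + walk_sum u (y # zs))"
      using walk_sum_append[of u "y # ys" y zs] by simp
    also have "\<dots> \<le> walk_sum u (xs @ [y]) + (0 + walk_sum u (y # zs))"
      using 1(2) by (intro add_mono order_refl walk_sum_nonpos[OF nonpos]) (auto simp: l)
    also have "\<dots> = walk_sum u k" using walk_sum_append[of u xs y zs] by (simp add: k_def)
    finally have le: "walk_sum u l \<le> walk_sum u k" .
    have k: "k \<noteq> []" "set k \<subseteq> set l" "hd k = hd l" "last k = last l" "length k < length l"
      by (auto simp: k_def l hd_append)
    have "set k \<subseteq> S" using k(2) 1(2) by auto
    with 1(1) k obtain l' where "distinct l' \<and> l' \<noteq> [] \<and> set l' \<subseteq> set k \<and> hd l' = hd k \<and> last l' = last k \<and> walk_sum u k \<le> walk_sum u l'"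
      by metis
    then show ?thesis using k le by (intro exI[of _ l']) auto
  next
    case True
    then show ?thesis using 1(3) by (intro exI[of _ l]) auto
  qed
qed

lemma finite_index_tuples: "finite (index_tuples K k i j)"
proof (rule finite_subset)
  show "index_tuples K k i j \<subseteq> {l. set l \<subseteq> {1..K} \<and> length l = k + 2}" by (auto simp: index_tuples_def)
qed (rule finite_lists_length_eq, simp)

text \<open>Any \<open>k\<close> of the \<open>K - 2\<close> remaining indices can serve as
  intermediate ones. Thus the inner maximum in \<open>upper_cost\<close> is attained for every
  admissible \<open>k\<close>.\<close>

lemma index_tuples_nonempty:
  assumes "i \<in> {1..K}" "j \<in> {1..K}" "i \<noteq> j" "k \<le> K - 2"
  shows "index_tuples K k i j \<noteq> {}"
proof -
  have "card ({1..K} - {i, j}) = K - 2" using assms by (subst card_Diff_subset) auto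
  then obtain S where S: "S \<subseteq> {1..K} - {i, j}" "card S = k" "finite S"
    using assms obtain_subset_with_card_n[of k "{1..K} - {i, j}"] by auto
  then obtain l where l: "set l = S" "distinct l" using finite_distinct_list by metis
  then have "length l = k" using S distinct_card by metis
  then have "i # l @ [j] \<in> index_tuples K k i j"
    using l S assms by (auto simp: index_tuples_def nth_append)
  then show ?thesis by auto
qed

context
  fixes Pn :: "nat \<Rightarrow> 's \<Rightarrow> 's \<Rightarrow> real" and C :: "nat \<Rightarrow> 's set" and K :: nat
begin

lemma upper_cost_ge_distinct_walk:
  assumes "distinct l" "l \<noteq> []" "set l \<subseteq> {1..K}" "hd l \<noteq> last l"
  shows "walk_sum (upper_exponent Pn C) l \<le> upper_cost Pn K C (hd l) (last l)"
proof -
  let ?u = "upper_exponent Pn C" and ?i = "hd l" and ?j = "last l"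
  have ij: "?i \<in> {1..K}" "?j \<in> {1..K}" using assms(2,3) hd_in_set last_in_set by blast+
  have "length l \<ge> 2" using assms(2,4) by (cases l) (auto simp: Suc_le_eq split: if_splits)
  then obtain k where k: "length l = k + 2" by (metis add.commute le_Suc_ex)
  have "length l = card (set l)" using assms(1) by (simp add: distinct_card)
  also have "\<dots> \<le> K" using card_mono[OF _ assms(3)] by simp
  finally have "k \<in> {0..K - 2}" using k by simp
  have l: "l \<in> index_tuples K k ?i ?j"
    using assms k by (auto simp: index_tuples_def hd_conv_nth last_conv_nth)
  have "walk_sum ?u l = (\<Sum>s=0..k. ?u (l ! s) (l ! (s + 1)))" using k by (rule walk_sum_eq_sum[symmetric])
  also have "\<dots> \<le> (MAX l\<in>index_tuples K k ?i ?j. \<Sum>s=0..k. ?u (l ! s) (l ! (s + 1)))"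
    using finite_index_tuples by (intro Max_ge finite_imageI imageI l)
  also have "\<dots> \<le> upper_cost Pn K C ?i ?j"
    unfolding upper_cost_def
    using \<open>k \<in> {0..K - 2}\<close> by (intro Max_ge finite_imageI imageI) auto
  finally show ?thesis .
qed

lemma upper_cost_attained:
  assumes "i \<in> {1..K}" "j \<in> {1..K}" "i \<noteq> j"
  obtains l where "distinct l" "l \<noteq> []" "set l \<subseteq> {1..K}" "hd l = i" "last l = j"
    "upper_cost Pn K C i j = walk_sum (upper_exponent Pn C) l"
proof -
  let ?u = "upper_exponent Pn C"
  let ?g = "\<lambda>k. MAX l\<in>index_tuples K k i j. \<Sum>s=0..k. ?u (l ! s) (l ! (s + 1))"
  have "upper_cost Pn K C i j \<in> ?g ` {0..K - 2}"
    unfolding upper_cost_def by (intro Max_in) auto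
  then obtain k where k: "k \<in> {0..K - 2}" "upper_cost Pn K C i j = ?g k" by blast
  have "?g k \<in> (\<lambda>l. \<Sum>s=0..k. ?u (l ! s) (l ! (s + 1))) ` index_tuples K k i j"
    using k index_tuples_nonempty[OF assms] finite_index_tuples by (intro Max_in) auto
  then obtain l where l: "l \<in> index_tuples K k i j" "?g k = (\<Sum>s=0..k. ?u (l ! s) (l ! (s + 1)))" by blast
  have "?g k = walk_sum ?u l"
    unfolding l(2) using l(1) by (intro walk_sum_eq_sum) (auto simp: index_tuples_def)
  note walk = this
  show thesis
  proof (intro that[of l])
    show "l \<noteq> []" using l(1) by (auto simp: index_tuples_def)
    then show "hd l = i" "last l = j" using l(1) by (auto simp: index_tuples_def hd_conv_nth last_conv_nth)
    show "upper_cost Pn K C i j = walk_sum ?u l" using k(2) walk by (rule trans)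
  qed (use l(1) in \<open>auto simp: index_tuples_def\<close>)
qed

context
  assumes nonpos: "\<And>i j. i \<in> {1..K} \<Longrightarrow> j \<in> {1..K} \<Longrightarrow> upper_exponent Pn C i j \<le> 0"
begin

lemma upper_cost_ge_walk:
  assumes "l \<noteq> []" "set l \<subseteq> {1..K}" "hd l \<noteq> last l"
  shows "walk_sum (upper_exponent Pn C) l \<le> upper_cost Pn K C (hd l) (last l)"
proof -
  obtain l' where l': "distinct l'" "l' \<noteq> []" "set l' \<subseteq> set l" "hd l' = hd l" "last l' = last l"
    "walk_sum (upper_exponent Pn C) l \<le> walk_sum (upper_exponent Pn C) l'"
    using loop_erasure[where S = "{1..K}" and u = "upper_exponent Pn C", OF nonpos assms(2,1)] by blast
  have "set l' \<subseteq> {1..K}" "hd l' \<noteq> last l'" using l' assms by auto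
  then have "walk_sum (upper_exponent Pn C) l' \<le> upper_cost Pn K C (hd l') (last l')"
    by (intro upper_cost_ge_distinct_walk l'(1,2))
  then show ?thesis using order_trans[OF l'(6)] by (simp only: l'(4,5))
qed

lemma upper_cost_nonpos:
  assumes "i \<in> {1..K}" "j \<in> {1..K}" "i \<noteq> j"
  shows "upper_cost Pn K C i j \<le> 0"
proof -
  obtain l where "set l \<subseteq> {1..K}" "upper_cost Pn K C i j = walk_sum (upper_exponent Pn C) l"
    using upper_cost_attained[OF assms] by metis
  then show ?thesis using walk_sum_nonpos[where S = "{1..K}" and u = "upper_exponent Pn C", OF nonpos] by auto
qed

lemma upper_cost_ge_exponent:
  assumes "i \<in> {1..K}" "j \<in> {1..K}" "i \<noteq> j"
  shows "upper_exponent Pn C i j \<le> upper_cost Pn K C i j"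
  using upper_cost_ge_walk[of "[i, j]"] assms by simp

text \<open>Joining optimal tuples for the two legs gives a walk that may repeat indices; loop
  erasure makes it admissible without lowering its sum.\<close>

lemma upper_cost_triangle:
  assumes "a \<in> {1..K}" "b \<in> {1..K}" "c \<in> {1..K}" "a \<noteq> b" "b \<noteq> c" "a \<noteq> c"
  shows "upper_cost Pn K C a b + upper_cost Pn K C b c \<le> upper_cost Pn K C a c"
proof -
  let ?u = "upper_exponent Pn C"
  obtain l1 where l1: "l1 \<noteq> []" "set l1 \<subseteq> {1..K}" "hd l1 = a" "last l1 = b"
    "upper_cost Pn K C a b = walk_sum ?u l1"
    using upper_cost_attained[of a b] assms by metis
  obtain l2 where l2: "l2 \<noteq> []" "set l2 \<subseteq> {1..K}" "hd l2 = b" "last l2 = c"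
    "upper_cost Pn K C b c = walk_sum ?u l2"
    using upper_cost_attained[of b c] assms by metis
  define m1 m2 where "m1 = butlast l1" and "m2 = tl l2"
  have m: "l1 = m1 @ [b]" "l2 = b # m2"
    unfolding m1_def m2_def using l1(1,4) l2(1,3) by (metis append_butlast_last_id, metis list.collapse)
  have "walk_sum ?u l1 + walk_sum ?u l2 = walk_sum ?u (m1 @ b # m2)"
    using walk_sum_append[of ?u m1 b m2] by (simp add: m)
  also have "\<dots> \<le> upper_cost Pn K C (hd (m1 @ b # m2)) (last (m1 @ b # m2))"
    using l1 l2 assms by (intro upper_cost_ge_walk) (auto simp: m hd_append split: if_splits)
  also have "hd (m1 @ b # m2) = a" using l1 by (auto simp: m hd_append split: if_splits)
  also have "last (m1 @ b # m2) = c" using l2 by (auto simp: m)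
  finally show ?thesis by (simp add: l1 l2)
qed

end
end

section \<open>Path probabilities\<close>

text \<open>Paths are lists of states, most recent state first.\<close>

fun path_prob :: "('s \<Rightarrow> real) \<Rightarrow> (nat \<Rightarrow> 's \<Rightarrow> 's \<Rightarrow> real) \<Rightarrow> 's list \<Rightarrow> real" where
  "path_prob \<pi> Pn [] = 1"
| "path_prob \<pi> Pn [x] = \<pi> x"
| "path_prob \<pi> Pn (y # x # l) = path_prob \<pi> Pn (x # l) * Pn (Suc (length l)) x y"

text \<open>The argument \<open>Suc (length l)\<close> is the time of the step into
  \<open>y\<close>, as in \<open>path_prob\<close>. The initial state carries no weight, just as it
  does not contribute to the sample mean.\<close>

fun path_weight :: "(nat \<Rightarrow> 's \<Rightarrow> 's \<Rightarrow> real) \<Rightarrow> 's list \<Rightarrow> real" where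
  "path_weight g (y # x # l) = path_weight g (x # l) * g (Suc (length l)) x y"
| "path_weight g l = 1"

primrec history :: "(nat \<Rightarrow> 'w \<Rightarrow> 's) \<Rightarrow> nat \<Rightarrow> 'w \<Rightarrow> 's list" where
  "history X 0 \<omega> = [X 0 \<omega>]"
| "history X (Suc n) \<omega> = X (Suc n) \<omega> # history X n \<omega>"

lemma length_history [simp]: "length (history X n \<omega>) = Suc n"
  by (induct n) auto

lemma nth_history: "i \<le> n \<Longrightarrow> history X n \<omega> ! i = X (n - i) \<omega>"
  by (induct n arbitrary: i) (auto simp: nth_Cons split: nat.splits)

lemma history_eq_iff:
  assumes "length l = Suc n"
  shows "history X n \<omega> = l \<longleftrightarrow> (\<forall>k\<le>n. X k \<omega> = l ! (n - k))"
proof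
  assume "history X n \<omega> = l"
  then show "\<forall>k\<le>n. X k \<omega> = l ! (n - k)" using nth_history[of "n - k" n X \<omega> for k] by auto
next
  assume *: "\<forall>k\<le>n. X k \<omega> = l ! (n - k)"
  show "history X n \<omega> = l"
  proof (rule nth_equalityI)
    fix i assume "i < length (history X n \<omega>)"
    then show "history X n \<omega> ! i = l ! i" using * by (simp add: nth_history)
  qed (use assms in auto)
qed

text \<open>The oldest entry of the history, dropped by \<open>butlast\<close>, is
  \<open>X 0\<close>, which the sample mean leaves out.\<close>

lemma sum_history:
  "(\<Sum>i=1..n. f (X i \<omega>)) = (\<Sum>z\<in>UNIV. real (count_list (butlast (history X n \<omega>)) z) *\<^sub>R f z)"
  for f :: "'s::finite \<Rightarrow> 'v::real_vector"
proof (induct n)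
  case (Suc n)
  have "history X n \<omega> \<noteq> []" using length_history[of X n \<omega>] by (metis length_0_conv nat.distinct(1))
  then have "(\<Sum>z\<in>UNIV. real (count_list (butlast (history X (Suc n) \<omega>)) z) *\<^sub>R f z) =
      (\<Sum>z\<in>UNIV. real (count_list (butlast (history X n \<omega>)) z) *\<^sub>R f z + (if z = X (Suc n) \<omega> then f z else 0))"
    by (intro sum.cong) (auto simp: algebra_simps)
  also have "\<dots> = (\<Sum>z\<in>UNIV. real (count_list (butlast (history X n \<omega>)) z) *\<^sub>R f z) + f (X (Suc n) \<omega>)"
    by (simp add: sum.distrib)
  also have "\<dots> = (\<Sum>i=1..Suc n. f (X i \<omega>))" unfolding Suc[symmetric] by simp
  finally show ?case by simp
qed simp

lemma lists_length_Suc: "{l :: 's list. length l = Suc n} = (\<lambda>(y, l). y # l) ` (UNIV \<times> {l. length l = n})"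
  by (auto simp: image_iff length_Suc_conv)

lemma sum_lists_length_Suc:
  "(\<Sum>l | length l = Suc n. F l) = (\<Sum>l | length l = n. \<Sum>y\<in>UNIV. F (y # l))"
  for F :: "'s::finite list \<Rightarrow> 'v::comm_monoid_add"
proof -
  have "(\<Sum>l | length l = Suc n. F l) = (\<Sum>(y, l)\<in>UNIV \<times> {l. length l = n}. F (y # l))"
    unfolding lists_length_Suc by (subst sum.reindex) (auto simp: inj_on_def case_prod_beta)
  also have "\<dots> = (\<Sum>y\<in>UNIV. \<Sum>l | length l = n. F (y # l))" by (rule sum.cartesian_product[symmetric])
  also have "\<dots> = (\<Sum>l | length l = n. \<Sum>y\<in>UNIV. F (y # l))" by (rule sum.swap)
  finally show ?thesis .
qed

lemma finite_lists_length: "finite {l :: 's::finite list. length l = n}"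
  using finite_lists_length_eq[of "UNIV :: 's set" n] by simp

lemma path_prob_nonneg:
  assumes "\<And>x. 0 \<le> \<pi> x" "\<And>k x y. 1 \<le> k \<Longrightarrow> 0 \<le> Pn k x y"
  shows "0 \<le> path_prob \<pi> Pn l"
  by (induct l rule: induct_list012) (use assms in auto)

text \<open>Iterated supermartingale inequality: integrating out the newest state costs the factor
  \<open>D k\<close>. The factors depend on time because only late steps will be almost
  superharmonic.\<close>

lemma sum_path_weight_le:
  fixes Pn :: "nat \<Rightarrow> 's::finite \<Rightarrow> 's \<Rightarrow> real"
  assumes pos: "\<And>x. 0 \<le> \<pi> x" "\<And>k x y. 1 \<le> k \<Longrightarrow> 0 \<le> Pn k x y" "\<And>k x y. 0 \<le> g k x y" "\<And>k. 0 \<le> D k"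
    and step: "\<And>k x. 1 \<le> k \<Longrightarrow> (\<Sum>y\<in>UNIV. Pn k x y * g k x y * h y) \<le> D k * h x"
  shows "(\<Sum>l | length l = Suc n. path_prob \<pi> Pn l * path_weight g l * h (hd l))
    \<le> (\<Prod>k=1..n. D k) * (\<Sum>x\<in>UNIV. \<pi> x * h x)"
proof (induct n)
  case 0
  show ?case by (simp add: sum_lists_length_Suc)
next
  case (Suc n)
  have w: "0 \<le> path_weight g l" for l
    by (induct l rule: induct_list012) (use pos in auto)
  have "(\<Sum>l | length l = Suc (Suc n). path_prob \<pi> Pn l * path_weight g l * h (hd l)) =
      (\<Sum>l | length l = Suc n. \<Sum>y\<in>UNIV. path_prob \<pi> Pn (y # l) * path_weight g (y # l) * h y)"
    by (subst sum_lists_length_Suc) simp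
  also have "\<dots> = (\<Sum>l | length l = Suc n. path_prob \<pi> Pn l * path_weight g l *
      (\<Sum>y\<in>UNIV. Pn (Suc n) (hd l) y * g (Suc n) (hd l) y * h y))"
    by (intro sum.cong) (auto simp: length_Suc_conv sum_distrib_left algebra_simps)
  also have "\<dots> \<le> (\<Sum>l | length l = Suc n. path_prob \<pi> Pn l * path_weight g l * (D (Suc n) * h (hd l)))"
    by (intro sum_mono mult_left_mono step mult_nonneg_nonneg path_prob_nonneg pos w) auto
  also have "\<dots> = D (Suc n) * (\<Sum>l | length l = Suc n. path_prob \<pi> Pn l * path_weight g l * h (hd l))"
    by (simp add: sum_distrib_left algebra_simps)
  also have "\<dots> \<le> D (Suc n) * ((\<Prod>k=1..n. D k) * (\<Sum>x\<in>UNIV. \<pi> x * h x))"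
    by (intro mult_left_mono Suc pos)
  finally show ?case by (simp add: algebra_simps)
qed

lemma history_event:
  assumes chain: "nonhomogeneous_markov_chain Pr X \<pi> Pn"
  shows "{\<omega> \<in> space Pr. history X n \<omega> = l} \<in> sets Pr"
proof (induct n arbitrary: l)
  have X: "{\<omega> \<in> space Pr. X k \<omega> = x} \<in> sets Pr" for k x
    using chain measurable_sets[of "X k" Pr "count_space UNIV" "{x}"]
    by (simp add: nonhomogeneous_markov_chain_def vimage_def Int_def conj_commute)
  {
    case 0
    show ?case
    proof (cases "\<exists>x. l = [x]")
      case True
      then show ?thesis using X by auto
    next
      case False
      then have "{\<omega> \<in> space Pr. history X 0 \<omega> = l} = {}" by auto
      then show ?thesis by (simp only: sets.empty_sets)
    qed
  next
    case (Suc n)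
    show ?case
    proof (cases l)
      case (Cons y k)
      have "{\<omega> \<in> space Pr. history X (Suc n) \<omega> = l} =
          {\<omega> \<in> space Pr. X (Suc n) \<omega> = y} \<inter> {\<omega> \<in> space Pr. history X n \<omega> = k}"
        by (auto simp: Cons)
      then show ?thesis using X Suc by simp
    qed simp
  }
qed

lemma prob_history:
  assumes chain: "nonhomogeneous_markov_chain Pr X \<pi> Pn" and "length l = Suc n"
  shows "measure Pr {\<omega> \<in> space Pr. history X n \<omega> = l} = path_prob \<pi> Pn l"
  using assms(2)
proof (induct n arbitrary: l)
  case 0
  then obtain x where "l = [x]" by (auto simp: length_Suc_conv)
  then show ?case using chain by (simp add: nonhomogeneous_markov_chain_def)
next
  case (Suc n)
  interpret prob_space Pr using chain by (simp add: nonhomogeneous_markov_chain_def)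
  obtain y k where l: "l = y # k" "length k = Suc n" using Suc(2) by (auto simp: length_Suc_conv)
  then obtain x k' where k: "k = x # k'" "length k' = n" by (auto simp: length_Suc_conv)
  let ?z = "\<lambda>i. k ! (n - i)"
  have eq: "{\<omega> \<in> space Pr. history X n \<omega> = k} = {\<omega> \<in> space Pr. \<forall>i\<le>n. X i \<omega> = ?z i}"
    using history_eq_iff[OF l(2), of X] by auto
  have IH: "\<P>(\<omega> in Pr. \<forall>i\<le>n. X i \<omega> = ?z i) = path_prob \<pi> Pn k" using Suc(1)[OF l(2)] eq by simp
  have set_eq: "{\<omega> \<in> space Pr. history X (Suc n) \<omega> = l} =
      {\<omega> \<in> space Pr. X (Suc n) \<omega> = y \<and> (\<forall>i\<le>n. X i \<omega> = ?z i)}"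
    using eq by (auto simp: l)
  show ?case
  proof (cases "path_prob \<pi> Pn k > 0")
    case True
    have "\<P>(\<omega> in Pr. X (Suc n) \<omega> = y \<bar> \<forall>i\<le>n. X i \<omega> = ?z i) = Pn (Suc n) (?z n) y"
      using chain True IH by (simp add: nonhomogeneous_markov_chain_def)
    then show ?thesis unfolding set_eq using True IH
      by (simp add: cond_prob_def field_simps l k)
  next
    \<comment> \<open>After a history of probability zero the transition law is not prescribed, but
      then both sides vanish.\<close>
    case False
    have "measure Pr {\<omega> \<in> space Pr. history X (Suc n) \<omega> = l} \<le> measure Pr {\<omega> \<in> space Pr. history X n \<omega> = k}"
      using history_event[OF chain] by (intro finite_measure_mono) (auto simp: l)
    moreover have k0: "path_prob \<pi> Pn k = 0"
      using False Suc(1)[OF l(2)] measure_nonneg[of Pr "{\<omega> \<in> space Pr. history X n \<omega> = k}"] by linarith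
    ultimately have "measure Pr {\<omega> \<in> space Pr. history X (Suc n) \<omega> = l} = 0"
      using Suc(1)[OF l(2)] measure_nonneg[of Pr "{\<omega> \<in> space Pr. history X (Suc n) \<omega> = l}"] by linarith
    then show ?thesis using k0 by (simp add: l k)
  qed
qed

lemma prob_history_mem_le:
  fixes X :: "nat \<Rightarrow> 'w \<Rightarrow> 's::finite"
  assumes chain: "nonhomogeneous_markov_chain Pr X \<pi> Pn"
  shows "measure Pr {\<omega> \<in> space Pr. history X n \<omega> \<in> A} \<le> (\<Sum>l | length l = Suc n \<and> l \<in> A. path_prob \<pi> Pn l)"
proof -
  interpret prob_space Pr using chain by (simp add: nonhomogeneous_markov_chain_def)
  let ?S = "{l. length l = Suc n \<and> l \<in> A}"
  have fin: "finite ?S" by (rule finite_subset[OF _ finite_lists_length[of "Suc n"]]) auto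
  have "{\<omega> \<in> space Pr. history X n \<omega> \<in> A} = (\<Union>l\<in>?S. {\<omega> \<in> space Pr. history X n \<omega> = l})" by auto
  also have "measure Pr \<dots> \<le> (\<Sum>l\<in>?S. measure Pr {\<omega> \<in> space Pr. history X n \<omega> = l})"
    using fin history_event[OF chain] by (intro finite_measure_subadditive_finite image_subsetI)
  also have "\<dots> = (\<Sum>l\<in>?S. path_prob \<pi> Pn l)" by (intro sum.cong prob_history[OF chain]) auto
  finally show ?thesis .
qed

section \<open>Truncated costs, classes and empirical measures\<close>

text \<open>A finite substitute for the cost \<open>- u\<close>, to be used in exponential weights;
  letting \<open>A\<close> grow recovers \<open>- u\<close>.\<close>

definition truncated_cost :: "real \<Rightarrow> ereal \<Rightarrow> real" where
  "truncated_cost A u = real_of_ereal (min (- u) (ereal A))"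

lemma ereal_truncated_cost:
  assumes "0 \<le> A" "u \<le> 0"
  shows "ereal (truncated_cost A u) = min (- u) (ereal A)"
  using assms by (cases u) (auto simp: truncated_cost_def min_def)

lemma truncated_cost_nonneg: "0 \<le> A \<Longrightarrow> u \<le> 0 \<Longrightarrow> 0 \<le> truncated_cost A u"
  by (cases u) (auto simp: truncated_cost_def min_def)

lemma truncated_cost_antimono: "0 \<le> A \<Longrightarrow> u \<le> v \<Longrightarrow> v \<le> 0 \<Longrightarrow> truncated_cost A v \<le> truncated_cost A u"
  by (cases u; cases v) (auto simp: truncated_cost_def min_def)

text \<open>If a cost on the right is cut off at \<open>A\<close>, it alone dominates the left side;
  otherwise nothing on the right has changed.\<close>

lemma truncated_cost_triangle:
  assumes "0 \<le> A" "u \<le> 0" "v \<le> 0" "w \<le> 0" "u + v \<le> w"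
  shows "truncated_cost A w \<le> truncated_cost A u + truncated_cost A v"
  using assms by (cases u; cases v; cases w) (auto simp: truncated_cost_def min_def)

section \<open>Paths within communicating classes\<close>

lemma equiv_communicating: "equiv UNIV (communicating P)"
  by (rule equivI) (auto simp: communicating_def refl_on_def sym_def trans_def intro: trancl_trans)

text \<open>Irreducibility asks for paths inside the block. A path whose end leads back to its start
  meets only states communicating with the start, so it never leaves the class.\<close>

lemma trancl_in_class:
  assumes "(a, b) \<in> (transitions P)\<^sup>+" "(b, a) \<in> (transitions P)\<^sup>*"
  shows "(a, b) \<in> (transitions P \<inter> communicating P `` {a} \<times> communicating P `` {a})\<^sup>+"
  using assms
proof (induct rule: trancl_induct)
  case (base y)
  then show ?case by (intro r_into_trancl) (auto simp: communicating_def rtrancl_eq_or_trancl)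
next
  case (step y z)
  have "(y, a) \<in> (transitions P)\<^sup>*" using step by (meson converse_rtrancl_into_rtrancl)
  moreover have "(a, z) \<in> (transitions P)\<^sup>+" using step by (meson trancl.trancl_into_trancl)
  ultimately have "(y, z) \<in> transitions P \<inter> communicating P `` {a} \<times> communicating P `` {a}"
    using step by (auto simp: communicating_def rtrancl_eq_or_trancl)
  then show ?case using step(3)[OF \<open>(y, a) \<in> (transitions P)\<^sup>*\<close>] by (meson trancl.trancl_into_trancl)
qed

text \<open>Any two states of the class are joined through the step from \<open>x\<close> to
  \<open>y\<close>, which gives a path with at least one step even if the class is a single
  state.\<close>

lemma class_transition_imp_irreducible:
  assumes D: "D \<in> communicating_classes P" and xy: "x \<in> D" "y \<in> D" "P x y > 0"
  shows "irreducible_block P D"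
  unfolding irreducible_block_def
proof (intro ballI)
  fix a b assume ab: "a \<in> D" "b \<in> D"
  have *: "(u, v) \<in> (transitions P)\<^sup>*" if "u \<in> D" "v \<in> D" for u v
  proof -
    have "(u, v) \<in> communicating P"
      using D that in_quotient_imp_in_rel[OF equiv_communicating, of D P u v]
      unfolding communicating_classes_def by simp
    then show ?thesis by (auto simp: communicating_def trancl_into_rtrancl)
  qed
  have "(x, y) \<in> transitions P" using xy by (simp add: transitions_def)
  then have "(a, b) \<in> (transitions P)\<^sup>+"
    using rtrancl_into_trancl1[OF *[OF ab(1) xy(1)]] *[OF xy(2) ab(2)] by (metis trancl_rtrancl_trancl)
  moreover have "communicating P `` {a} = D"
    using D ab(1) equiv_communicating unfolding communicating_classes_def
    by (metis Image_singleton_iff equiv_class_eq_iff quotientE)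
  ultimately show "(a, b) \<in> (transitions P \<inter> D \<times> D)\<^sup>+"
    using trancl_in_class[of a b P] *[OF ab(2,1)] by simp
qed

section \<open>Path weights and costs in terms of visit counts\<close>

lemma count_list_map: "count_list (map c l) i = (\<Sum>y | c y = i. count_list l y)"
  for c :: "'s::finite \<Rightarrow> 'i"
proof (induct l)
  case (Cons x l)
  have "(\<Sum>y | c y = i. count_list (x # l) y) = (\<Sum>y | c y = i. count_list l y + (if y = x then 1 else 0))"
    by (intro sum.cong) auto
  also have "\<dots> = (\<Sum>y | c y = i. count_list l y) + (if c x = i then 1 else 0)"
    by (simp add: sum.distrib)
  finally show ?case using Cons by simp
qed simp

lemma path_weight_exp:
  fixes c :: "'s::finite \<Rightarrow> 'i" and \<phi> :: "'s \<Rightarrow> real"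
  shows "path_weight (\<lambda>k x y. exp (\<phi> y + (if c x = c y then 0 else real k * w (c x) (c y)))) l =
    exp ((\<Sum>y\<in>UNIV. real (count_list (butlast l) y) * \<phi> y) + switch_cost w (map c l))"
proof (induct l rule: induct_list012)
  case (3 y x l)
  have "(\<Sum>z\<in>UNIV. real (count_list (butlast (y # x # l)) z) * \<phi> z) =
      (\<Sum>z\<in>UNIV. real (count_list (butlast (x # l)) z) * \<phi> z + (if z = y then \<phi> y else 0))"
    by (intro sum.cong) (auto simp: algebra_simps)
  also have "\<dots> = (\<Sum>z\<in>UNIV. real (count_list (butlast (x # l)) z) * \<phi> z) + \<phi> y"
    by (simp add: sum.distrib)
  finally show ?case using 3(2) by (simp add: exp_add algebra_simps)
qed auto

definition empirical :: "nat \<Rightarrow> 's list \<Rightarrow> real ^ 's::finite" where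
  "empirical n l = (\<chi> z. real (count_list (butlast l) z) / real n)"

definition occupation :: "('s \<Rightarrow> nat) \<Rightarrow> real ^ 's::finite \<Rightarrow> nat \<Rightarrow> real" where
  "occupation c m i = (\<Sum>y | c y = i. m $ y)"

text \<open>The path exponent per unit of time, with the switching cost replaced by a lower bound
  along the order \<open>\<sigma>\<close>. It sees the path only through its empirical
  measure.\<close>

definition ordered_cost ::
  "('s \<Rightarrow> nat) \<Rightarrow> ('s \<Rightarrow> real) \<Rightarrow> (nat \<Rightarrow> nat \<Rightarrow> real) \<Rightarrow> nat list \<Rightarrow> real ^ 's::finite \<Rightarrow> real" where
  "ordered_cost c \<phi> W \<sigma> m = (\<Sum>y\<in>UNIV. m $ y * \<phi> y) + order_cost (occupation c m) W 0 \<sigma>"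

lemma ordered_cost_le_path_exponent:
  fixes c :: "'s::finite \<Rightarrow> nat"
  assumes fin: "finite S" and nonneg: "\<And>a b. a \<in> S \<Longrightarrow> b \<in> S \<Longrightarrow> a \<noteq> b \<Longrightarrow> 0 \<le> W a b"
    and tri: "\<And>a b c. a \<in> S \<Longrightarrow> b \<in> S \<Longrightarrow> c \<in> S \<Longrightarrow> a \<noteq> b \<Longrightarrow> b \<noteq> c \<Longrightarrow> a \<noteq> c \<Longrightarrow>
      W a c \<le> W a b + W b c"
    and le: "\<And>a b. a \<in> S \<Longrightarrow> b \<in> S \<Longrightarrow> a \<noteq> b \<Longrightarrow> W a b \<le> w a b"
    and c: "range c \<subseteq> S" and G: "G \<subseteq> S" and l: "length l = Suc n" "n \<ge> 1"
  shows "\<exists>\<sigma>. distinct \<sigma> \<and> set \<sigma> = G \<and> real n * ordered_cost c \<phi> W \<sigma> (empirical n l) \<le>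
    (\<Sum>y\<in>UNIV. real (count_list (butlast l) y) * \<phi> y) + switch_cost w (map c l)"
proof -
  let ?T = "\<lambda>i. real (count_list (butlast (map c l)) i)"
  have "\<exists>\<sigma>. distinct \<sigma> \<and> set \<sigma> = S \<and> last \<sigma> = hd (map c l) \<and> order_cost ?T W 0 \<sigma> \<le> switch_cost w (map c l)"
    using l c by (intro order_cost_le_switch_cost fin nonneg tri le) auto
  then obtain \<sigma> where \<sigma>: "distinct \<sigma>" "set \<sigma> = S" "order_cost ?T W 0 \<sigma> \<le> switch_cost w (map c l)" by blast
  \<comment> \<open>The order obtained so far covers all classes, while \<open>J\<close> knows only
    the irreducible ones. Dropping the others does not raise the order cost.\<close>
  let ?\<tau> = "filter (\<lambda>i. i \<in> G) \<sigma>"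
  interpret subadditive_weight S W ?T using nonneg tri by unfold_locales auto
  have "order_cost ?T W 0 ?\<tau> \<le> switch_cost w (map c l)"
    using order_cost_filter[of 0 \<sigma> "\<lambda>i. i \<in> G"] \<sigma> by auto
  moreover have "?T = (\<lambda>i. real n * occupation c (empirical n l) i)"
    using l by (auto simp: occupation_def empirical_def count_list_map map_butlast[symmetric] sum_distrib_left)
  then have "order_cost ?T W 0 ?\<tau> = real n * order_cost (occupation c (empirical n l)) W 0 ?\<tau>"
    using order_cost_scale_time[of "real n" _ W 0] by simp
  moreover have "real n * (\<Sum>y\<in>UNIV. empirical n l $ y * \<phi> y) = (\<Sum>y\<in>UNIV. real (count_list (butlast l) y) * \<phi> y)"
    using l by (auto simp: empirical_def sum_distrib_left)
  ultimately show ?thesis using \<sigma> G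
    by (intro exI[of _ ?\<tau>]) (auto simp: ordered_cost_def distrib_left)
qed

lemma continuous_on_ordered_cost: "continuous_on UNIV (ordered_cost c \<phi> W \<sigma>)"
  unfolding ordered_cost_def[abs_def] occupation_def[abs_def]
  by (intro continuous_intros continuous_on_order_cost)

section \<open>The exponential supermartingale\<close>

locale markov_classes =
  fixes Pn :: "nat \<Rightarrow> 's::finite \<Rightarrow> 's \<Rightarrow> real" and P :: "'s \<Rightarrow> 's \<Rightarrow> real"
    and f :: "'s \<Rightarrow> real ^ 'd"
    and N M :: nat and C :: "nat \<Rightarrow> 's set" and \<zeta> :: "nat \<Rightarrow> nat"
  assumes Pn_stochastic: "\<And>n. n \<ge> 1 \<Longrightarrow> stochastic (Pn n)"
    and P_stochastic: "stochastic P"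
    and Pn_tendsto: "\<And>x y. (\<lambda>n. Pn n x y) \<longlonglongrightarrow> P x y"
    and decomposition: "class_decomposition P N M C \<zeta>"
begin

definition classes :: "nat set" where "classes = {1..N + M}"

definition irreducible_classes :: "nat set" where
  "irreducible_classes = {i \<in> {1..N + M}. irreducible_block P (C i)}"

definition class_of :: "'s \<Rightarrow> nat" where
  "class_of x = (THE i. i \<in> classes \<and> x \<in> C i)"

lemma finite_classes [simp]: "finite classes"
  by (simp add: classes_def)

lemma Pn_nonneg: "1 \<le> n \<Longrightarrow> 0 \<le> Pn n x y" and Pn_sum: "1 \<le> n \<Longrightarrow> (\<Sum>y\<in>UNIV. Pn n x y) = 1"
  using Pn_stochastic[of n] by (auto simp: stochastic_def prob_vector_def)

lemma Pn_le_1: "1 \<le> n \<Longrightarrow> Pn n x y \<le> 1"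
  using member_le_sum[of y UNIV "Pn n x"] Pn_nonneg[of n x] Pn_sum[of n x] by simp

lemma P_nonneg: "0 \<le> P x y"
  using P_stochastic by (auto simp: stochastic_def prob_vector_def)

lemma class_in_quotient: "i \<in> classes \<Longrightarrow> C i \<in> communicating_classes P"
  using decomposition by (auto simp: class_decomposition_def classes_def bij_betw_def)

lemma class_nonempty: "i \<in> classes \<Longrightarrow> C i \<noteq> {}"
  using class_in_quotient[of i] in_quotient_imp_non_empty[OF equiv_communicating]
  by (auto simp: communicating_classes_def)

lemma class_of_unique: "\<exists>!i. i \<in> classes \<and> x \<in> C i"
proof -
  have bij: "bij_betw C classes (communicating_classes P)"
    using decomposition by (simp add: class_decomposition_def classes_def)
  have "communicating P `` {x} \<in> communicating_classes P"
    unfolding communicating_classes_def by (intro quotientI) auto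
  then obtain i where i: "i \<in> classes" "C i = communicating P `` {x}"
    using bij by (metis bij_betw_imp_surj_on imageE)
  then have "x \<in> C i" by (auto simp: communicating_def)
  moreover have "j = i" if j: "j \<in> classes" "x \<in> C j" for j
  proof -
    have "C i \<inter> C j \<noteq> {}" using \<open>x \<in> C i\<close> j by auto
    then have "C i = C j"
      using quotient_disj[OF equiv_communicating, of "C i" P "C j"] class_in_quotient i(1) j(1)
      by (auto simp: communicating_classes_def)
    then show ?thesis using bij i(1) j(1) by (auto simp: bij_betw_def inj_on_def)
  qed
  ultimately show ?thesis using i(1) by blast
qed

lemma class_of_in_classes: "class_of x \<in> classes" and mem_class_of: "x \<in> C (class_of x)"
  using theI'[OF class_of_unique[of x]] by (auto simp: class_of_def)

lemma mem_class_iff: "i \<in> classes \<Longrightarrow> x \<in> C i \<longleftrightarrow> class_of x = i"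
  using class_of_unique[of x] class_of_in_classes[of x] mem_class_of[of x] by auto

lemma backward_zero: "class_of y < class_of x \<Longrightarrow> P x y = 0"
  using decomposition class_of_in_classes mem_class_of
  unfolding class_decomposition_def classes_def by blast

lemma degenerate_zero:
  assumes "i \<in> classes - irreducible_classes" "x \<in> C i" "y \<in> C i"
  shows "P x y = 0"
proof (rule ccontr)
  assume "P x y \<noteq> 0"
  with P_nonneg[of x y] have "P x y > 0" by simp
  then have "irreducible_block P (C i)"
    using class_transition_imp_irreducible[OF class_in_quotient, of i x y] assms by auto
  then show False using assms by (auto simp: irreducible_classes_def classes_def)
qed

lemma max_transition_attained:
  assumes "i \<in> classes" "j \<in> classes"
  obtains x y where "x \<in> C i" "y \<in> C j" "max_transition Pn C n i j = Pn n x y"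
proof -
  have "max_transition Pn C n i j \<in> (\<lambda>x. MAX y\<in>C j. Pn n x y) ` C i"
    unfolding max_transition_def using assms class_nonempty by (intro Max_in) auto
  then obtain x where x: "x \<in> C i" "max_transition Pn C n i j = (MAX y\<in>C j. Pn n x y)" by blast
  have "(MAX y\<in>C j. Pn n x y) \<in> Pn n x ` C j" using assms class_nonempty by (intro Max_in) auto
  then show thesis using x that by auto
qed

lemma le_max_transition: "x \<in> C i \<Longrightarrow> y \<in> C j \<Longrightarrow> Pn n x y \<le> max_transition Pn C n i j"
  unfolding max_transition_def by (rule order_trans[of _ "MAX y\<in>C j. Pn n x y"]) (auto intro!: Max_ge)

lemma max_transition_nonneg: "i \<in> classes \<Longrightarrow> j \<in> classes \<Longrightarrow> 1 \<le> n \<Longrightarrow> 0 \<le> max_transition Pn C n i j"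
  and max_transition_le_1: "i \<in> classes \<Longrightarrow> j \<in> classes \<Longrightarrow> 1 \<le> n \<Longrightarrow> max_transition Pn C n i j \<le> 1"
  by (metis max_transition_attained Pn_nonneg, metis max_transition_attained Pn_le_1)

lemma upper_exponent_nonpos:
  assumes "i \<in> classes" "j \<in> classes"
  shows "upper_exponent Pn C i j \<le> 0"
  unfolding upper_exponent_def
proof (rule Limsup_bounded)
  show "\<forall>\<^sub>F n in sequentially. ereal (1 / real n) * elog (max_transition Pn C n i j) \<le> 0"
    using eventually_ge_at_top[of 1]
  proof eventually_elim
    case (elim n)
    have "elog (max_transition Pn C n i j) \<le> 0"
      using max_transition_nonneg[OF assms elim] max_transition_le_1[OF assms elim] by (auto simp: elog_def)
    then show ?case by (simp add: ereal_mult_le_0_iff)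
  qed
qed

section \<open>Weighted switch probabilities at large times\<close>

definition step_rate :: "real \<Rightarrow> real \<Rightarrow> nat \<Rightarrow> nat \<Rightarrow> real" where
  "step_rate A c i j = c * truncated_cost A (upper_exponent Pn C i j)"

definition cost_rate :: "real \<Rightarrow> real \<Rightarrow> nat \<Rightarrow> nat \<Rightarrow> real" where
  "cost_rate A c i j = c * truncated_cost A (upper_cost Pn (N + M) C i j)"

text \<open>The midpoint \<open>c'\<close> of \<open>c\<close> and 1 lies strictly below 1, so the
  limsup bound gives eventually at most \<open>exp (- k * c' * m)\<close> for the transition
  probability. This beats the weight \<open>exp (k * c * m)\<close>.\<close>

lemma max_transition_bound:
  assumes ij: "i \<in> classes" "j \<in> classes" and A: "0 \<le> A" and c: "0 < c" "c < 1"
    and pos: "step_rate A c i j > 0"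
  obtains \<epsilon> where "\<epsilon> > 0"
    "\<forall>\<^sub>F k in sequentially. max_transition Pn C k i j * exp (real k * step_rate A c i j) \<le> exp (- real k * \<epsilon>)"
proof -
  let ?u = "upper_exponent Pn C i j"
  define m where "m = truncated_cost A ?u"
  have m: "m > 0" using pos c by (simp add: step_rate_def m_def zero_less_mult_iff)
  define c' where "c' = (1 + c) / 2"
  have c': "c < c'" "c' < 1" using c by (auto simp: c'_def)
  have "ereal m \<le> - ?u"
    using ereal_truncated_cost[OF A upper_exponent_nonpos[OF ij]] by (simp add: m_def)
  then have "?u \<le> ereal (- m)" by (cases ?u) auto
  also have "\<dots> < ereal (- (c' * m))" using m c' by simp
  finally have "\<forall>\<^sub>F k in sequentially. ereal (1 / real k) * elog (max_transition Pn C k i j) < ereal (- (c' * m))"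
    unfolding upper_exponent_def by (rule Limsup_lessD)
  then have "\<forall>\<^sub>F k in sequentially. max_transition Pn C k i j * exp (real k * step_rate A c i j)
      \<le> exp (- real k * ((c' - c) * m))"
    using eventually_ge_at_top[of 1]
  proof eventually_elim
    case (elim k)
    let ?t = "max_transition Pn C k i j"
    show ?case
    proof (cases "?t = 0")
      case False
      then have t: "?t > 0" using max_transition_nonneg[OF ij elim(2)] by simp
      then have "1 / real k * ln ?t < - (c' * m)" using elim(1) by (simp add: elog_def)
      then have "ln ?t < - real k * (c' * m)" using elim(2) by (simp add: field_simps)
      then have "?t \<le> exp (- real k * (c' * m))" using t by (metis exp_le_cancel_iff exp_ln less_imp_le)
      then have "?t * exp (real k * step_rate A c i j) \<le> exp (- real k * (c' * m)) * exp (real k * step_rate A c i j)"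
        by (intro mult_right_mono) auto
      also have "\<dots> = exp (- real k * ((c' - c) * m))"
        by (simp add: exp_add[symmetric] step_rate_def m_def algebra_simps)
      finally show ?thesis .
    qed auto
  qed
  moreover have "(c' - c) * m > 0" using c' m by simp
  ultimately show thesis using that by blast
qed

lemma switch_weight_le_1:
  assumes A: "0 \<le> A" and c: "0 < c" "c < 1"
  shows "\<forall>\<^sub>F k in sequentially. Pn k x y * exp (real k * step_rate A c (class_of x) (class_of y)) \<le> 1"
proof -
  let ?i = "class_of x" and ?j = "class_of y"
  have nonneg: "0 \<le> step_rate A c ?i ?j"
    using c upper_exponent_nonpos class_of_in_classes A
    by (auto simp: step_rate_def intro!: mult_nonneg_nonneg truncated_cost_nonneg)
  show ?thesis
  proof (cases "step_rate A c ?i ?j = 0")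
    case True
    then show ?thesis using Pn_le_1 by (auto intro!: eventually_sequentiallyI[of 1])
  next
    case False
    with nonneg have "step_rate A c ?i ?j > 0" by simp
    from max_transition_bound[OF class_of_in_classes class_of_in_classes A c this]
    obtain \<epsilon> where e: "\<epsilon> > 0" "\<forall>\<^sub>F k in sequentially.
      max_transition Pn C k ?i ?j * exp (real k * step_rate A c ?i ?j) \<le> exp (- real k * \<epsilon>)" by blast
    from e(2) show ?thesis
    proof eventually_elim
      case (elim k)
      have "Pn k x y * exp (real k * step_rate A c ?i ?j) \<le> max_transition Pn C k ?i ?j * exp (real k * step_rate A c ?i ?j)"
        by (intro mult_right_mono le_max_transition mem_class_of) auto
      also have "\<dots> \<le> exp (- real k * \<epsilon>)" by (rule elim)
      also have "\<dots> \<le> 1" using e(1) by simp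
      finally show ?case .
    qed
  qed
qed

text \<open>A positive rate leaves exponential decay after weighting. At rate zero there may be no
  such decay, but then the weight is 1 and the limit is \<open>P x y = 0\<close>.\<close>

lemma switch_weight_tendsto_0:
  assumes A: "0 \<le> A" and c: "0 < c" "c < 1" and zero: "P x y = 0"
  shows "(\<lambda>k. Pn k x y * exp (real k * step_rate A c (class_of x) (class_of y))) \<longlonglongrightarrow> 0"
proof -
  let ?i = "class_of x" and ?j = "class_of y"
  have nonneg: "0 \<le> step_rate A c ?i ?j"
    using c upper_exponent_nonpos class_of_in_classes A
    by (auto simp: step_rate_def intro!: mult_nonneg_nonneg truncated_cost_nonneg)
  show ?thesis
  proof (cases "step_rate A c ?i ?j = 0")
    case True
    then show ?thesis using Pn_tendsto[of x y] zero by simp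
  next
    case False
    with nonneg have "step_rate A c ?i ?j > 0" by simp
    from max_transition_bound[OF class_of_in_classes class_of_in_classes A c this]
    obtain \<epsilon> where e: "\<epsilon> > 0" "\<forall>\<^sub>F k in sequentially.
      max_transition Pn C k ?i ?j * exp (real k * step_rate A c ?i ?j) \<le> exp (- real k * \<epsilon>)" by blast
    have "(\<lambda>k. exp (- \<epsilon>) ^ k) \<longlonglongrightarrow> 0" using e(1) by (intro LIMSEQ_realpow_zero) auto
    then have lim: "(\<lambda>k. exp (- real k * \<epsilon>)) \<longlonglongrightarrow> 0" by (simp add: exp_of_nat_mult[symmetric])
    show ?thesis
    proof (rule tendsto_sandwich[OF _ _ tendsto_const lim])
      show "\<forall>\<^sub>F k in sequentially. 0 \<le> Pn k x y * exp (real k * step_rate A c ?i ?j)"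
        using Pn_nonneg by (auto intro!: eventually_sequentiallyI[of 1])
      show "\<forall>\<^sub>F k in sequentially. Pn k x y * exp (real k * step_rate A c ?i ?j) \<le> exp (- real k * \<epsilon>)"
        using e(2)
      proof eventually_elim
        case (elim k)
        have "Pn k x y * exp (real k * step_rate A c ?i ?j) \<le> max_transition Pn C k ?i ?j * exp (real k * step_rate A c ?i ?j)"
          by (intro mult_right_mono le_max_transition mem_class_of) auto
        also have "\<dots> \<le> exp (- real k * \<epsilon>)" by (rule elim)
        finally show ?case .
      qed
    qed
  qed
qed

definition tilt :: "('s \<Rightarrow> real) \<Rightarrow> real \<Rightarrow> real \<Rightarrow> nat \<Rightarrow> 's \<Rightarrow> 's \<Rightarrow> real" where
  "tilt \<phi> A c k x y =
    exp (\<phi> y + (if class_of x = class_of y then 0 else real k * step_rate A c (class_of x) (class_of y)))"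

text \<open>
  Class \<open>i\<close> is weighted by \<open>\<kappa> ^ i\<close>: a small \<open>\<kappa>\<close> makes the transitions to classes of
  higher index negligible, and those to classes of lower index have vanishing probability.
\<close>

lemma tilted_supermartingale:
  assumes A: "0 \<le> A" and c: "0 < c" "c < 1" and \<eta>: "\<eta> > 0"
    and h0: "\<And>x. h0 x > 0"
    and eig: "\<And>x. (\<Sum>y | class_of y = class_of x. P x y * exp (\<phi> y) * h0 y) \<le> h0 x"
  obtains h where "\<And>x. h x > 0"
    "\<forall>\<^sub>F k in sequentially. \<forall>x. (\<Sum>y\<in>UNIV. Pn k x y * tilt \<phi> A c k x y * h y) \<le> (1 + \<eta>) * h x"
proof -
  define B where "B = (\<Sum>y\<in>UNIV. exp (\<phi> y) * h0 y)"
  define hm where "hm = Min (range h0)"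
  have hm: "hm > 0" "hm \<le> h0 x" for x using h0 by (auto simp: hm_def)
  have B: "B > 0" unfolding B_def by (intro sum_pos) (auto simp: h0)
  \<comment> \<open>Relative to \<open>\<kappa> ^ class_of x\<close>, steps to classes of higher
    index contribute at most \<open>\<kappa> * B\<close>. This is kept below
    \<open>\<eta> / 2 * h0 x\<close>; the other half of \<open>\<eta>\<close> is room for the
    passage to the limit.\<close>
  define \<kappa> where "\<kappa> = min 1 (\<eta> * hm / (2 * B))"
  have \<kappa>: "\<kappa> > 0" "\<kappa> \<le> 1" using \<eta> hm B by (auto simp: \<kappa>_def)
  have \<kappa>B: "\<kappa> * B \<le> \<eta> / 2 * h0 x" for x
  proof -
    have "\<kappa> * B \<le> \<eta> * hm / (2 * B) * B" using B by (intro mult_right_mono) (auto simp: \<kappa>_def)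
    also have "\<dots> = \<eta> / 2 * hm" using B by simp
    also have "\<dots> \<le> \<eta> / 2 * h0 x" using \<eta> hm by (intro mult_left_mono) auto
    finally show ?thesis .
  qed
  define h where "h y = \<kappa> ^ class_of y * h0 y" for y
  have h: "h x > 0" for x using \<kappa> h0 by (simp add: h_def)
  have "\<forall>\<^sub>F k in sequentially. (\<Sum>y\<in>UNIV. Pn k x y * tilt \<phi> A c k x y * h y) \<le> (1 + \<eta>) * h x" for x
  proof -
    let ?i = "class_of x"
    \<comment> \<open>Bounds for the summands that converge in \<open>k\<close>: for classes of
      higher index the weighted transition probability need not converge and is replaced by its
      eventual bound 1.\<close>
    define b where "b k y = (if ?i < class_of y then exp (\<phi> y) * h y else
      (Pn k x y * exp (if ?i = class_of y then 0 else real k * step_rate A c ?i (class_of y))) * (exp (\<phi> y) * h y))" for k y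
    define L where "L y = (if ?i < class_of y then exp (\<phi> y) * h y else if ?i = class_of y then P x y * (exp (\<phi> y) * h y) else 0)" for y
    have "(\<lambda>k. b k y) \<longlonglongrightarrow> L y" for y
    proof -
      consider "?i < class_of y" | "?i = class_of y" | "class_of y < ?i" by linarith
      then show ?thesis
      proof cases
        case 3
        have "(\<lambda>k. Pn k x y * exp (real k * step_rate A c ?i (class_of y)) * (exp (\<phi> y) * h y)) \<longlonglongrightarrow> 0"
          using switch_weight_tendsto_0[OF A c backward_zero[OF 3]] by (intro tendsto_mult_left_zero)
        then show ?thesis using 3 by (simp add: b_def L_def)
      qed (auto simp: b_def L_def intro!: tendsto_intros Pn_tendsto)
    qed
    then have lim: "(\<lambda>k. \<Sum>y\<in>UNIV. b k y) \<longlonglongrightarrow> (\<Sum>y\<in>UNIV. L y)" by (intro tendsto_sum)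
    have "L y \<le> (if class_of y = ?i then \<kappa> ^ ?i * (P x y * exp (\<phi> y) * h0 y) else 0) + \<kappa> ^ ?i * \<kappa> * (exp (\<phi> y) * h0 y)" for y
    proof -
      have "0 \<le> \<kappa> ^ ?i * \<kappa> * (exp (\<phi> y) * h0 y)" using \<kappa> h0[of y] by simp
      moreover have "\<kappa> ^ class_of y * (exp (\<phi> y) * h0 y) \<le> \<kappa> ^ Suc ?i * (exp (\<phi> y) * h0 y)" if "?i < class_of y"
        using that \<kappa> h0[of y] by (intro mult_right_mono power_decreasing) auto
      ultimately show ?thesis by (auto simp: L_def h_def algebra_simps)
    qed
    then have "(\<Sum>y\<in>UNIV. L y) \<le> (\<Sum>y\<in>UNIV. (if class_of y = ?i then \<kappa> ^ ?i * (P x y * exp (\<phi> y) * h0 y) else 0) + \<kappa> ^ ?i * \<kappa> * (exp (\<phi> y) * h0 y))"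
      by (rule sum_mono)
    also have "\<dots> = \<kappa> ^ ?i * (\<Sum>y | class_of y = ?i. P x y * exp (\<phi> y) * h0 y) + \<kappa> ^ ?i * (\<kappa> * B)"
      by (simp add: sum.distrib sum.If_cases B_def sum_distrib_left mult.assoc)
    also have "\<dots> \<le> \<kappa> ^ ?i * h0 x + \<kappa> ^ ?i * (\<eta> / 2 * h0 x)"
      using \<kappa> by (intro add_mono mult_left_mono eig \<kappa>B) auto
    also have "\<dots> = (1 + \<eta> / 2) * h x" by (simp add: h_def algebra_simps)
    also have "\<dots> < (1 + \<eta>) * h x" using \<eta> h by (intro mult_strict_right_mono) auto
    finally have "\<forall>\<^sub>F k in sequentially. (\<Sum>y\<in>UNIV. b k y) < (1 + \<eta>) * h x"
      using order_tendstoD(2)[OF lim] by blast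
    moreover have "\<forall>\<^sub>F k in sequentially. \<forall>y. Pn k x y * exp (real k * step_rate A c ?i (class_of y)) \<le> 1"
      using switch_weight_le_1[OF A c] by (simp add: eventually_all_finite)
    ultimately show ?thesis
      using eventually_ge_at_top[of 1]
    proof eventually_elim
      case (elim k)
      have "(\<Sum>y\<in>UNIV. Pn k x y * tilt \<phi> A c k x y * h y) \<le> (\<Sum>y\<in>UNIV. b k y)"
      proof (rule sum_mono)
        fix y
        have "Pn k x y * exp (real k * step_rate A c ?i (class_of y)) * (exp (\<phi> y) * h y) \<le> 1 * (exp (\<phi> y) * h y)"
          using elim(2) h[of y] by (intro mult_right_mono) auto
        then show "Pn k x y * tilt \<phi> A c k x y * h y \<le> b k y"
          by (auto simp: b_def tilt_def exp_add algebra_simps)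
      qed
      then show ?case using elim(1) by linarith
    qed
  qed
  then have "\<forall>\<^sub>F k in sequentially. \<forall>x. (\<Sum>y\<in>UNIV. Pn k x y * tilt \<phi> A c k x y * h y) \<le> (1 + \<eta>) * h x"
    by (rule eventually_all_finite)
  with h that show thesis by blast
qed

end

section \<open>Chernoff bounds\<close>

lemma ereal_less_add_split:
  fixes x y :: ereal
  assumes "ereal a < x + y" "0 \<le> x" "0 \<le> y"
  obtains r s where "ereal r < x" "ereal s < y" "a < r + s"
proof (cases x)
  case (real x')
  note x = real
  show thesis
  proof (cases y)
    case (real y')
    define d where "d = (x' + y' - a) / 3"
    have "d > 0" using assms x real by (simp add: d_def)
    moreover have "a < (x' - d) + (y' - d)" using \<open>d > 0\<close> by (simp add: d_def field_simps)
    ultimately show ?thesis using that[of "x' - d" "y' - d"] x real by simp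
  next
    case PInf
    then show ?thesis using that[of "x' - 1" "a - x' + 2"] x by simp
  qed (use assms in auto)
next
  case PInf
  then show thesis using that[of "a + 2" "-1"] assms by (simp add: less_le_trans[of _ 0])
qed (use assms in auto)

lemma ereal_less_sum_split:
  fixes e :: "'i \<Rightarrow> ereal"
  assumes "finite S" "\<And>i. i \<in> S \<Longrightarrow> 0 \<le> e i" "ereal a < (\<Sum>i\<in>S. e i)"
  shows "\<exists>r. (\<forall>i\<in>S. ereal (r i) < e i) \<and> a < (\<Sum>i\<in>S. r i)"
  using assms
proof (induct S arbitrary: a)
  case (insert i S)
  then have "ereal a < e i + (\<Sum>i\<in>S. e i)" by simp
  then obtain r s where rs: "ereal r < e i" "ereal s < (\<Sum>i\<in>S. e i)" "a < r + s"
    using insert by (elim ereal_less_add_split) (auto intro: sum_nonneg)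
  then obtain q where q: "\<forall>i\<in>S. ereal (q i) < e i" "s < (\<Sum>i\<in>S. q i)"
    using insert.hyps(3)[OF insert.prems(1)[OF insertI2] rs(2)] by auto
  have "(\<Sum>j\<in>insert i S. (q(i := r)) j) = r + (\<Sum>j\<in>S. q j)"
    unfolding sum.insert[OF insert(1,2)] using insert(2) by (auto intro!: sum.cong)
  then show ?case using rs q insert(2) by (intro exI[of _ "q(i := r)"]) auto
qed auto

text \<open>For \<open>t = 0\<close> and \<open>u = -\<infinity>\<close> the convention
  \<open>0 * \<infinity> = 0\<close> makes the hypothesis say \<open>r < 0\<close>, which excludes
  the only case in which no cutoff would help.\<close>

lemma less_truncated_cost:
  assumes "u \<le> 0" "0 \<le> t" "ereal r < ereal t * (- u)"
  shows "\<forall>\<^sub>F A in at_top. r < t * truncated_cost A u"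
proof (cases u)
  case (real u')
  have "\<forall>\<^sub>F A in at_top. - u' \<le> A" by (rule eventually_ge_at_top)
  then show ?thesis
    by eventually_elim (use real assms in \<open>auto simp: truncated_cost_def min_def\<close>)
next
  case MInf
  show ?thesis
  proof (cases "t = 0")
    case False
    have "\<forall>\<^sub>F A in at_top. r / t < A" by (rule eventually_gt_at_top)
    then show ?thesis
      by eventually_elim (use MInf False assms in \<open>auto simp: truncated_cost_def field_simps\<close>)
  qed (use MInf assms in auto)
qed (use assms in auto)

context markov_classes
begin

lemma path_weight_sum_bound:
  assumes A: "0 \<le> A" and c: "0 < c" "c < 1" and \<eta>: "\<eta> > 0" and \<pi>: "prob_vector \<pi>"
    and h0: "\<And>x. h0 x > 0"
    and eig: "\<And>x. (\<Sum>y | class_of y = class_of x. P x y * exp (\<phi> y) * h0 y) \<le> h0 x"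
  obtains B where "B > 0"
    "\<And>n. (\<Sum>l | length l = Suc n. path_prob \<pi> Pn l * path_weight (tilt \<phi> A c) l) \<le> B * (1 + \<eta>) ^ n"
proof -
  obtain h where h: "\<And>x. h x > 0"
    "\<forall>\<^sub>F k in sequentially. \<forall>x. (\<Sum>y\<in>UNIV. Pn k x y * tilt \<phi> A c k x y * h y) \<le> (1 + \<eta>) * h x"
    by (rule tilted_supermartingale[OF A c \<eta> h0 eig], rule that)
  obtain n0 where n0: "\<And>k x. k \<ge> n0 \<Longrightarrow> (\<Sum>y\<in>UNIV. Pn k x y * tilt \<phi> A c k x y * h y) \<le> (1 + \<eta>) * h x"
    using h(2) by (auto simp: eventually_sequentially)
  have \<pi>0: "0 \<le> \<pi> x" for x using \<pi> by (simp add: prob_vector_def)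
  have pos: "0 \<le> tilt \<phi> A c k x y" for k x y by (simp add: tilt_def)
  define q where "q k x = (\<Sum>y\<in>UNIV. Pn k x y * tilt \<phi> A c k x y * h y) / h x" for k x
  have q: "0 \<le> q k x" if "1 \<le> k" for k x
    unfolding q_def using h(1) Pn_nonneg[OF that] pos
    by (intro divide_nonneg_pos sum_nonneg mult_nonneg_nonneg) (auto intro: less_imp_le)
  \<comment> \<open>The superharmonic inequality is available only from \<open>n0\<close> on. Each
    earlier step costs at most an additional factor \<open>E\<close>, so together they contribute
    the constant \<open>E ^ n0\<close>.\<close>
  define E where "E = 1 + (\<Sum>k\<in>{1..<n0}. \<Sum>x\<in>UNIV. q k x)"
  have "0 \<le> (\<Sum>k\<in>{1..<n0}. \<Sum>x\<in>UNIV. q k x)" using q by (intro sum_nonneg) auto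
  then have E: "1 \<le> E" by (simp add: E_def)
  define D where "D k = (1 + \<eta>) * (if k < n0 then E else 1)" for k
  have D: "0 \<le> D k" for k using E \<eta> by (simp add: D_def)
  have step: "(\<Sum>y\<in>UNIV. Pn k x y * tilt \<phi> A c k x y * h y) \<le> D k * h x" if k: "1 \<le> k" for k x
  proof (cases "k < n0")
    case True
    have "q k x \<le> (\<Sum>x\<in>UNIV. q k x)" using q[OF k] by (intro member_le_sum) auto
    also have "\<dots> \<le> (\<Sum>k\<in>{1..<n0}. \<Sum>x\<in>UNIV. q k x)"
      using k True q by (intro member_le_sum[of k _ "\<lambda>k. \<Sum>x\<in>UNIV. q k x"]) (auto intro!: sum_nonneg)
    also have "\<dots> \<le> E" by (simp add: E_def)
    also have "\<dots> \<le> D k" using True E \<eta> by (simp add: D_def)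
    finally show ?thesis using h(1)[of x] by (simp add: q_def divide_le_eq)
  qed (use n0 in \<open>simp add: D_def\<close>)
  have prod_D: "(\<Prod>k=1..n. D k) \<le> (1 + \<eta>) ^ n * E ^ n0" for n
  proof -
    have "(\<Prod>k=1..n. if k < n0 then E else 1) = (\<Prod>k\<in>{1..n} \<inter> {k. k < n0}. E)"
      by (simp add: prod.If_cases)
    also have "\<dots> = E ^ card ({1..n} \<inter> {k. k < n0})" by simp
    also have "\<dots> \<le> E ^ n0"
    proof (rule power_increasing[OF _ E])
      have "card ({1..n} \<inter> {k. k < n0}) \<le> card {..<n0}" by (rule card_mono) auto
      then show "card ({1..n} \<inter> {k. k < n0}) \<le> n0" by simp
    qed
    finally show ?thesis using \<eta> by (simp add: D_def prod.distrib mult_left_mono)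
  qed
  define hm where "hm = Min (range h)"
  have hm: "hm > 0" "hm \<le> h x" for x using h by (auto simp: hm_def)
  define S where "S = (\<Sum>x\<in>UNIV. \<pi> x * h x)"
  have S: "0 \<le> S" unfolding S_def by (intro sum_nonneg mult_nonneg_nonneg \<pi>0 less_imp_le[OF h(1)])
  have w: "0 \<le> path_weight (tilt \<phi> A c) l" for l
    by (induct l rule: induct_list012) (auto simp: pos)
  have pp: "0 \<le> path_prob \<pi> Pn l" for l by (intro path_prob_nonneg \<pi>0 Pn_nonneg)
  have "(\<Sum>l | length l = Suc n. path_prob \<pi> Pn l * path_weight (tilt \<phi> A c) l)
      \<le> ((E ^ n0 * S + 1) / hm) * (1 + \<eta>) ^ n" for n
  proof -
    have "hm * (\<Sum>l | length l = Suc n. path_prob \<pi> Pn l * path_weight (tilt \<phi> A c) l)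
      \<le> (\<Sum>l | length l = Suc n. path_prob \<pi> Pn l * path_weight (tilt \<phi> A c) l * h (hd l))"
      unfolding sum_distrib_left using hm pp w
      by (intro sum_mono) (subst mult.commute, intro mult_left_mono, auto)
    also have "\<dots> \<le> (\<Prod>k=1..n. D k) * S"
      unfolding S_def by (intro sum_path_weight_le \<pi>0 Pn_nonneg pos D step)
    also have "\<dots> \<le> ((1 + \<eta>) ^ n * E ^ n0) * S" by (intro mult_right_mono prod_D S)
    also have "\<dots> \<le> (E ^ n0 * S + 1) * (1 + \<eta>) ^ n" using \<eta> by (simp add: algebra_simps)
    finally show ?thesis using hm(1) by (simp add: field_simps)
  qed
  moreover have "(E ^ n0 * S + 1) / hm > 0"
    using E S hm(1) by (intro divide_pos_pos add_nonneg_pos mult_nonneg_nonneg) auto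
  ultimately show thesis by (rule that[rotated])
qed

text \<open>What is needed to delete visits from an order and to compare with the one-step weights;
  truncation and scaling preserve these properties of \<open>upper_cost\<close>.\<close>

lemma cost_rate_props:
  assumes A: "0 \<le> A" and c: "0 < c"
  shows "\<And>i j. i \<in> classes \<Longrightarrow> j \<in> classes \<Longrightarrow> i \<noteq> j \<Longrightarrow> 0 \<le> cost_rate A c i j"
    and "\<And>i j k. i \<in> classes \<Longrightarrow> j \<in> classes \<Longrightarrow> k \<in> classes \<Longrightarrow> i \<noteq> j \<Longrightarrow> j \<noteq> k \<Longrightarrow> i \<noteq> k \<Longrightarrow>
      cost_rate A c i k \<le> cost_rate A c i j + cost_rate A c j k"
    and "\<And>i j. i \<in> classes \<Longrightarrow> j \<in> classes \<Longrightarrow> i \<noteq> j \<Longrightarrow> cost_rate A c i j \<le> step_rate A c i j"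
proof -
  have np: "upper_exponent Pn C i j \<le> 0" if "i \<in> {1..N + M}" "j \<in> {1..N + M}" for i j
    using upper_exponent_nonpos that by (simp add: classes_def)
  note rules = upper_cost_nonpos[where Pn = Pn and C = C and K = "N + M", OF np]
    upper_cost_triangle[where Pn = Pn and C = C and K = "N + M", OF np]
    upper_cost_ge_exponent[where Pn = Pn and C = C and K = "N + M", OF np]
  show "0 \<le> cost_rate A c i j" if "i \<in> classes" "j \<in> classes" "i \<noteq> j" for i j
    unfolding cost_rate_def using A c that[unfolded classes_def]
    by (intro mult_nonneg_nonneg truncated_cost_nonneg rules) auto
  show "cost_rate A c i k \<le> cost_rate A c i j + cost_rate A c j k"
    if "i \<in> classes" "j \<in> classes" "k \<in> classes" "i \<noteq> j" "j \<noteq> k" "i \<noteq> k" for i j k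
    unfolding cost_rate_def distrib_left[symmetric] using that[unfolded classes_def] A c
    by (intro mult_left_mono truncated_cost_triangle rules) auto
  show "cost_rate A c i j \<le> step_rate A c i j" if "i \<in> classes" "j \<in> classes" "i \<noteq> j" for i j
    unfolding cost_rate_def step_rate_def using that[unfolded classes_def] A c
    by (intro mult_left_mono truncated_cost_antimono rules) auto
qed

section \<open>Chernoff bound on a set of empirical measures\<close>

definition orders :: "nat list set" where
  "orders = {\<sigma>. distinct \<sigma> \<and> set \<sigma> = irreducible_classes}"

lemma irreducible_classes_subset: "irreducible_classes \<subseteq> classes"
  by (auto simp: irreducible_classes_def classes_def)

lemma finite_irreducible_classes [simp]: "finite irreducible_classes"
  using irreducible_classes_subset finite_classes by (rule finite_subset)

lemma finite_orders: "finite orders"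
proof (rule finite_subset)
  show "orders \<subseteq> {\<sigma>. set \<sigma> \<subseteq> irreducible_classes \<and> length \<sigma> = card irreducible_classes}"
    by (auto simp: orders_def distinct_card[symmetric])
qed (rule finite_lists_length_eq, simp)

lemma orders_nonempty: "orders \<noteq> {}"
  using finite_distinct_list[of irreducible_classes] by (auto simp: orders_def)

text \<open>Markov's inequality for the path weight: as the ordered cost exceeds \<open>a\<close> on
  \<open>U\<close> for every order, the weight is at least \<open>exp (n * a)\<close> there,
  whichever order belongs to the path.\<close>

lemma empirical_sum_bound:
  assumes A: "0 \<le> A" and c: "0 < c" "c < 1" and \<eta>: "\<eta> > 0" and \<pi>: "prob_vector \<pi>"
    and h0: "\<And>x. h0 x > 0"
    and eig: "\<And>x. (\<Sum>y | class_of y = class_of x. P x y * exp (\<phi> y) * h0 y) \<le> h0 x"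
    and U: "\<And>m \<sigma>. m \<in> U \<Longrightarrow> \<sigma> \<in> orders \<Longrightarrow> a < ordered_cost class_of \<phi> (cost_rate A c) \<sigma> m"
  obtains B where "B > 0"
    "\<And>n. n \<ge> 1 \<Longrightarrow> (\<Sum>l | length l = Suc n \<and> empirical n l \<in> U. path_prob \<pi> Pn l) \<le> B * (1 + \<eta>) ^ n * exp (- real n * a)"
proof -
  obtain B where B: "B > 0"
    "\<And>n. (\<Sum>l | length l = Suc n. path_prob \<pi> Pn l * path_weight (tilt \<phi> A c) l) \<le> B * (1 + \<eta>) ^ n"
    by (rule path_weight_sum_bound[OF A c \<eta> \<pi> h0 eig], rule that)
  have \<pi>0: "0 \<le> \<pi> x" for x using \<pi> by (simp add: prob_vector_def)
  have pp: "0 \<le> path_prob \<pi> Pn l" for l by (intro path_prob_nonneg \<pi>0 Pn_nonneg)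
  have w: "path_weight (tilt \<phi> A c) l = exp ((\<Sum>y\<in>UNIV. real (count_list (butlast l) y) * \<phi> y)
      + switch_cost (step_rate A c) (map class_of l))" for l
    unfolding tilt_def[abs_def] by (rule path_weight_exp)
  have "(\<Sum>l | length l = Suc n \<and> empirical n l \<in> U. path_prob \<pi> Pn l) \<le> B * (1 + \<eta>) ^ n * exp (- real n * a)"
    if n: "n \<ge> 1" for n
  proof -
    have "exp (real n * a) \<le> path_weight (tilt \<phi> A c) l" if l: "length l = Suc n" "empirical n l \<in> U" for l
    proof -
      have "\<exists>\<sigma>. distinct \<sigma> \<and> set \<sigma> = irreducible_classes \<and>
          real n * ordered_cost class_of \<phi> (cost_rate A c) \<sigma> (empirical n l) \<le>
          (\<Sum>y\<in>UNIV. real (count_list (butlast l) y) * \<phi> y) + switch_cost (step_rate A c) (map class_of l)"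
        using class_of_in_classes l(1) n
        by (intro ordered_cost_le_path_exponent[where S = classes] cost_rate_props A c irreducible_classes_subset) auto
      then obtain \<sigma> where \<sigma>: "\<sigma> \<in> orders" "real n * ordered_cost class_of \<phi> (cost_rate A c) \<sigma> (empirical n l) \<le>
          (\<Sum>y\<in>UNIV. real (count_list (butlast l) y) * \<phi> y) + switch_cost (step_rate A c) (map class_of l)"
        by (auto simp: orders_def)
      have "real n * a \<le> real n * ordered_cost class_of \<phi> (cost_rate A c) \<sigma> (empirical n l)"
        using U[OF l(2) \<sigma>(1)] by (intro mult_left_mono) auto
      then show ?thesis using \<sigma>(2) unfolding w by simp
    qed
    then have "(\<Sum>l | length l = Suc n \<and> empirical n l \<in> U. path_prob \<pi> Pn l * exp (real n * a))
        \<le> (\<Sum>l | length l = Suc n \<and> empirical n l \<in> U. path_prob \<pi> Pn l * path_weight (tilt \<phi> A c) l)"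
      by (intro sum_mono mult_left_mono pp) auto
    also have "\<dots> \<le> (\<Sum>l | length l = Suc n. path_prob \<pi> Pn l * path_weight (tilt \<phi> A c) l)"
      by (intro sum_mono2 finite_lists_length) (auto simp: w pp)
    also have "\<dots> \<le> B * (1 + \<eta>) ^ n" by (rule B)
    finally show ?thesis by (simp add: sum_distrib_right[symmetric] exp_minus field_simps)
  qed
  with B(1) show thesis by (rule that)
qed

text \<open>Subtracting the logarithm normalizes the tilted block to eigenvalue 1. The block of a
  degenerate class is zero, so its states can carry any constant; the cutoff \<open>A\<close> of the
  switching costs is reused for this.\<close>

definition exponent :: "(nat \<Rightarrow> real ^ 'd) \<Rightarrow> real \<Rightarrow> 's \<Rightarrow> real" where
  "exponent \<theta> A y = (if class_of y \<in> irreducible_classes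
     then \<theta> (class_of y) \<bullet> f y - ln (tilted_eigenvalue P f (C (class_of y)) (\<theta> (class_of y))) else A)"

lemma irreducible_classD:
  assumes "i \<in> irreducible_classes"
  shows "i \<in> classes" "C i \<noteq> {}" "irreducible_block P (C i)"
  using assms irreducible_classes_subset class_nonempty by (auto simp: irreducible_classes_def)

lemma exponent_eigenvector:
  obtains h where "\<And>x. h x > 0"
    "\<And>x. (\<Sum>y | class_of y = class_of x. P x y * exp (exponent \<theta> A y) * h y) \<le> h x"
proof -
  have "\<exists>h. tilted_eigenvalue P f (C i) (\<theta> i) > 0 \<and> (\<forall>x\<in>C i. h x > 0) \<and>
    (\<forall>x\<in>C i. (\<Sum>y\<in>C i. P x y * exp (\<theta> i \<bullet> f y) * h y) = tilted_eigenvalue P f (C i) (\<theta> i) * h x)"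
    if "i \<in> irreducible_classes" for i
    using tilted_eigenvector[OF P_nonneg irreducible_classD(2,3)[OF that], where f = f and \<theta> = "\<theta> i"] by metis
  then have "\<exists>H. \<forall>i\<in>irreducible_classes. tilted_eigenvalue P f (C i) (\<theta> i) > 0 \<and> (\<forall>x\<in>C i. H i x > 0) \<and>
    (\<forall>x\<in>C i. (\<Sum>y\<in>C i. P x y * exp (\<theta> i \<bullet> f y) * H i y) = tilted_eigenvalue P f (C i) (\<theta> i) * H i x)"
    by (intro bchoice) blast
  then obtain H where H: "\<And>i. i \<in> irreducible_classes \<Longrightarrow> tilted_eigenvalue P f (C i) (\<theta> i) > 0"
    "\<And>i x. i \<in> irreducible_classes \<Longrightarrow> x \<in> C i \<Longrightarrow> H i x > 0"
    "\<And>i x. i \<in> irreducible_classes \<Longrightarrow> x \<in> C i \<Longrightarrow> (\<Sum>y\<in>C i. P x y * exp (\<theta> i \<bullet> f y) * H i y) = tilted_eigenvalue P f (C i) (\<theta> i) * H i x"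
    by blast
  define h where "h x = (if class_of x \<in> irreducible_classes then H (class_of x) x else 1)" for x
  have pos: "h x > 0" for x using H(2) mem_class_of by (simp add: h_def)
  moreover have "(\<Sum>y | class_of y = class_of x. P x y * exp (exponent \<theta> A y) * h y) \<le> h x" for x
  proof (cases "class_of x \<in> irreducible_classes")
    case True
    let ?i = "class_of x" and ?r = "tilted_eigenvalue P f (C (class_of x)) (\<theta> (class_of x))"
    have "(\<Sum>y | class_of y = ?i. P x y * exp (exponent \<theta> A y) * h y) = (\<Sum>y\<in>C ?i. P x y * exp (\<theta> ?i \<bullet> f y) * H ?i y / ?r)"
      using True H(1)[OF True]
      by (intro sum.cong) (auto simp: mem_class_iff[OF class_of_in_classes] exponent_def h_def exp_diff)
    also have "\<dots> = h x"
      using True H(1)[OF True] H(3)[OF True mem_class_of] by (simp add: sum_divide_distrib[symmetric] h_def)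
    finally show ?thesis by simp
  next
    case False
    have "(\<Sum>y | class_of y = class_of x. P x y * exp (exponent \<theta> A y) * h y) = 0"
    proof (rule sum.neutral, safe)
      fix y assume "class_of y = class_of x"
      then have "P x y = 0"
        using degenerate_zero[of "class_of x" x y] False class_of_in_classes[of x] mem_class_of[of x] mem_class_of[of y] by auto
      then show "P x y * exp (exponent \<theta> A y) * h y = 0" by simp
    qed
    then show ?thesis using pos[of x] by simp
  qed
  ultimately show thesis by (rule that)
qed

end

section \<open>The rate function and the linearized costs\<close>

context markov_classes
begin

lemma sum_over_classes: "(\<Sum>y\<in>UNIV. g y) = (\<Sum>i\<in>classes. \<Sum>y | class_of y = i. g y)"
  for g :: "'s \<Rightarrow> 'v::comm_monoid_add"
  using sum.group[of UNIV classes class_of g] class_of_in_classes by (simp add: image_subset_iff)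

lemma sum_irreducible_classes:
  fixes g :: "'s \<Rightarrow> 'v::comm_monoid_add"
  assumes "\<And>y. class_of y \<notin> irreducible_classes \<Longrightarrow> g y = 0"
  shows "(\<Sum>y\<in>UNIV. g y) = (\<Sum>i\<in>irreducible_classes. \<Sum>y | class_of y = i. g y)"
  unfolding sum_over_classes
  using irreducible_classes_subset assms by (intro sum.mono_neutral_right ballI sum.neutral) auto

abbreviation upper_rate :: "nat \<Rightarrow> nat \<Rightarrow> ereal" where
  "upper_rate \<equiv> upper_cost Pn (N + M) C"

abbreviation rate :: "nat \<Rightarrow> real ^ 'd \<Rightarrow> ereal" where
  "rate i \<equiv> class_rate P f (C i)"

abbreviation J :: "real ^ 'd \<Rightarrow> ereal" where
  "J \<equiv> rate_J M \<zeta> rate upper_rate"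

lemma upper_rate_nonpos:
  assumes "i \<in> classes" "j \<in> classes" "i \<noteq> j"
  shows "upper_rate i j \<le> 0"
proof -
  have np: "upper_exponent Pn C i j \<le> 0" if "i \<in> {1..N + M}" "j \<in> {1..N + M}" for i j
    using upper_exponent_nonpos that by (simp add: classes_def)
  show ?thesis
    using assms by (intro upper_cost_nonpos np) (auto simp: classes_def)
qed

lemma \<zeta>_bij: "bij_betw \<zeta> {1..M} irreducible_classes"
  using decomposition by (simp add: class_decomposition_def irreducible_classes_def)

lemma rate_nonneg: "i \<in> irreducible_classes \<Longrightarrow> 0 \<le> rate i x"
  using class_rate_nonneg[OF P_stochastic irreducible_classD(2,3)] .

text \<open>For \<open>M = 1\<close> the switching sum is empty and the only weight is 1, so the
  separate clause agrees with the general formula and later arguments avoid the case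
  distinction.\<close>

lemma path_cost_eq:
  assumes v: "v \<in> prob_weights M" and \<sigma>: "\<sigma> permutes {1..M}"
  shows "path_cost M \<zeta> rate upper_rate v \<sigma> x =
    - (\<Sum>i=1..M - 1. ereal (\<Sum>j=1..i. v j) * upper_rate (\<zeta> (\<sigma> i)) (\<zeta> (\<sigma> (i + 1))))
      + (\<Sum>i=1..M. ereal (v i) * rate (\<zeta> (\<sigma> i)) (x i))"
proof (cases "M = 1")
  case True
  then have "\<sigma> 1 = 1" using \<sigma> permutes_in_image[of \<sigma> "{1..M}" 1] by auto
  moreover have "v 1 = 1" using v True by (simp add: prob_weights_def)
  ultimately show ?thesis using True by (simp add: path_cost_def one_ereal_def[symmetric])
qed (simp add: path_cost_def)

text \<open>Negation is additive here because \<open>\<infinity>\<close> never meets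
  \<open>-\<infinity>\<close>.\<close>

lemma ereal_minus_sum_nonpos:
  fixes g :: "'i \<Rightarrow> ereal"
  assumes "finite S" "\<And>i. i \<in> S \<Longrightarrow> g i \<le> 0"
  shows "- (\<Sum>i\<in>S. g i) = (\<Sum>i\<in>S. - g i)"
  using assms
proof (induct S)
  case (insert i S)
  have "(\<Sum>i\<in>S. g i) \<le> 0" using insert by (intro sum_nonpos) auto
  then have "- (g i + (\<Sum>i\<in>S. g i)) = - g i + - (\<Sum>i\<in>S. g i)"
    using insert(4)[of i] by (cases "g i"; cases "\<Sum>i\<in>S. g i") auto
  then show ?case using insert by simp
qed simp

lemma J_le_path_cost:
  assumes "v \<in> prob_weights M" "x \<in> averaging_to M v z" "\<sigma> permutes {1..M}"
  shows "J z \<le> path_cost M \<zeta> rate upper_rate v \<sigma> x"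
  unfolding rate_J_def
  by (rule INF_lower2[OF assms(1)], rule INF_lower2[OF assms(2)])
    (use assms(3) finite_permutations[of "{1..M}"] in \<open>auto intro!: Min_le\<close>)

text \<open>Orders are lists indexed from 0 and permutations act on \<open>{1..M}\<close>; hence the
  shift by one.\<close>

lemma permutation_of_order:
  assumes "\<sigma> \<in> orders"
  obtains p where "p permutes {1..M}" "length \<sigma> = M" "\<And>i. i < M \<Longrightarrow> \<zeta> (p (Suc i)) = \<sigma> ! i"
proof -
  have dist: "distinct \<sigma>" and set: "set \<sigma> = irreducible_classes" using assms by (auto simp: orders_def)
  have len: "length \<sigma> = M" using distinct_card[OF dist] bij_betw_same_card[OF \<zeta>_bij] set by simp
  define p where "p j = (if j \<in> {1..M} then inv_into {1..M} \<zeta> (\<sigma> ! (j - 1)) else j)" for j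
  have b1: "bij_betw (\<lambda>j. \<sigma> ! (j - 1)) {1..M} irreducible_classes"
  proof -
    have "bij_betw (\<lambda>j. j - 1) {1..M} {..<M}"
      by (rule bij_betw_byWitness[where f' = Suc]) auto
    from bij_betw_trans[OF this bij_betw_nth[OF dist]] len set show ?thesis by (simp add: o_def)
  qed
  have "bij_betw (\<lambda>j. inv_into {1..M} \<zeta> (\<sigma> ! (j - 1))) {1..M} {1..M}"
    using bij_betw_trans[OF b1 bij_betw_inv_into[OF \<zeta>_bij]] by (simp add: o_def)
  then have "bij_betw p {1..M} {1..M}" by (rule bij_betw_cong[THEN iffD1, rotated]) (simp add: p_def)
  then have perm: "p permutes {1..M}" by (rule bij_imp_permutes) (auto simp: p_def)
  have "\<zeta> (p (Suc i)) = \<sigma> ! i" if "i < M" for i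
  proof -
    have "\<sigma> ! i \<in> irreducible_classes" using that len set nth_mem by fastforce
    then have "\<zeta> (inv_into {1..M} \<zeta> (\<sigma> ! i)) = \<sigma> ! i" using bij_betw_inv_into_right[OF \<zeta>_bij] by auto
    then show ?thesis using that by (simp add: p_def)
  qed
  with perm len show thesis by (rule that)
qed

text \<open>A measure without mass on degenerate classes gives a competitor in the infimum
  \<open>J\<close>: the class masses, listed in the order \<open>\<sigma>\<close>, are the weights
  and the class means are the points. Where the mass is zero, \<open>x i\<close> stays free.\<close>

lemma J_le_order_cost:
  fixes m :: "real ^ 's"
  defines "v \<equiv> occupation class_of m"
  assumes m: "\<And>y. 0 \<le> m $ y" "(\<Sum>y\<in>UNIV. m $ y) = 1"
    and null: "\<And>y. class_of y \<notin> irreducible_classes \<Longrightarrow> m $ y = 0"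
    and x: "\<And>i. i \<in> irreducible_classes \<Longrightarrow> v i *\<^sub>R x i = (\<Sum>y | class_of y = i. m $ y *\<^sub>R f y)"
    and \<sigma>: "\<sigma> \<in> orders"
  shows "J (\<Sum>y\<in>UNIV. m $ y *\<^sub>R f y) \<le>
    (\<Sum>i<length \<sigma> - 1. ereal (\<Sum>j\<le>i. v (\<sigma> ! j)) * - upper_rate (\<sigma> ! i) (\<sigma> ! Suc i))
    + (\<Sum>i\<in>irreducible_classes. ereal (v i) * rate i (x i))"
proof -
  obtain p where p: "p permutes {1..M}" "length \<sigma> = M" "\<And>i. i < M \<Longrightarrow> \<zeta> (p (Suc i)) = \<sigma> ! i"
    using permutation_of_order[OF \<sigma>] by blast
  have dist: "distinct \<sigma>" and set: "set \<sigma> = irreducible_classes" using \<sigma> by (auto simp: orders_def)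
  have v0: "0 \<le> v i" for i unfolding v_def occupation_def by (intro sum_nonneg m(1))
  have nth: "\<sigma> ! i \<in> irreducible_classes" if "i < M" for i using that p(2) set nth_mem by fastforce
  let ?v = "\<lambda>i. v (\<sigma> ! (i - 1))" and ?x = "\<lambda>i. x (\<sigma> ! (i - 1))"
  have shift: "(\<Sum>i=1..n. g (i - 1)) = (\<Sum>i<n. g i)" for n and g :: "nat \<Rightarrow> 'v::comm_monoid_add"
    by (rule sum.reindex_bij_witness[of _ Suc "\<lambda>i. i - 1"]) auto
  have over_order: "(\<Sum>i<M. g (\<sigma> ! i)) = (\<Sum>i\<in>irreducible_classes. g i)" for g :: "nat \<Rightarrow> 'v::comm_monoid_add"
    using sum.reindex_bij_betw[OF bij_betw_nth[OF dist refl refl], of g] p(2) set by simp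
  have "(\<Sum>i\<in>irreducible_classes. v i) = 1"
    using sum_irreducible_classes[of "\<lambda>y. m $ y"] null m(2) by (simp add: v_def occupation_def)
  then have w: "?v \<in> prob_weights M"
    using v0 shift[of "\<lambda>i. v (\<sigma> ! i)" M] over_order[of v] by (simp add: prob_weights_def)
  have "(\<Sum>i=1..M. ?v i *\<^sub>R ?x i) = (\<Sum>i\<in>irreducible_classes. v i *\<^sub>R x i)"
    using shift[of "\<lambda>i. v (\<sigma> ! i) *\<^sub>R x (\<sigma> ! i)" M] over_order[of "\<lambda>i. v i *\<^sub>R x i"] by simp
  also have "\<dots> = (\<Sum>i\<in>irreducible_classes. \<Sum>y | class_of y = i. m $ y *\<^sub>R f y)" using x by (intro sum.cong) auto
  also have "\<dots> = (\<Sum>y\<in>UNIV. m $ y *\<^sub>R f y)" using null by (subst sum_irreducible_classes) auto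
  finally have avg: "?x \<in> averaging_to M ?v (\<Sum>y\<in>UNIV. m $ y *\<^sub>R f y)" by (simp add: averaging_to_def)
  have U: "upper_rate (\<sigma> ! i) (\<sigma> ! Suc i) \<le> 0" if "i < M - 1" for i
    using that nth[of i] nth[of "Suc i"] irreducible_classes_subset dist p(2)
    by (intro upper_rate_nonpos) (auto simp: nth_eq_iff_index_eq)
  have "(\<Sum>i=1..M - 1. ereal (\<Sum>j=1..i. ?v j) * upper_rate (\<zeta> (p i)) (\<zeta> (p (i + 1)))) =
      (\<Sum>i=1..M - 1. (\<lambda>i. ereal (\<Sum>j\<le>i. v (\<sigma> ! j)) * upper_rate (\<sigma> ! i) (\<sigma> ! Suc i)) (i - 1))"
  proof (intro sum.cong refl)
    fix i assume i: "i \<in> {1..M - 1}"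
    then obtain k where k: "i = Suc k" by (cases i) auto
    show "ereal (\<Sum>j=1..i. ?v j) * upper_rate (\<zeta> (p i)) (\<zeta> (p (i + 1))) =
      (\<lambda>i. ereal (\<Sum>j\<le>i. v (\<sigma> ! j)) * upper_rate (\<sigma> ! i) (\<sigma> ! Suc i)) (i - 1)"
      using i k shift[of "\<lambda>j. v (\<sigma> ! j)" i] p(3)[of k] p(3)[of "Suc k"] by (simp add: lessThan_Suc_atMost)
  qed
  also have "\<dots> = (\<Sum>i<M - 1. ereal (\<Sum>j\<le>i. v (\<sigma> ! j)) * upper_rate (\<sigma> ! i) (\<sigma> ! Suc i))" by (rule shift)
  finally have sum_U: "(\<Sum>i=1..M - 1. ereal (\<Sum>j=1..i. ?v j) * upper_rate (\<zeta> (p i)) (\<zeta> (p (i + 1)))) = \<dots>" .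
  have "- (\<Sum>i<M - 1. ereal (\<Sum>j\<le>i. v (\<sigma> ! j)) * upper_rate (\<sigma> ! i) (\<sigma> ! Suc i)) =
      (\<Sum>i<M - 1. - (ereal (\<Sum>j\<le>i. v (\<sigma> ! j)) * upper_rate (\<sigma> ! i) (\<sigma> ! Suc i)))"
    using U v0 by (intro ereal_minus_sum_nonpos) (auto simp: ereal_mult_le_0_iff intro!: sum_nonneg)
  then have 1: "- (\<Sum>i=1..M - 1. ereal (\<Sum>j=1..i. ?v j) * upper_rate (\<zeta> (p i)) (\<zeta> (p (i + 1)))) =
      (\<Sum>i<M - 1. ereal (\<Sum>j\<le>i. v (\<sigma> ! j)) * - upper_rate (\<sigma> ! i) (\<sigma> ! Suc i))"
    unfolding sum_U by (simp only: ereal_mult_minus_right)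
  have "(\<Sum>i=1..M. ereal (?v i) * rate (\<zeta> (p i)) (?x i)) =
      (\<Sum>i=1..M. (\<lambda>i. ereal (v (\<sigma> ! i)) * rate (\<sigma> ! i) (x (\<sigma> ! i))) (i - 1))"
  proof (intro sum.cong refl)
    fix i assume i: "i \<in> {1..M}"
    then obtain k where k: "i = Suc k" by (cases i) auto
    show "ereal (?v i) * rate (\<zeta> (p i)) (?x i) = (\<lambda>i. ereal (v (\<sigma> ! i)) * rate (\<sigma> ! i) (x (\<sigma> ! i))) (i - 1)"
      using i k p(3)[of k] by simp
  qed
  also have "\<dots> = (\<Sum>i<M. ereal (v (\<sigma> ! i)) * rate (\<sigma> ! i) (x (\<sigma> ! i)))" by (rule shift)
  also have "\<dots> = (\<Sum>i\<in>irreducible_classes. ereal (v i) * rate i (x i))" by (rule over_order)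
  finally have 2: "(\<Sum>i=1..M. ereal (?v i) * rate (\<zeta> (p i)) (?x i)) = \<dots>" .
  show ?thesis
    using J_le_path_cost[OF w avg p(1)] unfolding path_cost_eq[OF w p(1)] 1 2 p(2) .
qed

text \<open>Removing all entries does not raise the cost, and the empty order costs 0.\<close>

lemma order_cost_nonneg:
  assumes A: "0 \<le> A" and c: "0 < c" and T: "\<And>i. 0 \<le> T i" and \<sigma>: "\<sigma> \<in> orders"
  shows "0 \<le> order_cost T (cost_rate A c) 0 \<sigma>"
proof -
  interpret subadditive_weight classes "cost_rate A c" T
    using cost_rate_props[OF A c] T by unfold_locales
  show ?thesis
    using order_cost_filter[of 0 \<sigma> "\<lambda>_. False"] \<sigma> irreducible_classes_subset by (auto simp: orders_def)
qed

section \<open>Tilts and cutoffs adapted to a given empirical measure\<close>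

lemma truncated_sum_exceeds:
  fixes t :: "'i \<Rightarrow> real" and u :: "'i \<Rightarrow> ereal"
  assumes "finite S" and t: "\<And>i. i \<in> S \<Longrightarrow> 0 \<le> t i" and u: "\<And>i. i \<in> S \<Longrightarrow> u i \<le> 0"
    and r: "ereal r < (\<Sum>i\<in>S. ereal (t i) * - u i)"
  shows "\<forall>\<^sub>F A in at_top. r < (\<Sum>i\<in>S. t i * truncated_cost A (u i))"
proof -
  have "\<exists>q. (\<forall>i\<in>S. ereal (q i) < ereal (t i) * - u i) \<and> r < (\<Sum>i\<in>S. q i)"
  proof (rule ereal_less_sum_split[OF \<open>finite S\<close> _ r])
    fix i assume "i \<in> S"
    then show "0 \<le> ereal (t i) * - u i"
      using t u by (intro ereal_0_le_mult) (auto simp: ereal_0_le_uminus_iff)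
  qed
  then obtain q where q: "\<forall>i\<in>S. ereal (q i) < ereal (t i) * - u i" "r < (\<Sum>i\<in>S. q i)" by blast
  have "\<forall>\<^sub>F A in at_top. \<forall>i\<in>S. q i < t i * truncated_cost A (u i)"
    using q(1) t u \<open>finite S\<close> by (intro eventually_ball_finite ballI less_truncated_cost) auto
  then show ?thesis
  proof eventually_elim
    case (elim A)
    have "(\<Sum>i\<in>S. q i) \<le> (\<Sum>i\<in>S. t i * truncated_cost A (u i))"
      using elim by (intro sum_mono) (auto intro: less_imp_le)
    then show ?case using q(2) by linarith
  qed
qed

text \<open>Distributing \<open>r\<close> over the summands lets each class choose its own tilt. At
  weight 0 every tilt is good enough, since the share \<open>q i\<close> is then negative.\<close>

lemma tilted_sum_exceeds:
  fixes v :: "'i \<Rightarrow> real"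
  assumes "finite S" and v: "\<And>i. i \<in> S \<Longrightarrow> 0 \<le> v i" and \<xi>: "\<And>i. i \<in> S \<Longrightarrow> \<xi> i \<in> irreducible_classes"
    and r: "ereal r < (\<Sum>i\<in>S. ereal (v i) * rate (\<xi> i) (x i))"
  obtains \<theta> where "r < (\<Sum>i\<in>S. v i * (\<theta> i \<bullet> x i - ln (tilted_eigenvalue P f (C (\<xi> i)) (\<theta> i))))"
proof -
  have "\<exists>q. (\<forall>i\<in>S. ereal (q i) < ereal (v i) * rate (\<xi> i) (x i)) \<and> r < (\<Sum>i\<in>S. q i)"
    using v rate_nonneg[OF \<xi>] by (intro ereal_less_sum_split[OF \<open>finite S\<close> _ r]) simp
  then obtain q where q: "\<forall>i\<in>S. ereal (q i) < ereal (v i) * rate (\<xi> i) (x i)" "r < (\<Sum>i\<in>S. q i)" by blast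
  have "\<exists>\<theta>. q i < v i * (\<theta> \<bullet> x i - ln (tilted_eigenvalue P f (C (\<xi> i)) \<theta>))" if i: "i \<in> S" for i
  proof (cases "v i = 0")
    case True
    then show ?thesis using bspec[OF q(1) i] by (simp add: zero_ereal_def[symmetric])
  next
    case False
    then have vi: "v i > 0" using v[OF i] by simp
    have "ereal (q i / v i) < rate (\<xi> i) (x i)"
      using bspec[OF q(1) i] vi by (cases "rate (\<xi> i) (x i)") (auto simp: field_simps)
    then obtain \<theta> where "q i / v i < \<theta> \<bullet> x i - ln (tilted_eigenvalue P f (C (\<xi> i)) \<theta>)"
      unfolding class_rate_alt[OF P_stochastic irreducible_classD(2,3)[OF \<xi>[OF i]]] less_SUP_iff by auto
    then show ?thesis using vi by (auto simp: field_simps)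
  qed
  then have "\<exists>\<theta>. \<forall>i\<in>S. q i < v i * (\<theta> i \<bullet> x i - ln (tilted_eigenvalue P f (C (\<xi> i)) (\<theta> i)))"
    by (intro bchoice) blast
  then obtain \<theta> where \<theta>: "\<forall>i\<in>S. q i < v i * (\<theta> i \<bullet> x i - ln (tilted_eigenvalue P f (C (\<xi> i)) (\<theta> i)))" by blast
  have "(\<Sum>i\<in>S. q i) \<le> (\<Sum>i\<in>S. v i * (\<theta> i \<bullet> x i - ln (tilted_eigenvalue P f (C (\<xi> i)) (\<theta> i))))"
    using \<theta> by (intro sum_mono) (auto intro: less_imp_le)
  then show thesis using q(2) by (intro that[of \<theta>]) linarith
qed

text \<open>At \<open>\<theta> = 0\<close> all exponents are nonnegative, so it suffices to take
  \<open>A\<close> so large that the mass at the degenerate state \<open>y0\<close> alone pays more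
  than \<open>a\<close>.\<close>

lemma ordered_cost_exceeds_degenerate:
  fixes m :: "real ^ 's"
  assumes m: "\<And>y. 0 \<le> m $ y" and y0: "class_of y0 \<notin> irreducible_classes" "m $ y0 \<noteq> 0"
  obtains A where "0 \<le> A" "\<And>\<sigma>. \<sigma> \<in> orders \<Longrightarrow>
    a < ordered_cost class_of (exponent (\<lambda>_. 0) A) (cost_rate A (1/2)) \<sigma> m"
proof -
  have w: "m $ y0 > 0" using m[of y0] y0(2) by simp
  define A where "A = (\<bar>a\<bar> + 1) / m $ y0"
  have A: "0 \<le> A" using w by (simp add: A_def)
  have exp0: "0 \<le> exponent (\<lambda>_. 0) A y" for y
  proof (cases "class_of y \<in> irreducible_classes")
    case True
    obtain R where R: "\<And>y. norm (f y) \<le> R" using finite_imp_bounded[of "range f"] by (auto simp: bounded_iff)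
    have "ln (tilted_eigenvalue P f (C (class_of y)) 0) \<le> 0"
      using ln_tilted_eigenvalue_le[OF P_stochastic irreducible_classD(2,3)[OF True], where \<theta> = 0 and f = f and R = R] R by simp
    then show ?thesis using True by (simp add: exponent_def)
  qed (simp add: exponent_def A)
  have "a < m $ y0 * A" using w by (simp add: A_def)
  also have "\<dots> = m $ y0 * exponent (\<lambda>_. 0) A y0" using y0 by (simp add: exponent_def)
  also have "\<dots> \<le> (\<Sum>y\<in>UNIV. m $ y * exponent (\<lambda>_. 0) A y)"
    by (rule member_le_sum) (auto intro!: mult_nonneg_nonneg m exp0)
  finally have *: "a < (\<Sum>y\<in>UNIV. m $ y * exponent (\<lambda>_. 0) A y)" .
  have "a < ordered_cost class_of (exponent (\<lambda>_. 0) A) (cost_rate A (1/2)) \<sigma> m" if \<sigma>: "\<sigma> \<in> orders" for \<sigma>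
  proof -
    have "0 \<le> order_cost (occupation class_of m) (cost_rate A (1/2)) 0 \<sigma>"
      using A \<sigma> by (intro order_cost_nonneg) (auto simp: occupation_def intro!: sum_nonneg m)
    then show ?thesis using * by (simp add: ordered_cost_def)
  qed
  with A show thesis by (rule that)
qed

text \<open>The cost is split at the cheapest order: \<open>t\<close> is the least switching cost
  and \<open>E\<close> collects the class rates, which do not involve the order. A real number
  \<open>r < t\<close> is then below the switching cost of every order, and the tilts depend on
  \<open>E\<close> alone.\<close>

lemma ordered_cost_exceeds:
  fixes m :: "real ^ 's"
  assumes m: "\<And>y. 0 \<le> m $ y" "(\<Sum>y\<in>UNIV. m $ y) = 1"
    and J: "ereal a < J (\<Sum>y\<in>UNIV. m $ y *\<^sub>R f y)"
  obtains \<theta> A c where "0 \<le> A" "0 < c" "c < 1"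
    "\<And>\<sigma>. \<sigma> \<in> orders \<Longrightarrow> a < ordered_cost class_of (exponent \<theta> A) (cost_rate A c) \<sigma> m"
proof (cases "\<exists>y. class_of y \<notin> irreducible_classes \<and> m $ y \<noteq> 0")
  case True
  then obtain y0 where "class_of y0 \<notin> irreducible_classes" "m $ y0 \<noteq> 0" by blast
  from ordered_cost_exceeds_degenerate[OF m(1) this] obtain A where "0 \<le> A" "\<And>\<sigma>. \<sigma> \<in> orders \<Longrightarrow>
    a < ordered_cost class_of (exponent (\<lambda>_. 0) A) (cost_rate A (1/2)) \<sigma> m" by metis
  then show thesis using that[of A "1/2" "\<lambda>_. 0"] by simp
next
  case False
  then have null: "m $ y = 0" if "class_of y \<notin> irreducible_classes" for y using that by blast
  define v where "v = occupation class_of m"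
  \<comment> \<open>The mean of \<open>f\<close> over class \<open>i\<close>. For
    \<open>v i = 0\<close> division by zero gives \<open>x i = 0\<close>, and \<open>vx\<close>
    still holds because nonnegative masses with sum zero vanish.\<close>
  define x where "x i = (1 / v i) *\<^sub>R (\<Sum>y | class_of y = i. m $ y *\<^sub>R f y)" for i
  have v0: "0 \<le> v i" for i unfolding v_def occupation_def by (intro sum_nonneg m(1))
  have vx: "v i *\<^sub>R x i = (\<Sum>y | class_of y = i. m $ y *\<^sub>R f y)" for i
  proof (cases "v i = 0")
    case True
    then have "\<forall>y\<in>{y. class_of y = i}. m $ y = 0"
      using sum_nonneg_eq_0_iff[of "{y. class_of y = i}" "\<lambda>y. m $ y"] m(1) by (simp add: v_def occupation_def)
    then have "(\<Sum>y | class_of y = i. m $ y *\<^sub>R f y) = 0" by (intro sum.neutral) auto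
    then show ?thesis using True by simp
  qed (simp add: x_def)
  define T where "T \<sigma> = (\<Sum>i<length \<sigma> - 1. ereal (\<Sum>j\<le>i. v (\<sigma> ! j)) * - upper_rate (\<sigma> ! i) (\<sigma> ! Suc i))" for \<sigma>
  define E where "E = (\<Sum>i\<in>irreducible_classes. ereal (v i) * rate i (x i))"
  have E0: "0 \<le> ereal (v i) * rate i (x i)" if "i \<in> irreducible_classes" for i
    using v0 rate_nonneg[OF that] by simp
  have U: "upper_rate (\<sigma> ! i) (\<sigma> ! Suc i) \<le> 0" if "\<sigma> \<in> orders" "i < length \<sigma> - 1" for i \<sigma>
  proof -
    have \<sigma>: "distinct \<sigma>" "set \<sigma> = irreducible_classes" using that(1) by (simp_all add: orders_def)
    have "\<sigma> ! i \<in> classes" "\<sigma> ! Suc i \<in> classes"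
      using nth_mem[of i \<sigma>] nth_mem[of "Suc i" \<sigma>] that(2) \<sigma>(2) irreducible_classes_subset by auto
    then show ?thesis using that(2) \<sigma>(1) by (intro upper_rate_nonpos) (simp_all add: nth_eq_iff_index_eq)
  qed
  have V0: "0 \<le> (\<Sum>j\<le>i. v (\<sigma> ! j))" for i \<sigma> by (intro sum_nonneg v0)
  have T0: "0 \<le> ereal (\<Sum>j\<le>i. v (\<sigma> ! j)) * - upper_rate (\<sigma> ! i) (\<sigma> ! Suc i)" if "\<sigma> \<in> orders" "i < length \<sigma> - 1" for i \<sigma>
    using U[OF that] V0[of \<sigma> i] by (intro ereal_0_le_mult) (auto simp: ereal_0_le_uminus_iff)
  define t where "t = Min (T ` orders)"
  have t: "t \<le> T \<sigma>" if "\<sigma> \<in> orders" for \<sigma> using that finite_orders by (simp add: t_def)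
  have "t \<in> T ` orders" unfolding t_def using finite_orders orders_nonempty by (intro Min_in) auto
  then obtain \<sigma>0 where \<sigma>0: "\<sigma>0 \<in> orders" "t = T \<sigma>0" by blast
  have "ereal a < t + E"
    using J J_le_order_cost[OF m null vx[unfolded v_def] \<sigma>0(1)] unfolding \<sigma>0 T_def E_def v_def by (rule less_le_trans)
  moreover have "0 \<le> t" unfolding \<sigma>0 T_def using T0[OF \<sigma>0(1)] by (intro sum_nonneg) auto
  moreover have "0 \<le> E" unfolding E_def using E0 by (intro sum_nonneg) auto
  ultimately obtain r s where rs: "ereal r < t" "ereal s < E" "a < r + s" by (rule ereal_less_add_split)
  obtain \<theta> where \<theta>: "s < (\<Sum>i\<in>irreducible_classes. v i * (\<theta> i \<bullet> x i - ln (tilted_eigenvalue P f (C i) (\<theta> i))))"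
    by (rule tilted_sum_exceeds[OF finite_irreducible_classes v0 _ rs(2)[unfolded E_def]], assumption, rule that)
  have exponent_sum: "s < (\<Sum>y\<in>UNIV. m $ y * exponent \<theta> A y)" for A
  proof -
    have "(\<Sum>y\<in>UNIV. m $ y * exponent \<theta> A y) = (\<Sum>i\<in>irreducible_classes. \<Sum>y | class_of y = i. m $ y * exponent \<theta> A y)"
      using null by (intro sum_irreducible_classes) auto
    also have "\<dots> = (\<Sum>i\<in>irreducible_classes. v i * (\<theta> i \<bullet> x i - ln (tilted_eigenvalue P f (C i) (\<theta> i))))"
    proof (intro sum.cong refl)
      fix i assume i: "i \<in> irreducible_classes"
      let ?l = "ln (tilted_eigenvalue P f (C i) (\<theta> i))"
      have "(\<Sum>y | class_of y = i. m $ y * exponent \<theta> A y) = (\<Sum>y | class_of y = i. \<theta> i \<bullet> (m $ y *\<^sub>R f y) - m $ y * ?l)"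
        using i by (intro sum.cong) (auto simp: exponent_def algebra_simps)
      also have "\<dots> = \<theta> i \<bullet> (v i *\<^sub>R x i) - v i * ?l"
        unfolding vx unfolding v_def occupation_def
        by (simp only: sum_subtractf inner_sum_right[symmetric] sum_distrib_right[symmetric])
      finally show "(\<Sum>y | class_of y = i. m $ y * exponent \<theta> A y) = v i * (\<theta> i \<bullet> x i - ?l)"
        by (simp add: algebra_simps)
    qed
    finally show ?thesis using \<theta> by simp
  qed
  let ?W = "\<lambda>A i j. truncated_cost A (upper_rate i j)"
  have "\<forall>\<^sub>F A in at_top. r < order_cost v (?W A) 0 \<sigma>" if \<sigma>: "\<sigma> \<in> orders" for \<sigma>
  proof -
    have "ereal r < T \<sigma>" using rs(1) t[OF \<sigma>] by (rule less_le_trans)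
    then show ?thesis
      unfolding T_def order_cost_eq_sum add_0 using V0 U[OF \<sigma>] by (intro truncated_sum_exceeds) auto
  qed
  then have "\<forall>\<^sub>F A in at_top. \<forall>\<sigma>\<in>orders. r < order_cost v (?W A) 0 \<sigma>"
    using finite_orders by (intro eventually_ball_finite) auto
  \<comment> \<open>The cutoff is fixed first; as the inequalities are strict and finite in number,
    a factor \<open>c\<close> slightly below 1 preserves them.\<close>
  then obtain A where A: "0 \<le> A" "\<And>\<sigma>. \<sigma> \<in> orders \<Longrightarrow> r < order_cost v (?W A) 0 \<sigma>"
    using eventually_happens[OF eventually_conj[OF eventually_ge_at_top[of 0]]] by fastforce
  have "\<forall>\<^sub>F c in at_left 1. r < c * order_cost v (?W A) 0 \<sigma>" if "\<sigma> \<in> orders" for \<sigma>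
  proof -
    have "((\<lambda>c. c * order_cost v (?W A) 0 \<sigma>) \<longlongrightarrow> 1 * order_cost v (?W A) 0 \<sigma>) (at_left 1)"
      by (intro tendsto_intros)
    then show ?thesis using A(2)[OF that] by (intro order_tendstoD) auto
  qed
  then have "\<forall>\<^sub>F c in at_left 1. \<forall>\<sigma>\<in>orders. r < c * order_cost v (?W A) 0 \<sigma>"
    using finite_orders by (intro eventually_ball_finite) auto
  moreover have "\<forall>\<^sub>F c in at_left (1::real). c \<in> {0<..<1}" by (intro eventually_at_left_real) simp
  ultimately have "\<forall>\<^sub>F c in at_left 1. (\<forall>\<sigma>\<in>orders. r < c * order_cost v (?W A) 0 \<sigma>) \<and> c \<in> {0<..<1}"
    by (rule eventually_conj)
  then obtain c where c: "\<And>\<sigma>. \<sigma> \<in> orders \<Longrightarrow> r < c * order_cost v (?W A) 0 \<sigma>" "0 < c" "c < 1"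
    using eventually_happens[of _ "at_left (1::real)"] by fastforce
  have "a < ordered_cost class_of (exponent \<theta> A) (cost_rate A c) \<sigma> m" if \<sigma>: "\<sigma> \<in> orders" for \<sigma>
  proof -
    have "order_cost v (cost_rate A c) 0 \<sigma> = c * order_cost v (?W A) 0 \<sigma>"
      unfolding cost_rate_def[abs_def] by (rule order_cost_scale_weight)
    then show ?thesis
      using c(1)[OF \<sigma>] exponent_sum[of A] rs(3) by (simp add: ordered_cost_def v_def[symmetric])
  qed
  with A(1) c(2,3) show thesis by (rule that)
qed

end

section \<open>Goodness of the rate function\<close>

text \<open>Tychonoff's theorem: the function space carries the product topology.\<close>

lemma compact_coordinatewise:
  fixes S :: "'i \<Rightarrow> 'b::topological_space set"
  assumes "\<And>i. compact (S i)"
  shows "compact {v. \<forall>i. v i \<in> S i}"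
proof -
  have "{v. \<forall>i. v i \<in> S i} = PiE UNIV S" by (auto simp: PiE_def Pi_def)
  then show ?thesis
    using compactin_PiE[of "\<lambda>_. euclidean" UNIV S] assms by (simp add: euclidean_product_topology)
qed

text \<open>The sets for \<open>b > a\<close> are nested, nonempty and closed in a compact set, so
  one point lies in all of them.\<close>

lemma compact_level_attained:
  fixes F :: "'a::t2_space \<Rightarrow> ereal"
  assumes K: "compact K" and closed: "\<And>b::real. closed {p \<in> K. F p \<le> ereal b}"
    and ex: "\<And>b::real. a < b \<Longrightarrow> \<exists>p\<in>K. F p \<le> ereal b"
  shows "\<exists>p\<in>K. F p \<le> ereal a"
proof -
  have "K \<inter> (\<Inter>b\<in>{a<..}. {p \<in> K. F p \<le> ereal b}) \<noteq> {}"
  proof (rule compact_imp_fip_image[OF K closed])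
    fix B assume B: "finite B" "B \<subseteq> {a<..}"
    have "a < Min (insert (a + 1) B)" using B by (subst Min_gr_iff) auto
    then obtain p where p: "p \<in> K" "F p \<le> ereal (Min (insert (a + 1) B))" using ex by blast
    have "F p \<le> ereal b" if "b \<in> B" for b
    proof -
      have "Min (insert (a + 1) B) \<le> b" using B that by (intro Min_le) auto
      then show ?thesis using p(2) by (meson ereal_less_eq(3) order_trans)
    qed
    then show "K \<inter> (\<Inter>b\<in>B. {p \<in> K. F p \<le> ereal b}) \<noteq> {}" using p(1) by blast
  qed
  then obtain p where p: "p \<in> K" "\<And>b. a < b \<Longrightarrow> F p \<le> ereal b" by auto
  have "F p \<le> ereal a"
  proof (rule ccontr)
    assume "\<not> F p \<le> ereal a"
    then obtain b where "a < b" "ereal b < F p" using ereal_dense2[of "ereal a" "F p"] by (auto simp: not_le)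
    then show False using p(2)[of b] by simp
  qed
  then show ?thesis using p(1) by blast
qed

text \<open>Compact level sets are closed in a Hausdorff space, and closed level sets give lower
  semicontinuity.\<close>

lemma good_rate_functionI:
  fixes I :: "'a::t2_space \<Rightarrow> ereal"
  assumes nonneg: "\<And>x. 0 \<le> I x" and compact: "\<And>a::real. compact {x. I x \<le> ereal a}"
  shows "good_rate_function I"
proof -
  have "I x \<le> Liminf (at x) I" for x
    unfolding le_Liminf_iff
  proof (intro allI impI)
    fix y assume "y < I x"
    then obtain b where b: "y < ereal b" "ereal b < I x" using ereal_dense2 by blast
    have "open (- {x. I x \<le> ereal b})" using compact_imp_closed[OF compact] by auto
    moreover have "x \<in> - {x. I x \<le> ereal b}" using b by auto
    ultimately have "\<forall>\<^sub>F z in at x. z \<in> - {x. I x \<le> ereal b}" by (rule eventually_at_in_open')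
    then show "\<forall>\<^sub>F z in at x. y < I z" using b(1) by (auto elim!: eventually_mono intro: less_trans)
  qed
  then show ?thesis using nonneg compact by (simp add: good_rate_function_def lower_semicontinuous_def)
qed

context markov_classes
begin

definition mean_point :: "(nat \<Rightarrow> real) \<times> (nat \<Rightarrow> real ^ 'd) \<Rightarrow> real ^ 'd" where
  "mean_point p = (\<Sum>i=1..M. fst p i *\<^sub>R snd p i)"

text \<open>Coordinates outside \<open>{1..M}\<close> are frozen at 0 because the set would not be
  compact if they were free. The radius \<open>R\<close> will bound \<open>f\<close>, beyond which
  all class rates are infinite.\<close>

definition bounded_points :: "real \<Rightarrow> ((nat \<Rightarrow> real) \<times> (nat \<Rightarrow> real ^ 'd)) set" where
  "bounded_points R = ({v. \<forall>i. v i \<in> (if i \<in> {1..M} then {0..1} else {0})} \<inter> prob_weights M) \<times>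
     {x. \<forall>i. x i \<in> (if i \<in> {1..M} then cball 0 R else {0})}"

definition point_cost :: "(nat \<Rightarrow> nat) \<Rightarrow> (nat \<Rightarrow> real) \<times> (nat \<Rightarrow> real ^ 'd) \<Rightarrow> ereal" where
  "point_cost \<sigma> p = path_cost M \<zeta> rate upper_rate (fst p) \<sigma> (snd p)"

lemma continuous_on_weight: "continuous_on S (\<lambda>p :: (nat \<Rightarrow> real) \<times> (nat \<Rightarrow> real ^ 'd). fst p i)"
  and continuous_on_point: "continuous_on S (\<lambda>p :: (nat \<Rightarrow> real) \<times> (nat \<Rightarrow> real ^ 'd). snd p i)"
  by (rule continuous_on_product_then_coordinatewise[OF continuous_on_fst[OF continuous_on_id]],
      rule continuous_on_product_then_coordinatewise[OF continuous_on_snd[OF continuous_on_id]])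

lemma closed_prob_weights: "closed (prob_weights M)"
proof -
  have c: "continuous_on UNIV (\<lambda>v :: nat \<Rightarrow> real. v i)" for i by (rule continuous_on_product_coordinates)
  have "prob_weights M = (\<Inter>i\<in>{1..M}. {v. 0 \<le> v i}) \<inter> {v. (\<Sum>i=1..M. v i) = 1}"
    by (auto simp: prob_weights_def)
  moreover have "closed {v :: nat \<Rightarrow> real. 0 \<le> v i}" for i
    by (rule closed_Collect_le[OF continuous_on_const c])
  moreover have "closed {v :: nat \<Rightarrow> real. (\<Sum>i=1..M. v i) = 1}"
    by (rule closed_Collect_eq[OF continuous_on_sum[OF c] continuous_on_const])
  ultimately show ?thesis by (simp add: closed_INT closed_Int)
qed

lemma compact_bounded_points: "compact (bounded_points R)"
  unfolding bounded_points_def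
  by (intro compact_Times compact_Int_closed closed_prob_weights compact_coordinatewise) auto

lemma continuous_on_mean_point: "continuous_on S mean_point"
  unfolding mean_point_def[abs_def]
  by (intro continuous_intros continuous_on_weight continuous_on_point)

lemma \<zeta>_permuted:
  assumes "\<sigma> permutes {1..M}" "i \<in> {1..M}"
  shows "\<zeta> (\<sigma> i) \<in> irreducible_classes"
  using bij_betwE[OF \<zeta>_bij] permutes_in_image[OF assms(1), of i] assms(2) by auto

lemma point_cost_eq:
  assumes v: "fst p \<in> prob_weights M" and \<sigma>: "\<sigma> permutes {1..M}"
  shows "point_cost \<sigma> p =
    (\<Sum>i=1..M - 1. ereal (\<Sum>j=1..i. fst p j) * - upper_rate (\<zeta> (\<sigma> i)) (\<zeta> (\<sigma> (i + 1))))
      + (\<Sum>i=1..M. ereal (fst p i) * rate (\<zeta> (\<sigma> i)) (snd p i))"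
    and permuted_rate_nonpos: "\<And>i. i \<in> {1..M - 1} \<Longrightarrow> upper_rate (\<zeta> (\<sigma> i)) (\<zeta> (\<sigma> (i + 1))) \<le> 0"
    and partial_weight_nonneg: "\<And>i. i \<in> {1..M - 1} \<Longrightarrow> 0 \<le> (\<Sum>j=1..i. fst p j)"
proof -
  show U: "upper_rate (\<zeta> (\<sigma> i)) (\<zeta> (\<sigma> (i + 1))) \<le> 0" if i: "i \<in> {1..M - 1}" for i
  proof (rule upper_rate_nonpos)
    show "\<zeta> (\<sigma> i) \<in> classes" "\<zeta> (\<sigma> (i + 1)) \<in> classes"
      using \<zeta>_permuted[OF \<sigma>] i irreducible_classes_subset by auto
    have "\<sigma> i \<noteq> \<sigma> (i + 1)" using injD[OF permutes_inj[OF \<sigma>], of i "i + 1"] by auto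
    moreover have "\<sigma> i \<in> {1..M}" "\<sigma> (i + 1) \<in> {1..M}" using i permutes_in_image[OF \<sigma>, of i] permutes_in_image[OF \<sigma>, of "i + 1"] by auto
    ultimately show "\<zeta> (\<sigma> i) \<noteq> \<zeta> (\<sigma> (i + 1))"
      using inj_onD[OF bij_betw_imp_inj_on[OF \<zeta>_bij], of "\<sigma> i" "\<sigma> (i + 1)"] by auto
  qed
  show V: "0 \<le> (\<Sum>j=1..i. fst p j)" if "i \<in> {1..M - 1}" for i
    using that v by (intro sum_nonneg) (auto simp: prob_weights_def)
  have "- (\<Sum>i=1..M - 1. ereal (\<Sum>j=1..i. fst p j) * upper_rate (\<zeta> (\<sigma> i)) (\<zeta> (\<sigma> (i + 1)))) =
      (\<Sum>i=1..M - 1. - (ereal (\<Sum>j=1..i. fst p j) * upper_rate (\<zeta> (\<sigma> i)) (\<zeta> (\<sigma> (i + 1)))))"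
    using U V by (intro ereal_minus_sum_nonpos) (auto simp: ereal_mult_le_0_iff)
  then show "point_cost \<sigma> p =
    (\<Sum>i=1..M - 1. ereal (\<Sum>j=1..i. fst p j) * - upper_rate (\<zeta> (\<sigma> i)) (\<zeta> (\<sigma> (i + 1))))
      + (\<Sum>i=1..M. ereal (fst p i) * rate (\<zeta> (\<sigma> i)) (snd p i))"
    unfolding point_cost_def path_cost_eq[OF v \<sigma>] by (simp only: ereal_mult_minus_right)
qed

lemma switch_part_nonneg:
  fixes p :: "(nat \<Rightarrow> real) \<times> (nat \<Rightarrow> real ^ 'd)"
  assumes v: "fst p \<in> prob_weights M" and \<sigma>: "\<sigma> permutes {1..M}"
  shows "0 \<le> (\<Sum>i=1..M - 1. ereal (\<Sum>j=1..i. fst p j) * - upper_rate (\<zeta> (\<sigma> i)) (\<zeta> (\<sigma> (i + 1))))"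
  using partial_weight_nonneg[OF v \<sigma>] permuted_rate_nonpos[OF v \<sigma>]
  by (intro sum_nonneg ereal_0_le_mult) (auto simp: ereal_0_le_uminus_iff)

lemma weighted_rate_nonneg:
  assumes v: "fst p \<in> prob_weights M" and \<sigma>: "\<sigma> permutes {1..M}" and i: "i \<in> {1..M}"
  shows "0 \<le> ereal (fst p i) * rate (\<zeta> (\<sigma> i)) (snd p i)"
  using v i rate_nonneg[OF \<zeta>_permuted[OF \<sigma> i]] by (intro ereal_0_le_mult) (auto simp: prob_weights_def)

lemma point_cost_nonneg:
  assumes v: "fst p \<in> prob_weights M" and \<sigma>: "\<sigma> permutes {1..M}"
  shows "0 \<le> point_cost \<sigma> p"
  unfolding point_cost_eq[OF v \<sigma>]
  by (intro add_nonneg_nonneg switch_part_nonneg sum_nonneg weighted_rate_nonneg v \<sigma>) auto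

text \<open>The delicate points are those where a weight tends to 0 while its cost is infinite. The
  approximations \<open>g A \<theta>\<close> are jointly continuous in weights and points, and at
  weight 0 their terms vanish in accordance with \<open>0 * \<infinity> = 0\<close>, so their
  supremum is the cost there too.\<close>

lemma closed_point_cost_le:
  assumes \<sigma>: "\<sigma> permutes {1..M}"
  shows "closed {p \<in> bounded_points R. point_cost \<sigma> p \<le> ereal a}"
proof -
  define g where "g A \<theta> p = (\<Sum>i=1..M - 1. (\<Sum>j=1..i. fst p j) * truncated_cost A (upper_rate (\<zeta> (\<sigma> i)) (\<zeta> (\<sigma> (i + 1)))))
    + (\<Sum>i=1..M. fst p i * (\<theta> i \<bullet> snd p i - ln (tilted_eigenvalue P f (C (\<zeta> (\<sigma> i))) (\<theta> i))))"
    for A and \<theta> :: "nat \<Rightarrow> real ^ 'd" and p :: "(nat \<Rightarrow> real) \<times> (nat \<Rightarrow> real ^ 'd)"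
  have le: "ereal (g A \<theta> p) \<le> point_cost \<sigma> p" if v: "fst p \<in> prob_weights M" and A: "0 \<le> A" for A \<theta> p
    unfolding point_cost_eq[OF v \<sigma>] g_def plus_ereal.simps(1)[symmetric] sum_ereal[symmetric] times_ereal.simps(1)[symmetric]
  proof (intro add_mono sum_mono ereal_mult_left_mono)
    fix i assume i: "i \<in> {1..M - 1}"
    show "ereal (truncated_cost A (upper_rate (\<zeta> (\<sigma> i)) (\<zeta> (\<sigma> (i + 1))))) \<le> - upper_rate (\<zeta> (\<sigma> i)) (\<zeta> (\<sigma> (i + 1)))"
      using ereal_truncated_cost[OF A permuted_rate_nonpos[OF v \<sigma> i]] by simp
    show "0 \<le> (\<Sum>j=1..i. ereal (fst p j))" using partial_weight_nonneg[OF v \<sigma> i] by simp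
  next
    fix i assume i: "i \<in> {1..M}"
    show "ereal (\<theta> i \<bullet> snd p i - ln (tilted_eigenvalue P f (C (\<zeta> (\<sigma> i))) (\<theta> i))) \<le> rate (\<zeta> (\<sigma> i)) (snd p i)"
      unfolding class_rate_alt[OF P_stochastic irreducible_classD(2,3)[OF \<zeta>_permuted[OF \<sigma> i]]]
      by (rule SUP_upper) simp
    show "0 \<le> ereal (fst p i)" using v i by (simp add: prob_weights_def)
  qed
  have ex: "\<exists>A\<ge>0. \<exists>\<theta>. a < g A \<theta> p" if v: "fst p \<in> prob_weights M" and a: "ereal a < point_cost \<sigma> p" for p
  proof -
    obtain r s where rs: "ereal r < (\<Sum>i=1..M - 1. ereal (\<Sum>j=1..i. fst p j) * - upper_rate (\<zeta> (\<sigma> i)) (\<zeta> (\<sigma> (i + 1))))"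
      "ereal s < (\<Sum>i=1..M. ereal (fst p i) * rate (\<zeta> (\<sigma> i)) (snd p i))" "a < r + s"
      using a unfolding point_cost_eq[OF v \<sigma>]
      by (rule ereal_less_add_split) (intro switch_part_nonneg sum_nonneg weighted_rate_nonneg v \<sigma>; assumption)+
    obtain \<theta> where \<theta>: "s < (\<Sum>i=1..M. fst p i * (\<theta> i \<bullet> snd p i - ln (tilted_eigenvalue P f (C (\<zeta> (\<sigma> i))) (\<theta> i))))"
    proof (rule tilted_sum_exceeds[OF finite_atLeastAtMost _ _ rs(2)])
      show "0 \<le> fst p i" if "i \<in> {1..M}" for i using v that by (simp add: prob_weights_def)
    qed (use \<zeta>_permuted[OF \<sigma>] in auto)
    have "\<forall>\<^sub>F A in at_top. r < (\<Sum>i=1..M - 1. (\<Sum>j=1..i. fst p j) * truncated_cost A (upper_rate (\<zeta> (\<sigma> i)) (\<zeta> (\<sigma> (i + 1)))))"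
      by (intro truncated_sum_exceeds finite_atLeastAtMost partial_weight_nonneg[OF v \<sigma>] permuted_rate_nonpos[OF v \<sigma>] rs(1))
    then obtain A where "0 \<le> A" "r < (\<Sum>i=1..M - 1. (\<Sum>j=1..i. fst p j) * truncated_cost A (upper_rate (\<zeta> (\<sigma> i)) (\<zeta> (\<sigma> (i + 1)))))"
      using eventually_happens[OF eventually_conj[OF eventually_ge_at_top[of "0::real"]]] by fastforce
    then show ?thesis using \<theta> rs(3) unfolding g_def by (intro exI[of _ A] conjI exI[of _ \<theta>]) auto
  qed
  have "{p \<in> bounded_points R. point_cost \<sigma> p \<le> ereal a} = bounded_points R \<inter> (\<Inter>A\<in>{0..}. \<Inter>\<theta>. {p. g A \<theta> p \<le> a})"
  proof (intro equalityI subsetI)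
    fix p assume p: "p \<in> {p \<in> bounded_points R. point_cost \<sigma> p \<le> ereal a}"
    then have "fst p \<in> prob_weights M" by (auto simp: bounded_points_def)
    then have "g A \<theta> p \<le> a" if "0 \<le> A" for A \<theta> using le[of p A \<theta>] that p by (auto dest: order_trans)
    then show "p \<in> bounded_points R \<inter> (\<Inter>A\<in>{0..}. \<Inter>\<theta>. {p. g A \<theta> p \<le> a})" using p by auto
  next
    fix p assume p: "p \<in> bounded_points R \<inter> (\<Inter>A\<in>{0..}. \<Inter>\<theta>. {p. g A \<theta> p \<le> a})"
    then have "fst p \<in> prob_weights M" by (auto simp: bounded_points_def)
    then have "\<not> ereal a < point_cost \<sigma> p" using ex[of p] p by (auto simp: not_less[symmetric])
    then show "p \<in> {p \<in> bounded_points R. point_cost \<sigma> p \<le> ereal a}" using p by auto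
  qed
  moreover have "continuous_on UNIV (g A \<theta>)" for A \<theta>
    unfolding g_def[abs_def] by (intro continuous_intros continuous_on_weight continuous_on_point)
  then have "closed {p. g A \<theta> p \<le> a}" for A \<theta> by (intro closed_Collect_le continuous_on_const)
  ultimately show ?thesis
    using compact_imp_closed[OF compact_bounded_points] by (auto intro!: closed_Int closed_INT)
qed

text \<open>
  Where \<open>v i = 0\<close> the value \<open>x i\<close> is irrelevant, since \<open>0 * \<infinity> = 0\<close>, and may be replaced by 0.
\<close>

lemma bounded_representative:
  assumes R: "\<And>y. norm (f y) \<le> R" and \<sigma>: "\<sigma> permutes {1..M}"
    and v: "v \<in> prob_weights M" and x: "x \<in> averaging_to M v z"
    and fin: "path_cost M \<zeta> rate upper_rate v \<sigma> x < \<infinity>"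
  obtains p where "p \<in> bounded_points R" "mean_point p = z" "point_cost \<sigma> p = path_cost M \<zeta> rate upper_rate v \<sigma> x"
proof -
  define v' where "v' i = (if i \<in> {1..M} then v i else 0)" for i
  define x' where "x' i = (if i \<in> {1..M} \<and> v i \<noteq> 0 then x i else 0)" for i
  have R0: "0 \<le> R" using R norm_ge_zero order_trans by blast
  have w: "v' \<in> prob_weights M" using v by (simp add: prob_weights_def v'_def)
  have "v i \<le> 1" if "i \<in> {1..M}" for i
    using member_le_sum[of i "{1..M}" v] that v by (simp add: prob_weights_def)
  then have v01: "v' i \<in> (if i \<in> {1..M} then {0..1} else {0})" for i
    using v by (simp add: v'_def prob_weights_def)
  have cost: "point_cost \<sigma> (v, x) = path_cost M \<zeta> rate upper_rate v \<sigma> x" by (simp add: point_cost_def)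
  have vx: "fst (v, x) \<in> prob_weights M" using v by simp
  \<comment> \<open>A finite total cost allows an infinite rate only at weight 0; at the other
    indices \<open>x i\<close> must lie in the ball.\<close>
  have finite_rate: "rate (\<zeta> (\<sigma> i)) (x i) \<noteq> \<infinity>" if i: "i \<in> {1..M}" and vi: "v i \<noteq> 0" for i
  proof
    assume "rate (\<zeta> (\<sigma> i)) (x i) = \<infinity>"
    then have "ereal (v i) * rate (\<zeta> (\<sigma> i)) (x i) = \<infinity>" using v i vi by (auto simp: prob_weights_def less_le)
    moreover have "ereal (v i) * rate (\<zeta> (\<sigma> i)) (x i) \<le> (\<Sum>i=1..M. ereal (v i) * rate (\<zeta> (\<sigma> i)) (x i))"
      using sum_mono2[of "{1..M}" "{i}" "\<lambda>i. ereal (v i) * rate (\<zeta> (\<sigma> i)) (x i)"] weighted_rate_nonneg[OF vx \<sigma>] i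
      by (simp del: ereal_zero_le_0_iff)
    ultimately have "(\<Sum>i=1..M. ereal (v i) * rate (\<zeta> (\<sigma> i)) (x i)) = \<infinity>"
      using ereal_infty_less_eq2(1) by blast
    then have "point_cost \<sigma> (v, x) = \<infinity>"
      unfolding point_cost_eq[OF vx \<sigma>] using switch_part_nonneg[OF vx \<sigma>] by auto
    then show False using fin cost by simp
  qed
  have "norm (x' i) \<le> R" for i
  proof (cases "i \<in> {1..M} \<and> v i \<noteq> 0")
    case True
    then show ?thesis
      using finite_rate[of i] class_rate_eq_infinity[OF P_stochastic irreducible_classD(2,3)[OF \<zeta>_permuted[OF \<sigma>, of i]], where f = f and R = R and x = "x i"] R
      by (auto simp: x'_def not_less[symmetric])
  qed (use R0 in \<open>auto simp: x'_def\<close>)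
  then have "(v', x') \<in> bounded_points R"
    using w v01 by (auto simp: bounded_points_def) (auto simp: x'_def)
  moreover have "mean_point (v', x') = z"
    using x by (auto simp: mean_point_def averaging_to_def v'_def x'_def intro!: sum.cong)
  moreover have "point_cost \<sigma> (v', x') = point_cost \<sigma> (v, x)"
  proof -
    have w': "fst (v', x') \<in> prob_weights M" using w by simp
    have "(\<Sum>j=1..i. v' j) = (\<Sum>j=1..i. v j)" if "i \<in> {1..M - 1}" for i
      using that by (intro sum.cong) (auto simp: v'_def)
    moreover have "ereal (v' i) * rate (\<zeta> (\<sigma> i)) (x' i) = ereal (v i) * rate (\<zeta> (\<sigma> i)) (x i)" if "i \<in> {1..M}" for i
      using that by (auto simp: v'_def x'_def zero_ereal_def[symmetric])
    ultimately show ?thesis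
      unfolding point_cost_eq[OF w' \<sigma>] point_cost_eq[OF vx \<sigma>] fst_conv snd_conv
      by (intro arg_cong2[where f = "(+)"] sum.cong) auto
  qed
  ultimately show thesis using that cost by simp
qed

text \<open>The infimum defining \<open>J\<close> is attained when finite, since by
  \<open>bounded_representative\<close> near-minimizers can be taken in a compact set. This exhibits
  the level set as a finite union of continuous images.\<close>

lemma level_set_J:
  assumes R: "\<And>y. norm (f y) \<le> R"
  shows "{z. J z \<le> ereal a} = (\<Union>\<sigma>\<in>{\<sigma>. \<sigma> permutes {1..M}}. mean_point ` {p \<in> bounded_points R. point_cost \<sigma> p \<le> ereal a})"
    (is "?L = ?R")
proof (intro equalityI subsetI)
  fix z assume "z \<in> ?R"
  then obtain \<sigma> p where p: "\<sigma> permutes {1..M}" "p \<in> bounded_points R" "point_cost \<sigma> p \<le> ereal a" "z = mean_point p" by auto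
  have "J z \<le> path_cost M \<zeta> rate upper_rate (fst p) \<sigma> (snd p)"
    using p by (intro J_le_path_cost) (auto simp: bounded_points_def averaging_to_def mean_point_def)
  then show "z \<in> ?L" using p(3) by (auto simp: point_cost_def)
next
  fix z assume z: "z \<in> ?L"
  define K where "K = {p \<in> bounded_points R. mean_point p = z}"
  define F where "F p = (MIN \<sigma>\<in>{\<sigma>. \<sigma> permutes {1..M}}. point_cost \<sigma> p)" for p
  have fin: "finite {\<sigma>. \<sigma> permutes {1..M}}" by (simp add: finite_permutations)
  have ne: "{\<sigma>. \<sigma> permutes {1..M}} \<noteq> {}" using permutes_id by blast
  have F_le: "F p \<le> b \<longleftrightarrow> (\<exists>\<sigma>. \<sigma> permutes {1..M} \<and> point_cost \<sigma> p \<le> b)" for p b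
    unfolding F_def using fin ne by (subst Min_le_iff) auto
  have Kc: "K = bounded_points R \<inter> {p. mean_point p = z}" by (auto simp: K_def)
  have cl: "closed {p. mean_point p = z}"
    by (intro closed_Collect_eq continuous_on_mean_point continuous_on_const)
  have "\<exists>p\<in>K. F p \<le> ereal a"
  proof (rule compact_level_attained)
    show "compact K" unfolding Kc by (intro compact_Int_closed compact_bounded_points cl)
    fix b :: real
    have "{p \<in> K. F p \<le> ereal b} = (\<Union>\<sigma>\<in>{\<sigma>. \<sigma> permutes {1..M}}. {p \<in> bounded_points R. point_cost \<sigma> p \<le> ereal b} \<inter> {p. mean_point p = z})"
      by (auto simp: K_def F_le)
    also have "closed \<dots>" by (intro closed_UN fin ballI closed_Int closed_point_cost_le cl) simp
    finally show "closed {p \<in> K. F p \<le> ereal b}" .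
    assume "a < b"
    then have "J z < ereal b" using z by (auto intro: le_less_trans)
    then obtain v x where vx: "v \<in> prob_weights M" "x \<in> averaging_to M v z"
      "(MIN \<sigma>\<in>{\<sigma>. \<sigma> permutes {1..M}}. path_cost M \<zeta> rate upper_rate v \<sigma> x) < ereal b"
      unfolding rate_J_def INF_less_iff by auto
    then obtain \<sigma> where \<sigma>: "\<sigma> permutes {1..M}" "path_cost M \<zeta> rate upper_rate v \<sigma> x < ereal b"
      using fin ne by (subst (asm) Min_less_iff) auto
    then have "path_cost M \<zeta> rate upper_rate v \<sigma> x < \<infinity>" by (auto intro: less_trans)
    then obtain p where "p \<in> bounded_points R" "mean_point p = z" "point_cost \<sigma> p = path_cost M \<zeta> rate upper_rate v \<sigma> x"
      by (rule bounded_representative[OF R \<sigma>(1) vx(1,2)])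
    then show "\<exists>p\<in>K. F p \<le> ereal b" using \<sigma> by (intro bexI[of _ p]) (auto simp: K_def F_le intro!: exI[of _ \<sigma>] less_imp_le)
  qed
  then show "z \<in> ?R" by (auto simp: K_def F_le)
qed

theorem good_rate_function_J: "good_rate_function J"
proof (rule good_rate_functionI)
  obtain R where R: "\<And>y. norm (f y) \<le> R" using finite_imp_bounded[of "range f"] by (auto simp: bounded_iff)
  have fin: "finite {\<sigma>. \<sigma> permutes {1..M}}" by (simp add: finite_permutations)
  have ne: "{\<sigma>. \<sigma> permutes {1..M}} \<noteq> {}" using permutes_id by blast
  show "0 \<le> J x" for x
    unfolding rate_J_def
  proof (intro INF_greatest)
    fix v y assume v: "v \<in> prob_weights M"
    show "0 \<le> (MIN \<sigma>\<in>{\<sigma>. \<sigma> permutes {1..M}}. path_cost M \<zeta> rate upper_rate v \<sigma> y)"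
      using fin ne point_cost_nonneg[of "(v, y)"] v by (subst Min_ge_iff) (auto simp: point_cost_def)
  qed
  fix a :: real
  have "compact (mean_point ` {p \<in> bounded_points R. point_cost \<sigma> p \<le> ereal a})" if "\<sigma> permutes {1..M}" for \<sigma>
  proof (rule compact_continuous_image[OF continuous_on_mean_point])
    have eq: "bounded_points R \<inter> {p \<in> bounded_points R. point_cost \<sigma> p \<le> ereal a} =
        {p \<in> bounded_points R. point_cost \<sigma> p \<le> ereal a}" by auto
    show "compact {p \<in> bounded_points R. point_cost \<sigma> p \<le> ereal a}"
      using compact_Int_closed[OF compact_bounded_points[of R] closed_point_cost_le[OF that, where R = R and a = a]] unfolding eq .
  qed
  then show "compact {x. J x \<le> ereal a}"
    unfolding level_set_J[OF R] using fin by (intro compact_UN) auto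
qed

end

section \<open>The upper bound\<close>

text \<open>The constant \<open>B\<close> disappears after division by \<open>n\<close>, and
  \<open>ln (1 + \<eta>) \<le> \<eta>\<close>.\<close>

lemma limsup_log_le:
  fixes p :: "nat \<Rightarrow> real"
  assumes p: "\<And>n. 0 \<le> p n" and B: "B > 0" and \<eta>: "\<eta> > 0"
    and le: "\<And>n. n \<ge> 1 \<Longrightarrow> p n \<le> B * (1 + \<eta>) ^ n * exp (- real n * a)"
  shows "limsup (\<lambda>n. ereal (1 / real n) * elog (p n)) \<le> ereal (\<eta> - a)"
proof -
  have "\<forall>\<^sub>F n in sequentially. ereal (1 / real n) * elog (p n) \<le> ereal (ln B / real n + (\<eta> - a))"
    using eventually_ge_at_top[of 1]
  proof eventually_elim
    case (elim n)
    show ?case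
    proof (cases "p n = 0")
      case True
      then show ?thesis using elim by (simp add: elog_def)
    next
      case False
      then have "ln (p n) \<le> ln (B * (1 + \<eta>) ^ n * exp (- real n * a))"
        using p[of n] le[OF elim] by (intro ln_mono) auto
      also have "\<dots> = ln B + real n * ln (1 + \<eta>) - real n * a"
        using B \<eta> by (simp add: ln_mult ln_realpow)
      also have "\<dots> \<le> ln B + real n * \<eta> - real n * a"
        using \<eta> ln_add_one_self_le_self[of \<eta>] by (simp add: mult_left_mono)
      finally have "ln (p n) / real n \<le> (ln B + real n * \<eta> - real n * a) / real n"
        by (rule divide_right_mono) simp
      also have "\<dots> = ln B / real n + (\<eta> - a)" using elim by (simp add: field_simps)
      finally show ?thesis using False by (simp add: elog_def)
    qed
  qed
  then have "limsup (\<lambda>n. ereal (1 / real n) * elog (p n)) \<le> limsup (\<lambda>n. ereal (ln B / real n + (\<eta> - a)))"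
    by (rule Limsup_mono)
  also have "(\<lambda>n. ereal (ln B / real n + (\<eta> - a))) \<longlonglongrightarrow> ereal (0 + (\<eta> - a))"
    by (intro tendsto_ereal tendsto_add lim_const_over_n tendsto_const)
  then have "limsup (\<lambda>n. ereal (ln B / real n + (\<eta> - a))) = ereal (\<eta> - a)"
    by (simp add: lim_imp_Limsup)
  finally show ?thesis .
qed

lemma sum_UN_le:
  fixes g :: "'a \<Rightarrow> real"
  assumes "finite T" "\<And>t. finite (L t)" "\<And>l. 0 \<le> g l"
  shows "(\<Sum>l\<in>(\<Union>t\<in>T. L t). g l) \<le> (\<Sum>t\<in>T. \<Sum>l\<in>L t. g l)"
  using assms(1)
proof (induct T)
  case (insert t T)
  have "(\<Sum>l\<in>L t \<union> (\<Union>t\<in>T. L t). g l) = (\<Sum>l\<in>L t. g l) + (\<Sum>l\<in>(\<Union>t\<in>T. L t). g l) - (\<Sum>l\<in>L t \<inter> (\<Union>t\<in>T. L t). g l)"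
    using insert(1) assms(2) by (intro sum_Un) auto
  moreover have "0 \<le> (\<Sum>l\<in>L t \<inter> (\<Union>t\<in>T. L t). g l)" by (intro sum_nonneg assms(3))
  ultimately show ?case using insert by simp
qed simp

lemma compact_simplex: "compact {m :: real ^ 's::finite. (\<forall>y. 0 \<le> m $ y) \<and> (\<Sum>y\<in>UNIV. m $ y) = 1}"
proof -
  have "norm m \<le> 1" if "\<forall>y. 0 \<le> m $ y" "(\<Sum>y\<in>UNIV. m $ y) = 1" for m :: "real ^ 's"
    using norm_le_l1_cart[of m] that by simp
  then have "bounded {m :: real ^ 's. (\<forall>y. 0 \<le> m $ y) \<and> (\<Sum>y\<in>UNIV. m $ y) = 1}"
    by (intro boundedI[of _ 1]) auto
  moreover have "closed {m :: real ^ 's. (\<forall>y. 0 \<le> m $ y) \<and> (\<Sum>y\<in>UNIV. m $ y) = 1}"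
    by (intro closed_Collect_conj closed_Collect_all closed_Collect_le closed_Collect_eq continuous_intros)
  ultimately show ?thesis by (simp add: compact_eq_bounded_closed)
qed

lemma empirical_in_simplex:
  fixes l :: "'s::finite list"
  assumes "length l = Suc n" "n \<ge> 1"
  shows "0 \<le> empirical n l $ y" "(\<Sum>y\<in>UNIV. empirical n l $ y) = 1"
proof -
  show "0 \<le> empirical n l $ y" by (simp add: empirical_def)
  have "(\<Sum>y\<in>UNIV. count_list (butlast l) y) = n"
    using sum_count_set[of "butlast l" UNIV] assms by simp
  then have "(\<Sum>y\<in>UNIV. real (count_list (butlast l) y)) = real n"
    by (metis of_nat_sum)
  then show "(\<Sum>y\<in>UNIV. empirical n l $ y) = 1"
    using assms by (simp add: empirical_def sum_divide_distrib[symmetric])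
qed

lemma sample_mean_empirical:
  fixes f :: "'s::finite \<Rightarrow> real ^ 'd"
  shows "sample_mean f X n \<omega> = (\<Sum>y\<in>UNIV. empirical n (history X n \<omega>) $ y *\<^sub>R f y)"
  unfolding sample_mean_def sum_history by (simp add: empirical_def scaleR_sum_right)

context markov_classes
begin

lemma probability_bound:
  assumes \<pi>: "prob_vector \<pi>" and chain: "nonhomogeneous_markov_chain Pr X \<pi> Pn"
    and S: "closed S" and a: "ereal a < (INF z\<in>S. J z)" and \<eta>: "\<eta> > 0"
  obtains B where "B > 0" "\<And>n. n \<ge> 1 \<Longrightarrow>
    measure Pr {\<omega> \<in> space Pr. sample_mean f X n \<omega> \<in> S} \<le> B * (1 + \<eta>) ^ n * exp (- real n * a)"
proof -
  let ?mean = "\<lambda>m :: real ^ 's. \<Sum>y\<in>UNIV. m $ y *\<^sub>R f y"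
  define Q where "Q = {m :: real ^ 's. (\<forall>y. 0 \<le> m $ y) \<and> (\<Sum>y\<in>UNIV. m $ y) = 1} \<inter> ?mean -` S"
  define params where "params = {(\<theta> :: nat \<Rightarrow> real ^ 'd, A :: real, c :: real). 0 \<le> A \<and> 0 < c \<and> c < 1}"
  \<comment> \<open>Asking for all orders makes the bound usable for a path whose order is unknown;
    as the orders are finitely many, the set is still open.\<close>
  define U where "U = (\<lambda>(\<theta>, A, c). {m. \<forall>\<sigma>\<in>orders. a < ordered_cost class_of (exponent \<theta> A) (cost_rate A c) \<sigma> m})"
  have "closed (?mean -` S)" by (intro continuous_closed_vimage S continuous_intros)
  then have "compact Q" unfolding Q_def by (intro compact_Int_closed compact_simplex)
  moreover have "open (U t)" if "t \<in> params" for t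
  proof -
    obtain \<theta> A c where t: "t = (\<theta>, A, c)" by (cases t)
    have "U t = (\<Inter>\<sigma>\<in>orders. {m. a < ordered_cost class_of (exponent \<theta> A) (cost_rate A c) \<sigma> m})"
      by (auto simp: U_def t)
    also have "open \<dots>"
      using finite_orders by (intro open_INT ballI open_Collect_less continuous_on_const continuous_on_ordered_cost)
    finally show ?thesis .
  qed
  moreover have "Q \<subseteq> (\<Union>t\<in>params. U t)"
  proof
    fix m assume m: "m \<in> Q"
    have "ereal a < J (?mean m)" using m by (intro less_le_trans[OF a] INF_lower) (auto simp: Q_def)
    then obtain \<theta> A c where "0 \<le> A" "0 < c" "c < 1"
      "\<And>\<sigma>. \<sigma> \<in> orders \<Longrightarrow> a < ordered_cost class_of (exponent \<theta> A) (cost_rate A c) \<sigma> m"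
      by (rule ordered_cost_exceeds[rotated 2]) (use m in \<open>auto simp: Q_def\<close>)
    then show "m \<in> (\<Union>t\<in>params. U t)" by (intro UN_I[of "(\<theta>, A, c)"]) (auto simp: params_def U_def)
  qed
  ultimately obtain T where T: "T \<subseteq> params" "finite T" "Q \<subseteq> (\<Union>t\<in>T. U t)"
    by (rule compactE_image)
  have "\<exists>B>0. \<forall>n\<ge>1. (\<Sum>l | length l = Suc n \<and> empirical n l \<in> U t. path_prob \<pi> Pn l) \<le> B * (1 + \<eta>) ^ n * exp (- real n * a)"
    if "t \<in> T" for t
  proof -
    obtain \<theta> A c where t: "t = (\<theta>, A, c)" by (cases t)
    then have Ac: "0 \<le> A" "0 < c" "c < 1" using that T(1) by (auto simp: params_def)
    obtain h where h: "\<And>x. h x > 0" "\<And>x. (\<Sum>y | class_of y = class_of x. P x y * exp (exponent \<theta> A y) * h y) \<le> h x"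
      by (rule exponent_eigenvector[of \<theta> A], rule that)
    show ?thesis
    proof (rule empirical_sum_bound[OF Ac \<eta> \<pi> h])
      show "a < ordered_cost class_of (exponent \<theta> A) (cost_rate A c) \<sigma> m" if "m \<in> U t" "\<sigma> \<in> orders" for m \<sigma>
        using that by (simp add: U_def t)
    qed auto
  qed
  then have "\<exists>B. \<forall>t\<in>T. B t > 0 \<and> (\<forall>n\<ge>1. (\<Sum>l | length l = Suc n \<and> empirical n l \<in> U t. path_prob \<pi> Pn l) \<le> B t * (1 + \<eta>) ^ n * exp (- real n * a))"
    by (intro bchoice) blast
  then obtain B where B: "\<And>t. t \<in> T \<Longrightarrow> B t > 0"
    "\<And>t n. t \<in> T \<Longrightarrow> n \<ge> 1 \<Longrightarrow> (\<Sum>l | length l = Suc n \<and> empirical n l \<in> U t. path_prob \<pi> Pn l) \<le> B t * (1 + \<eta>) ^ n * exp (- real n * a)"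
    by blast
  have \<pi>0: "0 \<le> \<pi> x" for x using \<pi> by (simp add: prob_vector_def)
  have pp: "0 \<le> path_prob \<pi> Pn l" for l by (intro path_prob_nonneg \<pi>0 Pn_nonneg)
  \<comment> \<open>The summand 1 keeps the constant positive even if the cover \<open>T\<close> is
    empty.\<close>
  have "measure Pr {\<omega> \<in> space Pr. sample_mean f X n \<omega> \<in> S} \<le> (1 + (\<Sum>t\<in>T. B t)) * (1 + \<eta>) ^ n * exp (- real n * a)"
    if n: "n \<ge> 1" for n
  proof -
    let ?L = "\<lambda>t. {l. length l = Suc n \<and> empirical n l \<in> U t}"
    have fin: "finite (?L t)" for t by (rule finite_subset[OF _ finite_lists_length[of "Suc n"]]) auto
    have "measure Pr {\<omega> \<in> space Pr. sample_mean f X n \<omega> \<in> S} =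
        measure Pr {\<omega> \<in> space Pr. history X n \<omega> \<in> {l. ?mean (empirical n l) \<in> S}}"
      by (simp add: sample_mean_empirical)
    also have "\<dots> \<le> (\<Sum>l | length l = Suc n \<and> l \<in> {l. ?mean (empirical n l) \<in> S}. path_prob \<pi> Pn l)"
      by (rule prob_history_mem_le[OF chain])
    also have "\<dots> \<le> (\<Sum>l\<in>(\<Union>t\<in>T. ?L t). path_prob \<pi> Pn l)"
    proof (rule sum_mono2)
      show "{l. length l = Suc n \<and> l \<in> {l. ?mean (empirical n l) \<in> S}} \<subseteq> (\<Union>t\<in>T. ?L t)"
      proof
        fix l assume l: "l \<in> {l. length l = Suc n \<and> l \<in> {l. ?mean (empirical n l) \<in> S}}"
        then have "empirical n l \<in> Q" using empirical_in_simplex[of l n] n by (simp add: Q_def)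
        then show "l \<in> (\<Union>t\<in>T. ?L t)" using T(3) l by blast
      qed
    qed (use T(2) fin pp in auto)
    also have "\<dots> \<le> (\<Sum>t\<in>T. \<Sum>l\<in>?L t. path_prob \<pi> Pn l)"
      using T(2) fin pp by (intro sum_UN_le)
    also have "\<dots> \<le> (\<Sum>t\<in>T. B t * (1 + \<eta>) ^ n * exp (- real n * a))"
      using B(2) n by (intro sum_mono)
    also have "\<dots> = (\<Sum>t\<in>T. B t) * (1 + \<eta>) ^ n * exp (- real n * a)"
      by (simp add: sum_distrib_right)
    also have "\<dots> \<le> (1 + (\<Sum>t\<in>T. B t)) * (1 + \<eta>) ^ n * exp (- real n * a)"
      using \<eta> by (intro mult_right_mono) auto
    finally show ?thesis .
  qed
  moreover have "1 + (\<Sum>t\<in>T. B t) > 0" using B(1) by (intro add_pos_nonneg sum_nonneg less_imp_le) auto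
  ultimately show thesis by (rule that[rotated])
qed

text \<open>The error \<open>\<eta>\<close> is removed for each fixed \<open>a\<close>; then
  \<open>a\<close> approaches the infimum by density of the reals, which also covers an infinite
  infimum.\<close>

theorem upper_bound:
  assumes \<pi>: "prob_vector \<pi>" and chain: "nonhomogeneous_markov_chain Pr X \<pi> Pn" and S: "closed S"
  shows "limsup (\<lambda>n. ereal (1 / real n) * elog (measure Pr {\<omega> \<in> space Pr. sample_mean f X n \<omega> \<in> S}))
    \<le> - (INF z\<in>S. J z)"
    (is "?l \<le> _")
proof -
  have "?l \<le> ereal (- a)" if a: "ereal a < (INF z\<in>S. J z)" for a
  proof (rule ereal_le_epsilon2)
    fix \<eta> :: real assume \<eta>: "0 < \<eta>"
    obtain B where B: "B > 0" "\<And>n. n \<ge> 1 \<Longrightarrow>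
      measure Pr {\<omega> \<in> space Pr. sample_mean f X n \<omega> \<in> S} \<le> B * (1 + \<eta>) ^ n * exp (- real n * a)"
      by (rule probability_bound[OF \<pi> chain S a \<eta>], rule that)
    have "?l \<le> ereal (\<eta> - a)" using B(1) \<eta> B(2) by (rule limsup_log_le[OF measure_nonneg])
    then show "?l \<le> ereal (- a) + ereal \<eta>" by (simp add: algebra_simps)
  qed
  note bound = this
  show ?thesis
  proof (rule ccontr)
    assume "\<not> ?l \<le> - (INF z\<in>S. J z)"
    then have "- (INF z\<in>S. J z) < ?l" by simp
    then obtain b where b: "- (INF z\<in>S. J z) < ereal b" "ereal b < ?l" using ereal_dense2 by blast
    have "ereal (- b) < (INF z\<in>S. J z)" using b(1) by (simp add: ereal_uminus_less_reorder)
    from bound[OF this] b(2) show False by simp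
  qed
qed

end

theorem theorem3p1:
  fixes Pn :: "nat \<Rightarrow> 's::finite \<Rightarrow> 's \<Rightarrow> real"
    and P :: "'s \<Rightarrow> 's \<Rightarrow> real"
    and \<pi> :: "'s \<Rightarrow> real"
    and Pr :: "'w measure"
    and X :: "nat \<Rightarrow> 'w \<Rightarrow> 's"
    and f :: "'s \<Rightarrow> real ^ 'd"
    and N M :: nat
    and C :: "nat \<Rightarrow> 's set"
    and \<zeta> :: "nat \<Rightarrow> nat"
  assumes "\<And>n. n \<ge> 1 \<Longrightarrow> stochastic (Pn n)"
    and "stochastic P"
    and "\<And>x y. (\<lambda>n. Pn n x y) \<longlonglongrightarrow> P x y"
    and "prob_vector \<pi>"
    and "nonhomogeneous_markov_chain Pr X \<pi> Pn"
    and "class_decomposition P N M C \<zeta>"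
  defines "J \<equiv> rate_J M \<zeta> (\<lambda>i. class_rate P f (C i)) (upper_cost Pn (N + M) C)"
  shows "good_rate_function J \<and>
    (\<forall>\<Gamma> \<in> sets borel.
       limsup (\<lambda>n. ereal (1 / real n) *
           elog (measure Pr {\<omega> \<in> space Pr. sample_mean f X n \<omega> \<in> closure \<Gamma>}))
         \<le> - (INF z\<in>closure \<Gamma>. J z))"
proof -
  interpret markov_classes Pn P f N M C \<zeta>
    using assms by unfold_locales auto
  show ?thesis
    unfolding J_def using good_rate_function_J upper_bound[OF assms(4,5) closed_closure] by blast
qed

end
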